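(* Let $d\ge1$ and let $\Sigma=\Sigma_{1,2d}\subset\mathbb R^{2d+1}$ be the cone of coefficient vectors (in the monomial basis) of univariate sum-of-squares polynomials of degree at most $2d$. Then: 1. For $\mathbf e=\Lambda^*(\mathbf I)$, the coefficient vector of the polynomial $z\mapsto1+z^2+\dots+z^{2d}$, we have $k_1^{\mathbf e}\ge1$, where $k_1^{\mathbf e}=\min\{\mathbf e^{\mathrm T}\mathbf v\mid\mathbf v\in\Sigma^*,\ \|\mathbf v\|_\infty=1\}$. 2. There exist finitely many points $z_1,\dots,z_s\in\mathbb R$, unisolvent for the polynomials of degree at most $2d$, and $\alpha_1,\dots,\alpha_s>0$ such that $\mathbf M=\sum_{i=1}^s\alpha_i\,\mathbf q(z_i)\mathbf q(z_i)^{\mathrm T}$, with $\mathbf q(z)=(1,z,\dots,z^{2d})^{\mathrm T}$, satisfies $\operatorname{cond}(\mathbf M)\le 3.21^{2d+1}/2$. 3. For every $\mathbf t\in\Sigma^\circ$ and $\varepsilon>0$ with $\mathbf t-\varepsilon\mathbf e$ on the boundary of $\Sigma$ (with $\mathbf e$ as in item 1), there exists an integer dual certificate $\overline{\mathbf y}\in(\Sigma^* )^\circ\cap\mathbb Z^{2d+1}$ of $\mathbf t$ with $$\|\overline{\mathbf y}\|_\infty\le\frac12+4d^{3/2}\,3.21^{\,d+1/2}\,\frac{\lceil\|\mathbf t\|_2\rceil}{\varepsilon},$$ and which satisfies $$\log\|\overline{\mathbf y}\|_\infty\le C\bigl(1+d+\log\|\mathbf t\|_2+\log(1/\varepsilon)\bigr)$$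 with an absolute constant $C$ (independent of $d,\mathbf t,\varepsilon$).
   Context: Univariate polynomials of degree at most $2d$ are identified with their coefficient vectors in $\mathbb R^{2d+1}$ in the monomial basis, indexed $0,\dots,2d$. $\Sigma^*=\{\mathbf y\in\mathbb R^{2d+1}:\mathbf x^{\mathrm T}\mathbf y\ge0\ \forall\mathbf x\in\Sigma\}$. $\Lambda:\mathbb R^{2d+1}\to\mathbb S^{d+1}$ is the linear map sending $\mathbf x$ to its Hankel matrix $(x_{i+j})_{0\le i,j\le d}$, $\Lambda^*$ is its adjoint (with respect to the standard and Frobenius inner products), $\mathbf I$ the identity matrix. Then $\Sigma^*=\{\mathbf x:\Lambda(\mathbf x)\succcurlyeq0\}$ and $(\Sigma^* )^\circ=\{\mathbf x:\Lambda(\mathbf x)\succ0\}$; $^\circ$ denotes interior. Let $f(\mathbf x)=-\ln\det\Lambda(\mathbf x)$ on $(\Sigma^* )^\circ$, with (positive definite) Hessian $H$. A vector $\mathbf x\in(\Sigma^* )^\circ$ is a dual certificate of $\mathbf s\in\Sigma$ if $H(\mathbf x)^{-1}\mathbf s\in\Sigma^*$. $\operatorname{cond}(\mathbf M)=\lambda_{\max}(\mathbf M)/\lambda_{\min}(\mathbf M)$. A point set is unisolvent for a space of polynomials if every polynomial in it is uniquely determined by its values on the set. *)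

theory Defs
  imports
    "HOL-Analysis.Abstract_Metric_Spaces"
    "HOL-Analysis.Derivative"
    "HOL-Analysis.L2_Norm"
    "HOL-Computational_Algebra.Polynomial"
    "Jordan_Normal_Form.Determinant"
    "Jordan_Normal_Form.Gauss_Jordan_Elimination"
    "Jordan_Normal_Form.Char_Poly"
begin

unbundle no vec_syntax
unbundle no inner_syntax

text \<open>
  The dimension \<^term>\<open>2 * d + 1\<close> varies inside the theorem, since one constant has to
  serve all \<^term>\<open>d\<close>. Vectors are therefore elements of \<^term>\<open>carrier_vec n\<close>, which
  carries the Euclidean topology through the metric below.
\<close>

definition l2_norm :: "real vec \<Rightarrow> real" where
  "l2_norm v = L2_set (\<lambda>i. v $ i) {..<dim_vec v}"

definition linf_norm :: "real vec \<Rightarrow> real" where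
  "linf_norm v = Max ((\<lambda>i. \<bar>v $ i\<bar>) ` {..<dim_vec v})"

definition l2_dist :: "nat \<Rightarrow> real vec \<Rightarrow> real vec \<Rightarrow> real" where
  "l2_dist n x y = L2_set (\<lambda>i. x $ i - y $ i) {..<n}"

lemma Metric_space_l2_dist: "Metric_space (carrier_vec n) (l2_dist n)"
proof
  fix x y z :: "real vec"
  show "0 \<le> l2_dist n x y"
    by (simp add: l2_dist_def)
  show "l2_dist n x y = l2_dist n y x"
    by (simp add: l2_dist_def L2_set_def power2_commute)
  show "l2_dist n x y = 0 \<longleftrightarrow> x = y" if "x \<in> carrier_vec n" "y \<in> carrier_vec n"
    using that by (auto simp: l2_dist_def L2_set_eq_0_iff intro!: eq_vecI)
  have "l2_dist n x z = L2_set (\<lambda>i. (x $ i - y $ i) + (y $ i - z $ i)) {..<n}"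
    by (simp add: l2_dist_def)
  also have "\<dots> \<le> l2_dist n x y + l2_dist n y z"
    unfolding l2_dist_def by (rule L2_set_triangle_ineq)
  finally show "l2_dist n x z \<le> l2_dist n x y + l2_dist n y z" .
qed

lemma l2_dist_eq_l2_norm:
  "x \<in> carrier_vec n \<Longrightarrow> y \<in> carrier_vec n \<Longrightarrow> l2_dist n x y = l2_norm (x - y)"
  by (auto simp: l2_dist_def l2_norm_def intro!: L2_set_cong)

definition vec_top :: "nat \<Rightarrow> real vec topology" where
  "vec_top n = Metric_space.mtopology (carrier_vec n) (l2_dist n)"

definition integer_vec :: "real vec \<Rightarrow> bool" where
  "integer_vec v \<longleftrightarrow> (\<forall>i<dim_vec v. v $ i \<in> \<int>)"

definition coeff_vec :: "nat \<Rightarrow> real poly \<Rightarrow> real vec" where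
  "coeff_vec d p = vec (2 * d + 1) (coeff p)"

definition sum_of_squares :: "real poly \<Rightarrow> bool" where
  "sum_of_squares p \<longleftrightarrow> (\<exists>qs. p = (\<Sum>q\<leftarrow>qs. q ^ 2))"

definition sos_cone :: "nat \<Rightarrow> real vec set" where
  "sos_cone d = {coeff_vec d p | p. degree p \<le> 2 * d \<and> sum_of_squares p}"

definition sos_dual :: "nat \<Rightarrow> real vec set" where
  "sos_dual d = {y \<in> carrier_vec (2 * d + 1). \<forall>x \<in> sos_cone d. scalar_prod x y \<ge> 0}"

definition hankel :: "nat \<Rightarrow> real vec \<Rightarrow> real mat" where
  "hankel d x = mat (d + 1) (d + 1) (\<lambda>(i, j). x $ (i + j))"

definition frobenius_prod :: "real mat \<Rightarrow> real mat \<Rightarrow> real" where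
  "frobenius_prod A B = (\<Sum>i<dim_row A. \<Sum>j<dim_col A. A $$ (i, j) * B $$ (i, j))"

definition hankel_adjoint :: "nat \<Rightarrow> real mat \<Rightarrow> real vec" where
  "hankel_adjoint d S = (THE v. v \<in> carrier_vec (2 * d + 1) \<and>
     (\<forall>x \<in> carrier_vec (2 * d + 1). scalar_prod v x = frobenius_prod S (hankel d x)))"

definition e_vec :: "nat \<Rightarrow> real vec" where
  "e_vec d = hankel_adjoint d (1\<^sub>m (d + 1))"

text \<open>The set whose minimum is \<open>k\<^sub>1\<close> of \<^term>\<open>e\<close>.\<close>

definition k1_values :: "nat \<Rightarrow> real vec \<Rightarrow> real set" where
  "k1_values d e = {scalar_prod e v | v. v \<in> sos_dual d \<and> linf_norm v = 1}"

definition barrier :: "nat \<Rightarrow> real vec \<Rightarrow> real" where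
  "barrier d x = - ln (det (hankel d x))"

text \<open>
  Entry \<open>(i, j)\<close> is the mixed second partial derivative of the barrier at \<^term>\<open>x\<close>. It is
  used only at interior points of the dual cone, near which the determinant is positive.
\<close>

definition hessian :: "nat \<Rightarrow> real vec \<Rightarrow> real mat" where
  "hessian d x = mat (2 * d + 1) (2 * d + 1) (\<lambda>(i, j).
     deriv (\<lambda>a. deriv (\<lambda>b.
       barrier d (x + a \<cdot>\<^sub>v unit_vec (2 * d + 1) i + b \<cdot>\<^sub>v unit_vec (2 * d + 1) j)) 0) 0)"

definition dual_certificate :: "nat \<Rightarrow> real vec \<Rightarrow> real vec \<Rightarrow> bool" where
  "dual_certificate d x s \<longleftrightarrow>
     s \<in> sos_cone d \<and>
     x \<in> vec_top (2 * d + 1) interior_of sos_dual d \<and>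
     (\<exists>B. mat_inverse (hessian d x) = Some B \<and> B *\<^sub>v s \<in> sos_dual d)"

text \<open>Intended for matrices with a nonempty set of real eigenvalues, such as symmetric ones.\<close>

definition cond_number :: "real mat \<Rightarrow> real" where
  "cond_number M = Max {l. eigenvalue M l} / Min {l. eigenvalue M l}"

definition unisolvent :: "nat \<Rightarrow> real set \<Rightarrow> bool" where
  "unisolvent n Z \<longleftrightarrow>
     (\<forall>p r. degree p \<le> n \<and> degree r \<le> n \<and> (\<forall>z\<in>Z. poly p z = poly r z) \<longrightarrow> p = r)"

definition monomials :: "nat \<Rightarrow> real \<Rightarrow> real vec" where
  "monomials d z = vec (2 * d + 1) (\<lambda>i. z ^ i)"

definition outer_prod :: "real vec \<Rightarrow> real vec \<Rightarrow> real mat" where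
  "outer_prod v w = mat (dim_vec v) (dim_vec w) (\<lambda>(i, j). v $ i * w $ j)"

text \<open>The sum is taken entrywise because matrices of unspecified size have no additive zero.\<close>

definition moment_mat :: "nat \<Rightarrow> nat \<Rightarrow> (nat \<Rightarrow> real) \<Rightarrow> (nat \<Rightarrow> real) \<Rightarrow> real mat" where
  "moment_mat d s z \<alpha> = mat (2 * d + 1) (2 * d + 1) (\<lambda>ij.
     \<Sum>i = 1..s. (\<alpha> i \<cdot>\<^sub>m outer_prod (monomials d (z i)) (monomials d (z i))) $$ ij)"

end

theory Submission
  imports Defs "HOL-Analysis.Complex_Transcendental"
begin

unbundle no vec_syntax
unbundle no inner_syntax

text \<open>
  Well-conditioned measure: on the real line \<open>\<Sum>k<n. x ^ (2 * k)\<close> is \<open>\<bar>F x\<bar>\<^sup>2\<close> for an explicit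
  polynomial \<open>F\<close> with zeros in the lower half plane. For \<open>w\<close> in the upper half plane, Lagrange
  interpolation at the \<open>n\<close> real points where \<open>F x * (x - cnj w)\<close> is purely imaginary has equal phases
  in its terms when applied to \<open>F\<close>; this makes a discrete version of the Poisson-Jensen inequality
  \<open>\<bar>p w\<bar>\<^sup>2 \<le> \<bar>F w\<bar>\<^sup>2 * (\<Sum>c j * (p (x j))\<^sup>2 / \<bar>F (x j)\<bar>\<^sup>2)\<close> an instance of Cauchy-Schwarz. Averaging
  over \<open>w\<close> on the unit circle turns the left side into the coefficient norm, \<open>\<bar>F w\<bar>\<close> is largest at
  \<open>w = \<i>\<close>, and \<open>\<bar>F \<i>\<bar>\<^sup>2\<close> is controlled by comparing a trapezoidal sum with an integral.

  Integer certificate: maximising \<open>det\<close> on a slice of the dual cone gives \<open>y\<close> at which \<open>t\<close> is minus the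
  gradient of the barrier. Its multiples stay certificates under perturbations of local norm less than
  1, and pairing the Hessian with the measure above bounds the local norm of a rounding error by
  \<open>sqrt (cond M) * \<parallel>t\<parallel>\<close>; so rounding a sufficiently large multiple of \<open>y\<close> suffices.
\<close>

section \<open>Sampling at nodes of equal phase\<close>

text \<open>The weight \<open>1 / \<bar>F\<bar>^2\<close> is dictated by the normalisation: it gives
  the moment matrix trace 1, so the largest eigenvalue is at most 1 for free and all the work goes
  into the smallest one. The same measure reappears in the local norm for the following reason. At
  the point \<open>y\<close> with gradient \<open>- t\<close>, a factor of the inverse Hankel matrix
  has columns that are coefficient vectors of polynomials whose squares sum to \<open>t\<close>. The
  local norm of \<open>u\<close> is a Frobenius norm, and its entries pair \<open>u\<close> with
  products of two of these polynomials. The norming inequality replaces coefficient norms of the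
  products by their values, and at each node the double sum over products collapses to the square of
  the value of \<open>t\<close>. The power \<open>d powr (3 / 2)\<close> has two sources: the
  Euclidean length of a rounding error contributes a square root of the dimension, and
  \<open>t \<bullet> y = d + 1\<close>, the trace of an identity matrix, contributes the rest. Since
  the dimension depends on \<open>d\<close>, vectors have no topology from their type. Interiors and
  frontiers are handled through Euclidean balls, and the single compactness argument is moved to the
  function space \<open>nat \<Rightarrow> real\<close>.\<close>

lemma lagrange_interpolation:
  fixes p :: "complex poly" and x :: "nat \<Rightarrow> complex"
  assumes "degree p < n" and inj: "inj_on x {..<n}"
  shows "poly p w = (\<Sum>j<n. poly p (x j) * (\<Prod>l\<in>{..<n}-{j}. (w - x l) / (x j - x l)))"
proof -
  define L where "L j = (\<Prod>l\<in>{..<n}-{j}. Polynomial.smult (inverse (x j - x l)) [:- x l, 1:])" for j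
  have degL: "degree (L j) < n" if "j < n" for j
  proof -
    have "degree (L j) \<le> (\<Sum>l\<in>{..<n}-{j}. degree (Polynomial.smult (inverse (x j - x l)) [:- x l, 1:]))"
      unfolding L_def
      using degree_prod_sum_le[of "{..<n}-{j}"] unfolding o_def by blast
    also have "\<dots> \<le> (\<Sum>l\<in>{..<n}-{j}. 1)"
      by (intro sum_mono order.trans[OF degree_smult_le]) simp
    also have "\<dots> < n" using that by simp
    finally show ?thesis .
  qed
  have polyL: "poly (L j) z = (\<Prod>l\<in>{..<n}-{j}. (z - x l) / (x j - x l))" for j z
    unfolding L_def poly_prod by (intro prod.cong) (auto simp: divide_inverse algebra_simps)
  define q where "q = (\<Sum>j<n. Polynomial.smult (poly p (x j)) (L j))"
  have "p = q"
  proof (rule poly_eqI_degree[where A = "x ` {..<n}"])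
    have card: "card (x ` {..<n}) = n" using inj by (simp add: card_image)
    show "degree p < card (x ` {..<n})" using assms card by simp
    have "n > 0" using assms by simp
    then show "degree q < card (x ` {..<n})"
      unfolding q_def card using degL
      by (intro degree_sum_less) (auto intro: le_less_trans[OF degree_smult_le])
    fix z assume "z \<in> x ` {..<n}"
    then obtain k where k: "k < n" "z = x k" by auto
    have eq: "poly (L j) (x k) = (if j = k then 1 else 0)" if "j < n" for j
    proof (cases "j = k")
      case True
      have "(x k - x l) / (x k - x l) = 1" if "l \<in> {..<n} - {k}" for l
        using that inj k by (auto simp: inj_on_def)
      then show ?thesis using True by (simp add: polyL)
    next
      case False
      then have "(\<Prod>l\<in>{..<n}-{j}. (x k - x l) / (x j - x l)) = 0"
        using k by (intro prod_zero) auto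
      then show ?thesis using False by (simp add: polyL)
    qed
    have "poly q (x k) = (\<Sum>j<n. poly p (x j) * poly (L j) (x k))"
      by (simp add: q_def poly_sum)
    also have "\<dots> = (\<Sum>j<n. if j = k then poly p (x j) else 0)"
      using eq by (intro sum.cong) auto
    also have "\<dots> = poly p (x k)" using k by simp
    finally show "poly p z = poly q z" using k by simp
  qed
  then have "poly p w = poly q w" by simp
  then show ?thesis by (simp add: q_def poly_sum polyL)
qed

text \<open>Writing the argument of a point in the upper half plane through \<open>arctan\<close>
  lets continuity, strict monotonicity and the limits in \<open>x\<close> be read off from
  \<open>arctan\<close>.\<close>

lemma cis_arctan_polar:
  fixes x a b :: real
  assumes "b > 0"
  shows "Complex (x - a) b = cmod (Complex (x - a) b) *\<^sub>R cis (pi / 2 - arctan ((x - a) / b))"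
proof -
  define t where "t = (x - a) / b"
  have t: "x - a = b * t" using assms by (simp add: t_def)
  have "(x - a)\<^sup>2 + b\<^sup>2 = b\<^sup>2 * (1 + t\<^sup>2)"
    unfolding t by (simp add: power_mult_distrib distrib_left)
  then have c: "cmod (Complex (x - a) b) = b * sqrt (1 + t\<^sup>2)"
    using assms by (simp add: cmod_def real_sqrt_mult)
  have "sqrt (1 + t\<^sup>2) > 0" by (simp add: add_pos_nonneg)
  then show ?thesis
    unfolding c using assms
    by (simp add: complex_eq_iff cos_diff sin_diff sin_arctan cos_arctan t flip: t_def)
qed

text \<open>Exactly \<open>j\<close> of the nodes are larger than \<open>x j\<close>. This sign is
  what cancels the alternating sign in the phases of \<open>imaginary_nodes\<close>.\<close>

lemma prod_sign_decreasing:
  fixes x :: "nat \<Rightarrow> real"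
  assumes dec: "\<And>i j. i < j \<Longrightarrow> j < n \<Longrightarrow> x j < x i" and j: "j < n"
  shows "(\<Prod>l\<in>{..<n}-{j}. (x j - x l)) = (-1) ^ j * \<bar>\<Prod>l\<in>{..<n}-{j}. (x j - x l)\<bar>"
proof -
  have s: "{..<n}-{j} = {..<j} \<union> {Suc j..<n}" using j by auto
  have 1: "(\<Prod>l<j. (x j - x l)) = (-1) ^ j * (\<Prod>l<j. \<bar>x j - x l\<bar>)"
  proof -
    have "(\<Prod>l<j. (x j - x l)) = (\<Prod>l<j. (-1) * \<bar>x j - x l\<bar>)"
    proof (rule prod.cong)
      fix l assume "l \<in> {..<j}"
      then show "x j - x l = (-1) * \<bar>x j - x l\<bar>" using dec[of l j] j by simp
    qed simp
    then show ?thesis by (simp only: prod.distrib) simp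
  qed
  have 2: "(\<Prod>l\<in>{Suc j..<n}. (x j - x l)) = (\<Prod>l\<in>{Suc j..<n}. \<bar>x j - x l\<bar>)"
  proof (rule prod.cong)
    fix l assume "l \<in> {Suc j..<n}"
    then show "x j - x l = \<bar>x j - x l\<bar>" using dec[of j l] by simp
  qed simp
  show ?thesis unfolding s by (subst (1 2) prod.union_disjoint) (auto simp: 1 2 abs_mult abs_prod)
qed

text \<open>The argument of \<open>\<Prod>k<n. (x - a k)\<close> decreases from \<open>n\<pi>\<close> to \<open>0\<close> along the real axis
  when all \<open>a k\<close> lie in the lower half plane; the nodes are where the product is purely imaginary.\<close>

lemma imaginary_nodes:
  fixes a :: "nat \<Rightarrow> complex"
  assumes im: "\<And>k. k < n \<Longrightarrow> Im (a k) < 0"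
  obtains x :: "nat \<Rightarrow> real" where
    "\<And>i j. i < j \<Longrightarrow> j < n \<Longrightarrow> x j < x i"
    "\<And>j. j < n \<Longrightarrow> (\<Prod>k<n. of_real (x j) - a k) = \<i> * (-1) ^ j * of_real (cmod (\<Prod>k<n. of_real (x j) - a k))"
proof -
  define th where "th x = (\<Sum>k<n. pi / 2 - arctan ((x - Re (a k)) / (- Im (a k))))" for x
  have im0: "Im (a k) \<noteq> 0" if "k < n" for k using im[OF that] by simp
  have cont: "continuous_on S th" for S
    unfolding th_def using im0 by (intro continuous_intros) auto
  have anti: "th y < th x" if "x < y" "n > 0" for x y
    unfolding th_def
  proof (rule sum_strict_mono)
    fix k assume "k \<in> {..<n}"
    then have "(x - Re (a k)) / (- Im (a k)) < (y - Re (a k)) / (- Im (a k))"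
      using im \<open>x < y\<close> by (intro divide_strict_right_mono) auto
    then show "pi / 2 - arctan ((y - Re (a k)) / (- Im (a k))) < pi / 2 - arctan ((x - Re (a k)) / (- Im (a k)))"
      by (simp only: diff_less_eq arctan_less_iff) (simp add: arctan_less_iff)
  qed (use that in auto)
  have top: "filterlim (\<lambda>x. (x - Re (a k)) / (- Im (a k))) at_top at_top" if "k < n" for k
    unfolding filterlim_at_top
  proof
    fix Z
    show "\<forall>\<^sub>F x in at_top. Z \<le> (x - Re (a k)) / - Im (a k)"
      using eventually_ge_at_top[of "Z * (- Im (a k)) + Re (a k)"]
      by eventually_elim (use im[OF that] in \<open>simp add: field_simps\<close>)
  qed
  have bot: "filterlim (\<lambda>x. (x - Re (a k)) / (- Im (a k))) at_bot at_bot" if "k < n" for k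
    unfolding filterlim_at_bot
  proof
    fix Z
    show "\<forall>\<^sub>F x in at_bot. Z \<ge> (x - Re (a k)) / - Im (a k)"
      using eventually_le_at_bot[of "Z * (- Im (a k)) + Re (a k)"]
      by eventually_elim (use im[OF that] in \<open>simp add: field_simps\<close>)
  qed
  have lim_top: "(th \<longlongrightarrow> (\<Sum>k<n. pi / 2 - pi / 2)) at_top"
    unfolding th_def
    by (intro tendsto_intros filterlim_compose[OF tendsto_arctan_at_top] top) auto
  have lim_bot: "(th \<longlongrightarrow> (\<Sum>k<n. pi / 2 - (- (pi / 2)))) at_bot"
    unfolding th_def
    by (intro tendsto_intros filterlim_compose[OF tendsto_arctan_at_bot] bot) auto
  \<comment> \<open>These levels are arguments of purely imaginary numbers, and for
    \<open>j < n\<close> they lie strictly between the limits 0 and \<open>n * pi\<close> of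
    \<open>th\<close>.\<close>
  have "\<exists>x. th x = pi * (real j + 1 / 2)" if "j < n" for j
  proof -
    define tau where "tau = pi * (real j + 1 / 2)"
    have "tau > 0" unfolding tau_def by (intro mult_pos_pos) auto
    then have "\<forall>\<^sub>F x in at_top. th x < tau" using lim_top by (intro order_tendstoD) auto
    then obtain x1 where x1: "th x1 < tau" using eventually_happens trivial_limit_at_top_linorder by blast
    have "tau < pi * real n" unfolding tau_def using that by (intro mult_strict_left_mono) auto
    then have "\<forall>\<^sub>F x in at_bot. tau < th x" using lim_bot by (intro order_tendstoD) (auto simp: mult.commute)
    then obtain x0 where x0: "tau < th x0" using eventually_happens trivial_limit_at_bot_linorder by blast
    have "x0 < x1"
    proof (rule ccontr)
      assume "\<not> x0 < x1"
      then have "th x0 \<le> th x1" using anti[of x1 x0] that by (cases "x0 = x1") auto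
      then show False using x0 x1 by simp
    qed
    then show ?thesis using IVT2'[of th x1 tau x0] x0 x1 cont unfolding tau_def by auto
  qed
  then obtain x where x: "\<And>j. j < n \<Longrightarrow> th (x j) = pi * (real j + 1 / 2)" by metis
  have polar: "(\<Prod>k<n. of_real y - a k) = cmod (\<Prod>k<n. of_real y - a k) *\<^sub>R cis (th y)" for y
  proof -
    have "(\<Prod>k<n. of_real y - a k) = (\<Prod>k<n. cmod (of_real y - a k) *\<^sub>R cis (pi / 2 - arctan ((y - Re (a k)) / (- Im (a k)))))"
    proof (rule prod.cong)
      fix k assume "k \<in> {..<n}"
      moreover have "complex_of_real y - a k = Complex (y - Re (a k)) (- Im (a k))"
        by (simp add: complex_eq_iff)
      ultimately show "of_real y - a k = cmod (of_real y - a k) *\<^sub>R cis (pi / 2 - arctan ((y - Re (a k)) / (- Im (a k))))"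
        using cis_arctan_polar[of "- Im (a k)" y "Re (a k)"] im by simp
    qed simp
    also have "\<dots> = cmod (\<Prod>k<n. of_real y - a k) *\<^sub>R (\<Prod>k<n. cis (pi / 2 - arctan ((y - Re (a k)) / (- Im (a k)))))"
      by (simp add: scaleR_conv_of_real prod.distrib prod_norm flip: of_real_prod)
    also have "(\<Prod>k<n. cis (pi / 2 - arctan ((y - Re (a k)) / (- Im (a k))))) = cis (th y)"
      unfolding th_def by (induction n) (auto simp: cis_mult)
    finally show ?thesis .
  qed
  have cis: "cis (pi * (real j + 1 / 2)) = \<i> * (-1) ^ j" for j
  proof -
    have "cis (pi * (real j + 1 / 2)) = cis (pi * real j) * cis (pi / 2)"
      by (simp only: cis_mult distrib_left) simp
    also have "cis (pi * real j) = (-1) ^ j"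
      by (induction j) (simp_all add: distrib_left flip: cis_mult)
    finally show ?thesis by simp
  qed
  show thesis
  proof (rule that)
    fix i j assume ij: "i < j" "j < n"
    then have "pi * (real i + 1 / 2) < pi * (real j + 1 / 2)" by (intro mult_strict_left_mono) auto
    then have "th (x i) < th (x j)" using x ij by simp
    then have "\<not> x i \<le> x j" using anti[of "x i" "x j"] ij by (cases "x i = x j") auto
    then show "x j < x i" by simp
  next
    fix j assume "j < n"
    then show "(\<Prod>k<n. of_real (x j) - a k) = \<i> * (-1) ^ j * of_real (cmod (\<Prod>k<n. of_real (x j) - a k))"
      using polar[of "x j"] x[of j] cis[of j] by (simp add: scaleR_conv_of_real mult.commute)
  qed
qed

text \<open>For \<open>p = F\<close> all interpolation terms at \<open>w\<close> have the same
  phase, so the triangle inequality is sharp. Their moduli, normalised to total mass 1, are the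
  weights \<open>c j\<close>, a discrete stand-in for the Poisson kernel at \<open>w\<close>.
  Cauchy-Schwarz with these weights then bounds every other \<open>p\<close>.\<close>

lemma sampling_bound:
  fixes a :: "nat \<Rightarrow> complex" and w :: complex
  assumes im: "\<And>k. k < m \<Longrightarrow> Im (a k) < 0" and w: "Im w > 0"
  defines "F \<equiv> (\<lambda>z. \<Prod>k<m. z - a k)"
  obtains x :: "nat \<Rightarrow> real" and c :: "nat \<Rightarrow> real" where
    "inj_on x {..m}" "\<And>j. j \<le> m \<Longrightarrow> c j > 0" "(\<Sum>j\<le>m. c j) = 1"
    "\<And>p. degree p \<le> m \<Longrightarrow>
       (cmod (poly p w))\<^sup>2 \<le> (cmod (F w))\<^sup>2 * (\<Sum>j\<le>m. c j * (cmod (poly p (of_real (x j))))\<^sup>2 / (cmod (F (of_real (x j))))\<^sup>2)"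
proof -
  \<comment> \<open>The extra zero \<open>cnj w\<close> raises the number of nodes to
    \<open>m + 1\<close>, enough to interpolate degree \<open>m\<close>. Its factor also combines
    with the factor \<open>w - x j\<close> that the Lagrange basis leaves out into a squared
    modulus, which carries no phase.\<close>
  define a' where "a' k = (if k < m then a k else cnj w)" for k
  have "\<And>k. k < Suc m \<Longrightarrow> Im (a' k) < 0" using im w by (auto simp: a'_def)
  then obtain x :: "nat \<Rightarrow> real" where
    dec: "\<And>i j. i < j \<Longrightarrow> j < Suc m \<Longrightarrow> x j < x i" and
    ph: "\<And>j. j < Suc m \<Longrightarrow> (\<Prod>k<Suc m. of_real (x j) - a' k) = \<i> * (-1) ^ j * of_real (cmod (\<Prod>k<Suc m. of_real (x j) - a' k))"
    using imaginary_nodes[of "Suc m" a'] by metis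
  have inj: "inj_on x {..<Suc m}"
    using dec by (intro inj_onI) (metis lessThan_iff less_irrefl linorder_neqE_nat)
  have injc: "inj_on (\<lambda>j. complex_of_real (x j)) {..<Suc m}"
    using inj by (auto simp: inj_on_def)
  define G where "G j = cmod (F (of_real (x j)) * (of_real (x j) - cnj w))" for j
  have ph': "F (of_real (x j)) * (of_real (x j) - cnj w) = \<i> * (-1) ^ j * of_real (G j)" if "j < Suc m" for j
    using ph[OF that] by (simp add: a'_def F_def G_def)
  have F0: "F (of_real y) \<noteq> 0" for y by (auto simp: F_def) (metis Im_complex_of_real im less_irrefl)
  have wx: "w - of_real y \<noteq> 0" "of_real y - cnj w \<noteq> 0" for y
    using w by (auto simp: complex_eq_iff)
  define D where "D j = \<bar>\<Prod>l\<in>{..<Suc m}-{j}. (x j - x l)\<bar>" for j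
  have D: "(\<Prod>l\<in>{..<Suc m}-{j}. (of_real (x j) - of_real (x l))) = (-1) ^ j * complex_of_real (D j)" if "j < Suc m" for j
    using arg_cong[OF prod_sign_decreasing[OF dec that], where f = complex_of_real] by (simp add: D_def)
  have Dpos: "D j > 0" if "j < Suc m" for j
    using inj that by (auto simp: D_def inj_on_def)
  define W where "W = (\<Prod>l<Suc m. w - of_real (x l))"
  define s where "s j = G j / ((cmod (w - of_real (x j)))\<^sup>2 * D j)" for j
  have spos: "s j > 0" if "j < Suc m" for j
    using Dpos[OF that] F0 wx by (simp add: s_def G_def)
  define L where "L j = (\<Prod>l\<in>{..<Suc m}-{j}. (w - of_real (x l)) / (of_real (x j) - of_real (x l)))" for j
  \<comment> \<open>The sign \<open>(-1) ^ j\<close> from the denominators of the Lagrange basis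
    meets the same sign in the phase at \<open>x j\<close>; what remains besides the positive
    \<open>s j\<close> does not depend on \<open>j\<close>.\<close>
  have FL: "F (of_real (x j)) * L j = - \<i> * W * of_real (s j)" if j: "j < Suc m" for j
  proof -
    have "W = (w - of_real (x j)) * (\<Prod>l\<in>{..<Suc m}-{j}. (w - of_real (x l)))"
      using j unfolding W_def by (subst prod.remove[of _ j]) auto
    then have L: "L j = W / ((w - of_real (x j)) * ((-1) ^ j * complex_of_real (D j)))"
      using wx(1)[of "x j"] D[OF j] by (simp add: L_def prod_dividef)
    have n: "of_real ((cmod (w - of_real (x j)))\<^sup>2) = (w - of_real (x j)) * (cnj w - of_real (x j))"
      using complex_norm_square[of "w - of_real (x j)"] by (simp del: of_real_power)
    have F: "F (of_real (x j)) = - (\<i> * (-1) ^ j * of_real (G j)) / (cnj w - of_real (x j))"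
      using ph'[OF j] wx(2)[of "x j"] by (simp add: field_simps)
    have ne: "cnj w - of_real (x j) \<noteq> 0" using wx(2)[of "x j"] by auto
    have "complex_of_real (s j) = of_real (G j) / ((w - of_real (x j)) * (cnj w - of_real (x j)) * of_real (D j))"
      unfolding s_def of_real_divide of_real_mult n ..
    moreover have "- (\<i> * e * g) / c * (W / (b * (e * d))) = - \<i> * W * (g / (b * c * d))"
      if "e \<noteq> 0" for e g c b d :: complex
      using that by (cases "c = 0"; cases "b = 0"; cases "d = 0") (auto simp: field_simps)
    ultimately show ?thesis unfolding L F by (simp add: mult_ac)
  qed
  define S where "S = (\<Sum>j<Suc m. s j)"
  have "S > 0" unfolding S_def using spos by (intro sum_pos) auto
  have "F w = (\<Sum>j<Suc m. F (of_real (x j)) * L j)"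
  proof -
    define f where "f = (\<Prod>k<m. [:- a k, 1:])"
    have "degree f \<le> (\<Sum>k<m. 1)"
      unfolding f_def by (rule order.trans[OF degree_prod_sum_le]) auto
    then have "degree f < Suc m" by simp
    moreover have "poly f z = F z" for z by (simp add: f_def F_def poly_prod)
    ultimately show ?thesis using lagrange_interpolation[OF _ injc, of f w] by (simp add: L_def)
  qed
  also have "\<dots> = - \<i> * W * of_real S" unfolding S_def of_real_sum sum_distrib_left using FL by (intro sum.cong) auto
  finally have Fw: "cmod (F w) = cmod W * S" using \<open>S > 0\<close> by (simp add: norm_mult)
  have Lnorm: "cmod (L j) = cmod W * s j / cmod (F (of_real (x j)))" if "j < Suc m" for j
    using arg_cong[OF FL[OF that], where f = cmod] F0[of "x j"] spos[OF that] by (simp add: norm_mult field_simps)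
  show thesis
  proof (rule that[of x "\<lambda>j. s j / S"])
    show "inj_on x {..m}" using inj by (simp add: lessThan_Suc_atMost)
    show "\<And>j. j \<le> m \<Longrightarrow> s j / S > 0" using spos \<open>S > 0\<close> by simp
    show "(\<Sum>j\<le>m. s j / S) = 1" using \<open>S > 0\<close>
      by (simp add: S_def lessThan_Suc_atMost flip: sum_divide_distrib)
    fix p :: "complex poly" assume p: "degree p \<le> m"
    define u where "u j = cmod (poly p (of_real (x j))) / cmod (F (of_real (x j)))" for j
    have "poly p w = (\<Sum>j<Suc m. poly p (of_real (x j)) * L j)"
      using lagrange_interpolation[OF _ injc, of p w] p by (simp add: L_def)
    then have "cmod (poly p w) \<le> (\<Sum>j<Suc m. cmod (poly p (of_real (x j)) * L j))"
      using norm_sum by metis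
    also have "\<dots> = (\<Sum>j<Suc m. cmod W * (s j * u j))"
      using Lnorm by (intro sum.cong) (auto simp: norm_mult u_def)
    also have "\<dots> = cmod W * (\<Sum>j<Suc m. s j * u j)" by (simp only: sum_distrib_left)
    finally have "(cmod (poly p w))\<^sup>2 \<le> (cmod W)\<^sup>2 * (\<Sum>j<Suc m. s j * u j)\<^sup>2"
      unfolding power_mult_distrib[symmetric] by (intro power_mono) auto
    \<comment> \<open>Splitting each weight into two square roots makes the first factor the total
      mass \<open>S\<close>, which together with the modulus of \<open>W\<close> rebuilds the
      modulus of \<open>F w\<close>.\<close>
    also have "(\<Sum>j<Suc m. s j * u j)\<^sup>2 \<le> (\<Sum>j<Suc m. (sqrt (s j))\<^sup>2) * (\<Sum>j<Suc m. (sqrt (s j) * u j)\<^sup>2)"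
    proof -
      have "s j * u j = sqrt (s j) * (sqrt (s j) * u j)" if "j < Suc m" for j
        using spos[OF that] by (simp flip: mult.assoc)
      then have "(\<Sum>j<Suc m. s j * u j) = (\<Sum>j<Suc m. sqrt (s j) * (sqrt (s j) * u j))"
        by (intro sum.cong) auto
      then show ?thesis using Cauchy_Schwarz_ineq_sum by metis
    qed
    also have "(\<Sum>j<Suc m. (sqrt (s j))\<^sup>2) = S"
      unfolding S_def using spos by (intro sum.cong) (auto simp: less_imp_le)
    also have "(\<Sum>j<Suc m. (sqrt (s j) * u j)\<^sup>2) = (\<Sum>j<Suc m. s j * (u j)\<^sup>2)"
      using spos by (intro sum.cong) (auto simp: power_mult_distrib less_imp_le)
    also have "(cmod W)\<^sup>2 * (S * (\<Sum>j<Suc m. s j * (u j)\<^sup>2)) = (cmod (F w))\<^sup>2 * (\<Sum>j<Suc m. s j / S * (u j)\<^sup>2)"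
      unfolding Fw using \<open>S > 0\<close> by (simp add: power2_eq_square flip: sum_divide_distrib)
    finally show "(cmod (poly p w))\<^sup>2 \<le> (cmod (F w))\<^sup>2 *
        (\<Sum>j\<le>m. s j / S * (cmod (poly p (of_real (x j))))\<^sup>2 / (cmod (F (of_real (x j))))\<^sup>2)"
      by (simp add: mult_left_mono u_def power_divide lessThan_Suc_atMost)
  qed
qed

section \<open>The constant 3.21\<close>

text \<open>The trapezoidal rule overestimates the integral of a convex function. For powers this is
  algebra: the left side is \<open>b - a\<close> times the average of the products
  \<open>a ^ i * b ^ (j - i)\<close>, and the products for \<open>i\<close> and for
  \<open>j - i\<close> together are at most \<open>a ^ j + b ^ j\<close>.\<close>

lemma even_power_trapezoid:
  fixes a b :: real
  assumes "a \<le> b" "even j"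
  shows "(b ^ Suc j - a ^ Suc j) / Suc j \<le> (b - a) * (a ^ j + b ^ j) / 2"
proof -
  have pair: "a ^ i * b ^ (j - i) + a ^ (j - i) * b ^ i \<le> a ^ j + b ^ j" if "i \<le> j" for i
  proof -
    \<comment> \<open>For even \<open>j\<close> the exponents \<open>i\<close> and
      \<open>j - i\<close> have the same parity, so the two differences cannot have opposite signs:
      even powers are ordered by absolute value, odd powers by the numbers themselves.\<close>
    have "0 \<le> (a ^ i - b ^ i) * (a ^ (j - i) - b ^ (j - i))"
    proof (cases "even i")
      case True
      then have ev: "even (j - i)" using assms that by simp
      have e: "a ^ i = \<bar>a\<bar> ^ i" "b ^ i = \<bar>b\<bar> ^ i" "a ^ (j - i) = \<bar>a\<bar> ^ (j - i)" "b ^ (j - i) = \<bar>b\<bar> ^ (j - i)"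
        using True ev by (simp_all add: power_even_abs)
      show ?thesis
      proof (cases "\<bar>a\<bar> \<le> \<bar>b\<bar>")
        case True
        then show ?thesis unfolding e by (intro mult_nonpos_nonpos) (simp_all add: power_mono)
      next
        case False
        then show ?thesis unfolding e by (intro mult_nonneg_nonneg) (simp_all add: power_mono)
      qed
    next
      case False
      then have "odd (j - i)" using assms that by simp
      then show ?thesis using False assms(1)
        by (intro mult_nonpos_nonpos) (simp_all add: power_mono_odd)
    qed
    moreover have "a ^ j = a ^ i * a ^ (j - i)" "b ^ j = b ^ i * b ^ (j - i)"
      using that by (simp_all flip: power_add)
    ultimately show ?thesis by (simp add: algebra_simps)
  qed
  have sw: "(\<Sum>i<Suc j. a ^ i * b ^ (j - i)) = (\<Sum>i<Suc j. a ^ (j - i) * b ^ i)"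
    by (subst sum.nat_diff_reindex[symmetric]) (auto intro!: sum.cong)
  have "2 * (\<Sum>i<Suc j. a ^ i * b ^ (j - i)) = (\<Sum>i<Suc j. a ^ i * b ^ (j - i) + a ^ (j - i) * b ^ i)"
    using sw by (simp only: sum.distrib mult_2)
  also have "\<dots> \<le> (\<Sum>i<Suc j. a ^ j + b ^ j)" using pair by (intro sum_mono) auto
  also have "\<dots> = Suc j * (a ^ j + b ^ j)" by simp
  finally have "(\<Sum>i<Suc j. a ^ i * b ^ (j - i)) / Suc j \<le> (a ^ j + b ^ j) / 2"
    by (simp add: field_simps del: sum.lessThan_Suc)
  then have "(b - a) * ((\<Sum>i<Suc j. a ^ i * b ^ (j - i)) / Suc j) \<le> (b - a) * ((a ^ j + b ^ j) / 2)"
    using assms(1) by (intro mult_left_mono) auto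
  moreover have "b ^ Suc j - a ^ Suc j = (b - a) * (\<Sum>i<Suc j. a ^ i * b ^ (j - i))"
    using power_diff_sumr2[of b "Suc j" a] sw by (simp add: mult.commute del: sum.lessThan_Suc)
  ultimately show ?thesis by simp
qed

text \<open>This is the trapezoidal rule on [-1, 1]; the two endpoints, each of weight 1/2 and value
  1, account for the \<open>+ 1\<close>. A lower bound is what is wanted, because even powers enter
  the expansion of \<open>ln (cos x)\<close> with negative coefficients.\<close>

lemma sum_even_power_grid_ge:
  assumes "even j" "n > 0"
  shows "real n / Suc j \<le> (\<Sum>k=1..<n. (2 * real k / real n - 1) ^ j) + 1"
proof -
  define u where "u k = 2 * real k / real n - 1" for k
  have du: "u (Suc k) - u k = 2 / n" for k by (simp add: u_def add_divide_distrib algebra_simps)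
  have "2 / Suc j = (\<Sum>k<n. (u (Suc k) ^ Suc j - u k ^ Suc j) / Suc j)"
    using assms unfolding sum_divide_distrib[symmetric] sum_lessThan_telescope[of "\<lambda>k. u k ^ Suc j"] by (simp add: u_def)
  also have "\<dots> \<le> (\<Sum>k<n. (u (Suc k) - u k) * (u k ^ j + u (Suc k) ^ j) / 2)"
  proof (rule sum_mono)
    fix k
    have "u k \<le> u (Suc k)" using du[of k] by (smt (verit) divide_nonneg_nonneg of_nat_0_le_iff)
    from even_power_trapezoid[OF this assms(1)]
    show "(u (Suc k) ^ Suc j - u k ^ Suc j) / Suc j \<le> (u (Suc k) - u k) * (u k ^ j + u (Suc k) ^ j) / 2" by simp
  qed
  also have "\<dots> = 1 / n * ((\<Sum>k<n. u k ^ j) + (\<Sum>k<n. u (Suc k) ^ j))"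
    unfolding du sum.distrib[symmetric] sum_distrib_left
    by (intro sum.cong) (simp_all add: add_divide_distrib flip: mult.assoc)
  also have "(\<Sum>k<n. u k ^ j) = 1 + (\<Sum>k=1..<n. u k ^ j)"
    using assms by (simp add: lessThan_atLeast0 sum.atLeast_Suc_lessThan u_def)
  also have "(\<Sum>k<n. u (Suc k) ^ j) = (\<Sum>k=1..<Suc n. u k ^ j)"
    using sum.shift_bounds_Suc_ivl[of "\<lambda>k. u k ^ j" 0 n] by (simp add: lessThan_atLeast0)
  also have "\<dots> = (\<Sum>k=1..<n. u k ^ j) + 1"
    using assms by (simp add: u_def)
  finally have "2 / real (Suc j) \<le> 2 / n * ((\<Sum>k=1..<n. u k ^ j) + 1)" by (simp add: field_simps)
  then show ?thesis using assms(2) unfolding u_def by (simp add: field_simps)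
qed

text \<open>The sharp constant behind 3.21 is \<open>exp (4 * G / \<pi>) = 3.2099\<dots>\<close> with Catalan's constant \<open>G\<close>,
  so little room is left that the expansion of \<open>ln (cos x)\<close> is needed up to degree 10.\<close>

lemma tan_ge_taylor:
  fixes x :: real
  assumes "0 \<le> x" "x < pi / 2"
  shows "x + x^3/3 + 2*x^5/15 + 17*x^7/315 + 62*x^9/2835 \<le> tan x"
proof -
  define P where "P x = x + x^3/3 + 2*x^5/15 + 17*x^7/315 + 62*x^9/2835" for x :: real
  define P' where "P' x = 1 + x^2 + 2*x^4/3 + 17*x^6/45 + 62*x^8/315" for x :: real
  have dP: "(P has_real_derivative P' t) (at t)" for t
    unfolding P_def P'_def by (auto intro!: derivative_eq_intros)
  \<comment> \<open>The Taylor polynomial is a subsolution of \<open>y' = 1 + y ^ 2\<close>, the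
    differential equation of \<open>tan\<close>, so \<open>arctan (P t) - t\<close> cannot
    increase.\<close>
  have le: "P' t \<le> 1 + (P t)\<^sup>2" if "t \<ge> 0" for t
  proof -
    define A where "A = 2835 + 945*t^2 + 378*t^4 + 153*t^6 + 62*t^8"
    define B where "B = 2835 + 2835*t^2 + 1890*t^4 + 1071*t^6 + 558*t^8"
    have PA: "P t = t * A / 2835" and PB: "P' t = B / 2835"
      by (simp_all add: P_def P'_def A_def B_def field_simps power_numeral_reduce)
    have "2835\<^sup>2 + t\<^sup>2 * A\<^sup>2 - 2835 * B = 783594*t^10 + 232848*t^12 + 70281*t^14 + 18972*t^16 + 3844*t^18"
      unfolding A_def B_def by (simp add: power_numeral_reduce algebra_simps)
    then have "1 + (P t)\<^sup>2 - P' t = (783594*t^10 + 232848*t^12 + 70281*t^14 + 18972*t^16 + 3844*t^18) / 2835\<^sup>2"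
      unfolding PA PB by (simp add: power_mult_distrib power_divide divide_simps)
    moreover have "\<dots> \<ge> 0" using that by (intro divide_nonneg_nonneg add_nonneg_nonneg) auto
    ultimately show ?thesis by (metis diff_ge_0_iff_ge)
  qed
  have "arctan (P x) - x \<le> arctan (P 0) - 0"
  proof (rule DERIV_nonpos_imp_nonincreasing[OF assms(1)])
    fix t assume t: "0 \<le> t" "t \<le> x"
    have "((\<lambda>t. arctan (P t) - t) has_real_derivative P' t / (1 + (P t)\<^sup>2) - 1) (at t)"
      using dP[of t] by (auto intro!: derivative_eq_intros simp: divide_inverse)
    moreover have "P' t / (1 + (P t)\<^sup>2) - 1 \<le> 0"
      using le[OF t(1)] by (simp add: divide_le_eq add_pos_nonneg)
    ultimately show "\<exists>y. ((\<lambda>t. arctan (P t) - t) has_real_derivative y) (at t) \<and> y \<le> 0" by blast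
  qed
  then have "arctan (P x) \<le> x" by (simp add: P_def)
  then have "tan (arctan (P x)) \<le> tan x"
    using assms by (intro tan_mono_le arctan_lbound) auto
  then show ?thesis by (simp add: tan_arctan P_def)
qed

text \<open>Integration of \<open>tan_ge_taylor\<close> from 0, with evenness covering negative
  \<open>x\<close>.\<close>

lemma ln_cos_le:
  fixes x :: real
  assumes "\<bar>x\<bar> < pi / 2"
  shows "ln (cos x) \<le> - (x^2/2 + x^4/12 + x^6/45 + 17*x^8/2520 + 31*x^10/14175)"
proof -
  define Q where "Q x = x^2/2 + x^4/12 + x^6/45 + 17*x^8/2520 + 31*x^10/14175" for x :: real
  have *: "ln (cos x) + Q x \<le> 0" if x: "0 \<le> x" "x < pi / 2" for x
  proof -
    have "ln (cos x) + Q x \<le> ln (cos 0) + Q 0"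
    proof (rule DERIV_nonpos_imp_nonincreasing[OF x(1)])
      fix t assume t: "0 \<le> t" "t \<le> x"
      then have c: "cos t > 0" using x by (intro cos_gt_zero_pi) auto
      have "((\<lambda>t. ln (cos t) + Q t) has_real_derivative - tan t + (t + t^3/3 + 2*t^5/15 + 17*t^7/315 + 62*t^9/2835)) (at t)"
        unfolding Q_def using c by (auto intro!: derivative_eq_intros simp: tan_def)
      moreover have "- tan t + (t + t^3/3 + 2*t^5/15 + 17*t^7/315 + 62*t^9/2835) \<le> 0"
        using tan_ge_taylor[of t] t x by simp
      ultimately show "\<exists>y. ((\<lambda>t. ln (cos t) + Q t) has_real_derivative y) (at t) \<and> y \<le> 0" by blast
    qed
    then show ?thesis by (simp add: Q_def)
  qed
  have "ln (cos x) = ln (cos \<bar>x\<bar>)" "Q x = Q \<bar>x\<bar>"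
    by (simp_all add: Q_def power_even_abs)
  then show ?thesis using *[of "\<bar>x\<bar>"] assms unfolding Q_def by simp
qed

text \<open>The product is the squared modulus of \<open>outer_poly n\<close> at
  \<open>\<i>\<close>. Since \<open>1 + cos (2 * x) = 2 * (cos x) ^ 2\<close>, its logarithm is a
  sum of \<open>2 * ln 2 + 2 * ln (cos (pi / 4 * u))\<close> over a uniform grid in (-1, 1). Each
  term is bounded by an even polynomial, whose grid sum is then compared with its integral.\<close>

lemma prod_two_plus_two_sin_le:
  assumes "n > 0"
  shows "(\<Prod>k=1..<n. 2 + 2 * sin (pi * real k / real n)) \<le> 3.21 ^ n / 2"
proof -
  define u where "u k = 2 * real k / real n - 1" for k
  define y where "y = (pi / 4)\<^sup>2"
  define q where "q t = t^2/2 + t^4/12 + t^6/45 + 17*t^8/2520 + 31*t^10/14175" for t :: real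
  have pi4: "pi / 4 \<ge> 0.785397" using pi_approx(1) by simp
  have y: "y \<ge> 0.616848" unfolding y_def using power_mono[OF pi4, of 2] by (simp add: power2_eq_square)
  have qu: "q (pi / 4 * t) = y/2 * t^2 + y^2/12 * t^4 + y^3/45 * t^6 + 17*y^4/2520 * t^8 + 31*y^5/14175 * t^10" for t
    unfolding q_def y_def by (simp only: power_mult_distrib flip: power_mult) simp
  have u: "\<bar>u k\<bar> < 1" if "k \<in> {1..<n}" for k
    using that by (auto simp: u_def abs_less_iff field_simps)
  have fac: "2 + 2 * sin (pi * real k / real n) = exp (2 * ln 2 + 2 * ln (cos (pi / 4 * u k)))"
    and cpos: "cos (pi / 4 * u k) > 0" if k: "k \<in> {1..<n}" for k
  proof -
    have "\<bar>pi / 4 * u k\<bar> < pi / 4 * 1" unfolding abs_mult using u[OF k] by simp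
    also have "\<dots> \<le> pi / 2" by simp
    finally have "\<bar>pi / 4 * u k\<bar> < pi / 2" .
    then show c: "cos (pi / 4 * u k) > 0" by (intro cos_gt_zero_pi) linarith+
    have "pi * real k / real n = pi / 2 + 2 * (pi / 4 * u k)"
      using assms by (simp add: u_def field_simps)
    then have "sin (pi * real k / real n) = cos (2 * (pi / 4 * u k))" by (simp only: sin_cos_eq) simp
    also have "\<dots> = 2 * (cos (pi / 4 * u k))\<^sup>2 - 1" by (rule cos_double_cos)
    finally have "2 + 2 * sin (pi * real k / real n) = (2 * cos (pi / 4 * u k))\<^sup>2" by (simp add: power2_eq_square)
    also have "\<dots> = exp (ln (2 * cos (pi / 4 * u k)) * 2)" using c by (subst mult.commute, subst exp_double, subst exp_ln) auto
    finally show "2 + 2 * sin (pi * real k / real n) = exp (2 * ln 2 + 2 * ln (cos (pi / 4 * u k)))"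
      using c by (simp add: ln_mult mult.commute)
  qed
  have U: "(\<Sum>k=1..<n. u k ^ j) \<ge> real n / Suc j - 1" if "even j" for j
    using sum_even_power_grid_ge[OF that assms] by (simp add: u_def)
  have "(\<Sum>k=1..<n. 2 * ln 2 + 2 * ln (cos (pi / 4 * u k))) \<le> (\<Sum>k=1..<n. 2 * ln 2 - 2 * q (pi / 4 * u k))"
  proof (rule sum_mono)
    fix k assume k: "k \<in> {1..<n}"
    have "\<bar>pi / 4 * u k\<bar> < pi / 4 * 1" unfolding abs_mult using u[OF k] by simp
    also have "\<dots> \<le> pi / 2" by simp
    finally have "\<bar>pi / 4 * u k\<bar> < pi / 2" .
    from ln_cos_le[OF this] show "2 * ln 2 + 2 * ln (cos (pi / 4 * u k)) \<le> 2 * ln 2 - 2 * q (pi / 4 * u k)"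
      by (simp add: q_def)
  qed
  also have "\<dots> = real (n - 1) * (2 * ln 2) - 2 * (y/2 * (\<Sum>k=1..<n. u k ^ 2) + y^2/12 * (\<Sum>k=1..<n. u k ^ 4)
      + y^3/45 * (\<Sum>k=1..<n. u k ^ 6) + 17*y^4/2520 * (\<Sum>k=1..<n. u k ^ 8) + 31*y^5/14175 * (\<Sum>k=1..<n. u k ^ 10))"
    unfolding qu by (simp only: sum_subtractf sum.distrib sum_distrib_left[symmetric]) simp
  also have "\<dots> \<le> real (n - 1) * (2 * ln 2) - 2 * (y/2 * (n / 3 - 1) + y^2/12 * (n / 5 - 1)
      + y^3/45 * (n / 7 - 1) + 17*y^4/2520 * (n / 9 - 1) + 31*y^5/14175 * (n / 11 - 1))"
    using U[of 2] U[of 4] U[of 6] U[of 8] U[of 10] y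
    by (intro diff_left_mono mult_left_mono add_mono) auto
  also have "\<dots> = real n * (2 * ln 2 - 2 * (y/6 + y^2/60 + y^3/315 + 17*y^4/22680 + 31*y^5/155925)) - 2 * ln 2 + 2 * q (pi / 4)"
    using qu[of 1] assms by (simp add: of_nat_diff Suc_leI field_simps)
  \<comment> \<open>The endpoint corrections of the trapezoidal rule contribute
    \<open>2 * q (pi / 4)\<close>, at most \<open>- 2 * ln (cos (pi / 4)) = ln 2\<close>. Against
    the \<open>- 2 * ln 2\<close> that comes from having only \<open>n - 1\<close> factors this
    leaves \<open>- ln 2\<close>, which is the division by 2 in the bound.\<close>
  also have "\<dots> \<le> real n * (2 * ln 2 - 2 * (y/6 + y^2/60 + y^3/315 + 17*y^4/22680 + 31*y^5/155925)) - ln 2"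
  proof -
    have "ln (cos (pi / 4)) = ln (sqrt 2) - ln 2" by (simp add: cos_45 ln_div)
    also have "\<dots> = - ln 2 / 2" by (simp add: ln_sqrt)
    finally have "2 * q (pi / 4) \<le> ln 2" using ln_cos_le[of "pi / 4"] by (simp add: q_def)
    then show ?thesis by simp
  qed
  also have "\<dots> \<le> real n * ln 3.21 - ln 2"
  proof -
    define S where "S = 2 * (y/6 + y^2/60 + y^3/315 + 17*y^4/22680 + 31*y^5/155925)"
    \<comment> \<open>The number 0.22004 separates \<open>ln (400 / 321)\<close>, about 0.220023,
      from \<open>S\<close>. For the comparison with the exponential it is divided by 16, which
      makes the quadratic Taylor bound accurate enough for so narrow a gap.\<close>
    have "22004 / 100000 \<le> 2 * (0.616848/6 + 0.616848^2/60 + 0.616848^3/315 + 17*0.616848^4/22680 + 31*0.616848^5/(155925::real))"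
      by (simp add: power_numeral_reduce)
    also have "\<dots> \<le> S" unfolding S_def using y
      by (intro mult_left_mono add_mono divide_right_mono power_mono) auto
    finally have S: "22004 / 100000 \<le> S" .
    have "(400 / 321 :: real) \<le> (1 + 22004/1600000 + (22004/1600000)\<^sup>2 / 2) ^ 16"
      by (simp add: power_numeral_reduce)
    also have "\<dots> \<le> exp (22004/1600000) ^ 16"
      by (intro power_mono exp_lower_Taylor_quadratic) auto
    also have "\<dots> = exp (22004 / 100000)" by (simp flip: exp_of_nat_mult)
    also have "\<dots> \<le> exp S" using S by simp
    finally have "ln (400 / 321) \<le> ln (exp S)" by (subst ln_le_cancel_iff) auto
    then have "ln (400 / 321) \<le> S" by simp
    moreover have "ln (400 / 321) = 2 * ln 2 - ln (3.21::real)"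
    proof -
      have "ln (400 / 321) = ln (2 * 2 / (3.21::real))" by simp
      also have "\<dots> = ln 2 + ln 2 - ln 3.21" by (simp only: ln_div ln_mult zero_less_numeral zero_less_divide_iff mult_pos_pos) (simp add: ln_div)
      finally show ?thesis by simp
    qed
    ultimately have "2 * ln 2 - S \<le> ln 3.21" by simp
    then show ?thesis unfolding S_def[symmetric] by (simp add: mult_left_mono)
  qed
  finally have "exp (\<Sum>k=1..<n. 2 * ln 2 + 2 * ln (cos (pi / 4 * u k))) \<le> exp (real n * ln 3.21 - ln 2)" by simp
  then have "(\<Prod>k=1..<n. 2 + 2 * sin (pi * real k / real n)) \<le> exp (real n * ln 3.21 - ln 2)"
    using fac by (simp add: exp_sum)
  also have "\<dots> = 3.21 ^ n / 2"
    by (simp only: exp_diff exp_of_nat_mult) (simp add: exp_diff)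
  finally show ?thesis .
qed

section \<open>The norming measure\<close>

lemma sum_rotate:
  "(\<Sum>l\<in>C. \<Sum>i\<in>A. \<Sum>j\<in>B. f i j l) = (\<Sum>i\<in>A. \<Sum>j\<in>B. \<Sum>l\<in>C. f i j l)"
  by (subst sum.swap) (intro sum.cong refl sum.swap)

text \<open>Multiplication by \<open>sin h\<close> makes the sum telescope, and
  \<open>\<bar>r\<bar> < 2 * n\<close> keeps \<open>h\<close> away from the zeros of the
  sine.\<close>

lemma sum_cos_grid_eq_0:
  fixes r :: int
  assumes "r \<noteq> 0" "\<bar>r\<bar> < 2 * int n"
  shows "(\<Sum>l<n. cos (of_int r * (pi * (2 * real l + 1) / (2 * real n)))) = 0"
proof -
  define h where "h = of_int r * pi / (2 * real n)"
  have n: "n > 0" using assms by (cases n) auto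
  have "\<bar>real_of_int r\<bar> < 2 * real n" using assms(2) by linarith
  then have "\<bar>h\<bar> < pi" using n by (simp add: h_def abs_mult field_simps)
  moreover have "h \<noteq> 0" using n assms by (simp add: h_def)
  ultimately have "sin h \<noteq> 0" using sin_eq_0_pi[of h] by (auto simp: abs_less_iff)
  have "sin h * cos (of_int r * (pi * (2 * real l + 1) / (2 * real n))) = (sin (2 * real (Suc l) * h) - sin (2 * real l * h)) / 2" for l
  proof -
    have "of_int r * (pi * (2 * real l + 1) / (2 * real n)) = (2 * real l + 1) * h" by (simp add: h_def)
    moreover have "2 * real (Suc l) * h = (2 * real l + 1) * h + h" "2 * real l * h = (2 * real l + 1) * h - h"
      by (simp_all add: algebra_simps)
    ultimately show ?thesis by (simp add: sin_add sin_diff)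
  qed
  then have "sin h * (\<Sum>l<n. cos (of_int r * (pi * (2 * real l + 1) / (2 * real n)))) = (\<Sum>l<n. sin (2 * real (Suc l) * h) - sin (2 * real l * h)) / 2"
    unfolding sum_distrib_left sum_divide_distrib by (intro sum.cong refl)
  also have "\<dots> = sin (2 * real n * h) / 2"
    unfolding sum_lessThan_telescope[of "\<lambda>l. sin (2 * real l * h)"] by simp
  also have "2 * real n * h = of_int r * pi" using n by (simp add: h_def)
  also have "sin (of_int r * pi) = 0" by (simp add: sin_zero_iff_int2)
  finally show ?thesis using \<open>sin h \<noteq> 0\<close> by simp
qed

text \<open>A discrete Parseval identity. The nodes are the solutions of
  \<open>z ^ (2 * n) = - 1\<close> in the upper half plane, where \<open>sampling_bound\<close>
  applies; as the \<open>v k\<close> are real, their conjugates would contribute the same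
  amount.\<close>

lemma sum_norm_sq_grid:
  fixes v :: "nat \<Rightarrow> real"
  shows "(\<Sum>l<n. (cmod (\<Sum>k<n. of_real (v k) * cis (pi * (2 * real l + 1) / (2 * real n)) ^ k))\<^sup>2) = real n * (\<Sum>k<n. (v k)\<^sup>2)"
proof -
  define th where "th l = pi * (2 * real l + 1) / (2 * real n)" for l
  have sq: "(cmod (\<Sum>k<n. of_real (v k) * cis t ^ k))\<^sup>2 = (\<Sum>j<n. \<Sum>k<n. v j * v k * cos (of_int (int j - int k) * t))" for t
  proof -
    have "cos (of_int (int j - int k) * t) = cos (real j * t) * cos (real k * t) + sin (real j * t) * sin (real k * t)" for j k
      by (simp add: left_diff_distrib cos_diff)
    then have "(\<Sum>j<n. \<Sum>k<n. v j * v k * cos (of_int (int j - int k) * t)) = (\<Sum>j<n. v j * cos (real j * t))\<^sup>2 + (\<Sum>j<n. v j * sin (real j * t))\<^sup>2"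
      by (simp add: power2_eq_square sum_product algebra_simps sum.distrib)
    then show ?thesis unfolding cmod_power2 Complex.DeMoivre by simp
  qed
  have "(\<Sum>l<n. (cmod (\<Sum>k<n. of_real (v k) * cis (th l) ^ k))\<^sup>2) = (\<Sum>l<n. \<Sum>j<n. \<Sum>k<n. v j * v k * cos (of_int (int j - int k) * th l))"
    by (simp only: sq)
  also have "\<dots> = (\<Sum>j<n. \<Sum>k<n. \<Sum>l<n. v j * v k * cos (of_int (int j - int k) * th l))"
    by (rule sum_rotate)
  also have "\<dots> = (\<Sum>j<n. \<Sum>k<n. v j * v k * (if j = k then real n else 0))"
  proof (intro sum.cong refl)
    fix j k assume "j \<in> {..<n}" "k \<in> {..<n}"
    then have "j \<noteq> k \<Longrightarrow> (\<Sum>l<n. cos (of_int (int j - int k) * th l)) = 0"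
      using sum_cos_grid_eq_0[of "int j - int k" n] by (simp add: th_def)
    then show "(\<Sum>l<n. v j * v k * cos (of_int (int j - int k) * th l)) = v j * v k * (if j = k then real n else 0)"
      by (simp flip: sum_distrib_left)
  qed
  also have "\<dots> = (\<Sum>j<n. real n * (v j)\<^sup>2)"
    by (intro sum.cong refl) (simp add: if_distrib[of "\<lambda>t. _ * t"] power2_eq_square cong: if_cong)
  finally show ?thesis by (simp add: th_def sum_distrib_left)
qed

text \<open>The outer function of the upper half plane whose squared modulus on the real line is
  \<open>\<Sum>k<n. x ^ (2 * k)\<close>; its zeros are the solutions of \<open>z ^ (2 * n) = 1\<close> in the lower half plane.\<close>

definition outer_poly :: "nat \<Rightarrow> complex \<Rightarrow> complex" where
  "outer_poly n z = (\<Prod>k<n - 1. z - cis (- (pi * real (Suc k) / real n)))"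

lemma outer_poly_alt: "outer_poly n z = (\<Prod>l\<in>{1..<n}. z - cis (- (pi * real l / real n)))"
  unfolding outer_poly_def by (rule prod.reindex_bij_witness[of _ "\<lambda>l. l - 1" Suc]) auto

text \<open>The sum is \<open>(x ^ (2 * n) - 1) / (x ^ 2 - 1)\<close>, the product over all
  \<open>2 * n\<close>-th roots of unity except 1 and -1. The roots in the upper half plane are the
  conjugates of the zeros of \<open>outer_poly n\<close>.\<close>

lemma norm_outer_poly_real:
  assumes "n > 0"
  shows "(cmod (outer_poly n (of_real x)))\<^sup>2 = (\<Sum>k<n. x ^ (2 * k))"
proof -
  define ph where "ph l = pi * real l / real n" for l
  define I where "I = {1..<2 * n} - {n}"
  have bij: "bij_betw (\<lambda>l. cis (ph l)) {..<2 * n} {z. z ^ (2 * n) = 1}"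
  proof -
    have "cis (2 * pi * real l / real (2 * n)) = cis (ph l)" for l by (simp add: ph_def)
    then show ?thesis using Complex.bij_betw_roots_unity[of "2 * n"] assms by (simp only: mult_pos_pos zero_less_numeral)
  qed
  have inj: "inj_on (\<lambda>l. cis (ph l)) {..<2 * n}" using bij by (rule bij_betw_imp_inj_on)
  have I: "I \<subseteq> {..<2 * n}" "finite I" "card I = 2 * n - 2"
    using assms by (auto simp: I_def)
  let ?A = "\<Prod>l\<in>I. [:- cis (ph l), 1:]"
  have deg: "degree ?A = 2 * n - 2"
    by (subst degree_prod_eq_sum_degree) (auto simp: I)
  have lc: "lead_coeff ?A = 1"
    by (simp add: lead_coeff_prod)
  have degB: "degree (\<Sum>k<n. monom (1::complex) (2 * k)) \<le> 2 * n - 2"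
    by (intro degree_sum_le) (auto intro!: order.trans[OF degree_monom_le])
  \<comment> \<open>Both sides are monic of degree \<open>2 * n - 2\<close>, so agreement at the
    \<open>2 * n - 2\<close> roots is enough.\<close>
  have "?A = (\<Sum>k<n. monom 1 (2 * k))"
  proof (rule poly_eqI_degree_lead_coeff[where n = "2 * n - 2" and A = "(\<lambda>l. cis (ph l)) ` I"])
    have "coeff (\<Sum>k<n. monom (1::complex) (2 * k)) (2 * n - 2) = (\<Sum>k<n. if k = n - 1 then 1 else 0)"
      unfolding coeff_sum by (intro sum.cong) auto
    then show "coeff ?A (2 * n - 2) = coeff (\<Sum>k<n. monom 1 (2 * k)) (2 * n - 2)"
      using lc deg assms by simp
    show "2 * n - 2 \<le> card ((\<lambda>l. cis (ph l)) ` I)"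
      using inj_on_subset[OF inj I(1)] I by (simp add: card_image)
    fix z assume "z \<in> (\<lambda>l. cis (ph l)) ` I"
    then obtain l where l: "l \<in> I" "z = cis (ph l)" by auto
    have z1: "z ^ (2 * n) = 1" using bij l I(1) by (auto simp: bij_betw_def)
    have "z \<noteq> 1" using inj_onD[OF inj, of l 0] l I(1) assms by (auto simp: ph_def I_def)
    moreover have "z \<noteq> - 1" using inj_onD[OF inj, of l n] l I(1) assms by (auto simp: ph_def I_def)
    ultimately have "z\<^sup>2 \<noteq> 1" by (simp add: power2_eq_1_iff)
    moreover have "(\<Sum>k<n. (z\<^sup>2) ^ k) * (z\<^sup>2 - 1) = z ^ (2 * n) - 1"
      unfolding power_mult power_diff_1_eq[of "z\<^sup>2"] by (rule mult.commute)
    ultimately have "(\<Sum>k<n. (z\<^sup>2) ^ k) = 0" using z1 by simp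
    moreover have "poly ?A z = 0"
      using l I by (auto simp: poly_prod intro!: prod_zero)
    ultimately show "poly ?A z = poly (\<Sum>k<n. monom 1 (2 * k)) z"
      by (simp add: poly_sum poly_monom power_mult)
  qed (use deg degB in auto)
  then have "poly ?A (of_real x) = poly (\<Sum>k<n. monom 1 (2 * k)) (of_real x)" by simp
  then have main: "(\<Prod>l\<in>I. of_real x - cis (ph l)) = of_real (\<Sum>k<n. x ^ (2 * k))"
    by (simp add: poly_prod poly_sum poly_monom)
  have split: "I = {1..<n} \<union> {n<..<2 * n}" by (auto simp: I_def)
  have low: "(\<Prod>l\<in>{n<..<2 * n}. of_real x - cis (ph l)) = (\<Prod>l\<in>{1..<n}. of_real x - cis (- ph l))"
  proof (rule prod.reindex_bij_witness[of _ "\<lambda>l. 2 * n - l" "\<lambda>l. 2 * n - l"])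
    fix l assume l: "l \<in> {n<..<2 * n}"
    have "- ph (2 * n - l) = ph l - 2 * pi"
      using l assms by (simp add: ph_def of_nat_diff field_simps)
    then show "of_real x - cis (- ph (2 * n - l)) = of_real x - cis (ph l)"
      by (simp add: complex_eq_iff cos_diff sin_diff)
  qed auto
  have outer: "outer_poly n z = (\<Prod>l\<in>{1..<n}. z - cis (- ph l))" for z
    unfolding ph_def by (rule outer_poly_alt)
  have "(\<Prod>l\<in>I. of_real x - cis (ph l)) = (\<Prod>l\<in>{1..<n}. of_real x - cis (ph l)) * (\<Prod>l\<in>{1..<n}. of_real x - cis (- ph l))"
    unfolding split by (subst prod.union_disjoint) (auto simp: low)
  also have "\<dots> = cnj (outer_poly n (of_real x)) * outer_poly n (of_real x)"
    unfolding outer by (simp add: cis_cnj)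
  also have "\<dots> = of_real ((cmod (outer_poly n (of_real x)))\<^sup>2)"
    by (simp add: complex_norm_square mult.commute del: of_real_power)
  finally have "of_real ((cmod (outer_poly n (of_real x)))\<^sup>2) = complex_of_real (\<Sum>k<n. x ^ (2 * k))"
    using main by simp
  then show ?thesis unfolding of_real_eq_iff .
qed

text \<open>On the upper half circle the modulus is largest at \<open>\<i>\<close>, but not factor
  by factor. Reflection in the imaginary axis permutes the factors, so
  \<open>P t = P (pi - t)\<close>; pairing each factor at \<open>t\<close> with one at
  \<open>pi - t\<close> yields a comparison that does hold factorwise.\<close>

lemma norm_outer_poly_circle_le:
  assumes "n > 0" "0 \<le> t" "t \<le> pi"
  shows "(cmod (outer_poly n (cis t)))\<^sup>2 \<le> 3.21 ^ n / 2"
proof -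
  define ph where "ph l = pi * real l / real n" for l
  define P where "P t = (\<Prod>l\<in>{1..<n}. 2 - 2 * cos (t + ph l))" for t
  have "(cmod (cis t - cis (- s)))\<^sup>2 = 2 - 2 * cos (t + s)" for t s
  proof -
    have "(cmod (cis t - cis (- s)))\<^sup>2 = ((cos t)\<^sup>2 + (sin t)\<^sup>2) + ((cos s)\<^sup>2 + (sin s)\<^sup>2) - 2 * (cos t * cos s - sin t * sin s)"
      unfolding cmod_power2
      by (simp add: power2_eq_square algebra_simps del: sin_cos_squared_add sin_cos_squared_add2 sin_cos_squared_add3)
    then show ?thesis by (simp add: cos_add)
  qed
  moreover have "outer_poly n z = (\<Prod>l\<in>{1..<n}. z - cis (- ph l))" for z
    unfolding ph_def by (rule outer_poly_alt)
  ultimately have P: "(cmod (outer_poly n (cis t)))\<^sup>2 = P t" for t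
    by (simp add: P_def prod_norm[symmetric] prod_power_distrib)
  have "P t = (\<Prod>l\<in>{1..<n}. 2 - 2 * cos (pi - t + ph l))"
    unfolding P_def
  proof (rule prod.reindex_bij_witness[of _ "\<lambda>l. n - l" "\<lambda>l. n - l"])
    fix l assume l: "l \<in> {1..<n}"
    have "ph (n - l) = pi - ph l" using l assms by (simp add: ph_def of_nat_diff field_simps)
    then have "pi - t + ph (n - l) = 2 * pi - (t + ph l)" by simp
    then show "2 - 2 * cos (pi - t + ph (n - l)) = 2 - 2 * cos (t + ph l)" by (simp only: cos_2pi_minus)
  qed auto
  then have "P t * P t = (\<Prod>l\<in>{1..<n}. (2 - 2 * cos (t + ph l)) * (2 - 2 * cos (pi - t + ph l)))"
    by (simp add: P_def prod.distrib)
  also have "\<dots> \<le> (\<Prod>l\<in>{1..<n}. (2 + 2 * sin (ph l))\<^sup>2)"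
  proof (rule prod_mono)
    fix l assume l: "l \<in> {1..<n}"
    have "ph l \<le> pi * 1" unfolding ph_def using l assms by (simp add: field_simps)
    then have s: "0 \<le> sin (ph l)" using assms by (intro sin_ge_zero) (auto simp: ph_def)
    define a where "a = sin t * sin (ph l)"
    have a: "0 \<le> a" "a \<le> sin (ph l)"
      using s assms by (auto simp: a_def sin_ge_zero mult_left_le_one_le)
    have "cos (pi - t + ph l) = - cos (t - ph l)"
      using cos_pi_minus[of "t - ph l"] by (simp add: algebra_simps)
    then have "(2 - 2 * cos (t + ph l)) * (2 - 2 * cos (pi - t + ph l)) = 4 * ((1 + a)\<^sup>2 - (cos t * cos (ph l))\<^sup>2)"
      by (simp add: a_def cos_add cos_diff power2_eq_square algebra_simps)
    also have "\<dots> \<le> 4 * (1 + sin (ph l))\<^sup>2"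
    proof -
      have "(1 + a)\<^sup>2 \<le> (1 + sin (ph l))\<^sup>2" using a by (intro power_mono) auto
      then have "(1 + a)\<^sup>2 - (cos t * cos (ph l))\<^sup>2 \<le> (1 + sin (ph l))\<^sup>2"
        using zero_le_power2[of "cos t * cos (ph l)"] by linarith
      then show ?thesis by simp
    qed
    also have "\<dots> = (2 + 2 * sin (ph l))\<^sup>2" by (simp add: power2_eq_square algebra_simps)
    finally have "(2 - 2 * cos (t + ph l)) * (2 - 2 * cos (pi - t + ph l)) \<le> (2 + 2 * sin (ph l))\<^sup>2" .
    moreover have "0 \<le> (2 - 2 * cos (t + ph l)) * (2 - 2 * cos (pi - t + ph l))"
      by (intro mult_nonneg_nonneg) auto
    ultimately show "0 \<le> (2 - 2 * cos (t + ph l)) * (2 - 2 * cos (pi - t + ph l)) \<and>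
        (2 - 2 * cos (t + ph l)) * (2 - 2 * cos (pi - t + ph l)) \<le> (2 + 2 * sin (ph l))\<^sup>2" by simp
  qed
  also have "\<dots> = (\<Prod>l\<in>{1..<n}. 2 + 2 * sin (ph l))\<^sup>2" by (simp add: prod_power_distrib)
  finally have "(P t)\<^sup>2 \<le> (\<Prod>l\<in>{1..<n}. 2 + 2 * sin (ph l))\<^sup>2" by (simp add: power2_eq_square)
  moreover have "0 \<le> 2 + 2 * sin (ph l)" for l using sin_ge_minus_one[of "ph l"] by linarith
  then have "0 \<le> (\<Prod>l\<in>{1..<n}. 2 + 2 * sin (ph l))" by (rule prod_nonneg)
  ultimately have "P t \<le> (\<Prod>l\<in>{1..<n}. 2 + 2 * sin (ph l))" by (rule power2_le_imp_le)
  also have "\<dots> \<le> 3.21 ^ n / 2" using prod_two_plus_two_sin_le[OF assms(1)] by (simp add: ph_def)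
  finally show ?thesis by (simp add: P)
qed

text \<open>In terms of the moment matrix: the normalisation says that its trace is 1, and the last
  conclusion says that its eigenvalues are at least \<open>2 / 3.21 ^ n\<close>. The measure is the
  average over the points \<open>cis (th l)\<close> of the probability measures of
  \<open>sampling_bound\<close>, divided by the squared modulus of
  \<open>outer_poly n\<close>.\<close>

lemma discrete_norming_measure:
  assumes n: "n > 0"
  shows "\<exists>(Z :: real set) \<alpha>. finite Z \<and> n \<le> card Z \<and> (\<forall>z\<in>Z. \<alpha> z > 0) \<and>
    (\<Sum>z\<in>Z. \<alpha> z * (\<Sum>k<n. z ^ (2 * k))) = 1 \<and>
    (\<forall>v. (\<Sum>k<n. (v k)\<^sup>2) \<le> 3.21 ^ n / 2 * (\<Sum>z\<in>Z. \<alpha> z * (\<Sum>k<n. v k * z ^ k)\<^sup>2))"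
proof -
  obtain m where m: "n = Suc m" using n by (cases n) auto
  define th where "th l = pi * (2 * real l + 1) / (2 * real n)" for l
  define S where "S x = (\<Sum>k<n. x ^ (2 * k))" for x :: real
  have th: "0 < th l" "th l < pi" if "l < n" for l
  proof -
    show "0 < th l" using n by (auto simp: th_def intro!: divide_pos_pos mult_pos_pos)
    have "2 * real l + 1 < 2 * real n" using that by linarith
    then have "pi * (2 * real l + 1) < pi * (2 * real n)" by (intro mult_strict_left_mono) auto
    then show "th l < pi" using n by (simp add: th_def divide_less_eq)
  qed
  have imth: "Im (cis (th l)) > 0" if "l < n" for l using th[OF that] by (simp add: sin_gt_zero)
  have im: "Im (cis (- (pi * real (Suc k) / real n))) < 0" if "k < m" for k
  proof -
    have "pi * real (Suc k) < pi * real n" using that m by (intro mult_strict_left_mono) auto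
    then have "pi * real (Suc k) / real n < pi" using n by (simp add: divide_less_eq)
    moreover have "pi * real (Suc k) / real n > 0" using n by (intro divide_pos_pos mult_pos_pos) auto
    ultimately have "sin (pi * real (Suc k) / real n) > 0" by (intro sin_gt_zero) auto
    then show ?thesis by simp
  qed
  have outer: "outer_poly n z = (\<Prod>k<m. z - cis (- (pi * real (Suc k) / real n)))" for z
    by (simp add: outer_poly_def m)
  define Q where "Q l x c \<longleftrightarrow> inj_on x {..<n} \<and> (\<forall>j<n. c j > 0) \<and> (\<Sum>j<n. c j) = 1 \<and>
     (\<forall>p. degree p < n \<longrightarrow> (cmod (poly p (cis (th l))))\<^sup>2 \<le> (cmod (outer_poly n (cis (th l))))\<^sup>2
        * (\<Sum>j<n. c j * (cmod (poly p (of_real (x j))))\<^sup>2 / S (x j)))" for l :: nat and x c :: "nat \<Rightarrow> real"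
  have "\<exists>x c. Q l x c" if l: "l < n" for l
  proof -
    obtain x :: "nat \<Rightarrow> real" and c :: "nat \<Rightarrow> real" where
      o: "inj_on x {..m}" "\<And>j. j \<le> m \<Longrightarrow> c j > 0" "(\<Sum>j\<le>m. c j) = 1"
      and o4: "\<And>p. degree p \<le> m \<Longrightarrow> (cmod (poly p (cis (th l))))\<^sup>2 \<le> (cmod (outer_poly n (cis (th l))))\<^sup>2 *
        (\<Sum>j\<le>m. c j * (cmod (poly p (of_real (x j))))\<^sup>2 / (cmod (outer_poly n (of_real (x j))))\<^sup>2)"
      unfolding outer by (rule sampling_bound[OF im imth[OF l]]) blast+
    have nrm: "(cmod (outer_poly n (of_real t)))\<^sup>2 = S t" for t
      using norm_outer_poly_real[OF n] by (simp only: S_def)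
    have mn: "{..m} = {..<n}" by (simp add: m lessThan_Suc_atMost)
    show ?thesis unfolding Q_def
    proof (rule exI[of _ x], rule exI[of _ c], intro conjI allI impI)
      show "inj_on x {..<n}" "(\<Sum>j<n. c j) = 1" using o by (simp_all only: mn)
      show "c j > 0" if "j < n" for j using that o(2) by (simp add: m)
      show "(cmod (poly p (cis (th l))))\<^sup>2 \<le> (cmod (outer_poly n (cis (th l))))\<^sup>2
          * (\<Sum>j<n. c j * (cmod (poly p (of_real (x j))))\<^sup>2 / S (x j))" if "degree p < n" for p
        using o4[of p, unfolded nrm mn] that m by simp
    qed
  qed
  then obtain x c where Q: "\<And>l. l < n \<Longrightarrow> Q l (x l) (c l)" by metis
  have inj: "inj_on (x l) {..<n}" and c: "j < n \<Longrightarrow> c l j > 0" and c1: "(\<Sum>j<n. c l j) = 1" and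
    bnd: "degree p < n \<Longrightarrow> (cmod (poly p (cis (th l))))\<^sup>2 \<le> (cmod (outer_poly n (cis (th l))))\<^sup>2
        * (\<Sum>j<n. c l j * (cmod (poly p (of_real (x l j))))\<^sup>2 / S (x l j))" if "l < n" for l j p
    using Q[OF that] unfolding Q_def by simp_all
  have S: "S t > 0" for t
  proof -
    have "S t = 1 + (\<Sum>k<m. t ^ (2 * Suc k))" unfolding S_def m by (subst sum.lessThan_Suc_shift) simp
    also have "\<dots> \<ge> 1" by (simp add: sum_nonneg power_mult del: power_Suc mult_Suc_right)
    finally show ?thesis by simp
  qed
  define P where "P = {..<n} \<times> {..<n}"
  define X where "X p = x (fst p) (snd p)" for p
  define W where "W p = c (fst p) (snd p) / (real n * S (X p))" for p
  have W: "W p > 0" if "p \<in> P" for p using that c S n by (auto simp: P_def W_def)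
  define Z where "Z = X ` P"
  \<comment> \<open>Nodes that belong to different \<open>l\<close> may coincide; the weights over
    one point are added.\<close>
  define \<alpha> where "\<alpha> z = (\<Sum>p | p \<in> P \<and> X p = z. W p)" for z
  have finP: "finite P" by (simp add: P_def)
  have sumZ: "(\<Sum>z\<in>Z. \<alpha> z * g z) = (\<Sum>p\<in>P. W p * g (X p))" for g :: "real \<Rightarrow> real"
  proof -
    have "(\<Sum>p\<in>P. W p * g (X p)) = (\<Sum>z\<in>Z. \<Sum>p | p \<in> P \<and> X p = z. W p * g (X p))"
      unfolding Z_def by (rule sum.image_gen[OF finP])
    also have "\<dots> = (\<Sum>z\<in>Z. \<alpha> z * g z)"
      unfolding \<alpha>_def sum_distrib_right by (intro sum.cong) auto
    finally show ?thesis ..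
  qed
  show ?thesis
  proof (intro exI[of _ Z] exI[of _ \<alpha>] conjI ballI allI)
    show fin: "finite Z" using finP by (simp add: Z_def)
    have "x 0 ` {..<n} \<subseteq> Z" using n by (force simp: Z_def P_def X_def)
    then show "n \<le> card Z" using card_mono[OF fin, of "x 0 ` {..<n}"] inj[of 0] n by (simp add: card_image)
    show "\<alpha> z > 0" if "z \<in> Z" for z
      unfolding \<alpha>_def using that W finP by (intro sum_pos) (auto simp: Z_def)
    have "(\<Sum>p\<in>P. W p * S (X p)) = (\<Sum>p\<in>P. c (fst p) (snd p) / real n)"
      using S by (intro sum.cong) (auto simp: W_def less_imp_neq[symmetric])
    also have "\<dots> = (\<Sum>l<n. (\<Sum>j<n. c l j) / real n)"
      unfolding P_def sum_divide_distrib sum.cartesian_product by (simp add: split_def)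
    also have "\<dots> = 1" using c1 n by simp
    finally show "(\<Sum>z\<in>Z. \<alpha> z * (\<Sum>k<n. z ^ (2 * k))) = 1" unfolding sumZ S_def .
    fix v :: "nat \<Rightarrow> real"
    define p where "p = (\<Sum>k<n. monom (complex_of_real (v k)) k)"
    have "degree p \<le> m" unfolding p_def
      by (intro degree_sum_le) (auto simp: m intro!: order.trans[OF degree_monom_le])
    then have dp: "degree p < n" using m by simp
    have px: "(cmod (poly p (of_real t)))\<^sup>2 = (\<Sum>k<n. v k * t ^ k)\<^sup>2" for t
    proof -
      have "poly p (of_real t) = of_real (\<Sum>k<n. v k * t ^ k)"
        by (simp add: p_def poly_sum poly_monom)
      then show ?thesis by (simp only: norm_of_real power2_abs)
    qed
    have "real n * (\<Sum>k<n. (v k)\<^sup>2) = (\<Sum>l<n. (cmod (poly p (cis (th l))))\<^sup>2)"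
      unfolding sum_norm_sq_grid[symmetric] by (simp add: p_def poly_sum poly_monom th_def)
    also have "\<dots> \<le> (\<Sum>l<n. 3.21 ^ n / 2 * (\<Sum>j<n. c l j * (cmod (poly p (of_real (x l j))))\<^sup>2 / S (x l j)))"
    proof (rule sum_mono)
      fix l assume l: "l \<in> {..<n}"
      have "(cmod (outer_poly n (cis (th l))))\<^sup>2 \<le> 3.21 ^ n / 2"
        using th[of l] l n by (intro norm_outer_poly_circle_le) auto
      moreover have "0 \<le> (\<Sum>j<n. c l j * (cmod (poly p (of_real (x l j))))\<^sup>2 / S (x l j))"
        using c S l by (intro sum_nonneg divide_nonneg_nonneg mult_nonneg_nonneg) (auto intro: less_imp_le)
      ultimately show "(cmod (poly p (cis (th l))))\<^sup>2 \<le> 3.21 ^ n / 2 * (\<Sum>j<n. c l j * (cmod (poly p (of_real (x l j))))\<^sup>2 / S (x l j))"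
        using order.trans[OF bnd[of l p] mult_right_mono] l dp by blast
    qed
    also have "\<dots> = 3.21 ^ n / 2 * (\<Sum>l<n. \<Sum>j<n. c l j * (\<Sum>k<n. v k * x l j ^ k)\<^sup>2 / S (x l j))"
      unfolding px by (rule sum_distrib_left[symmetric])
    also have "(\<Sum>l<n. \<Sum>j<n. c l j * (\<Sum>k<n. v k * x l j ^ k)\<^sup>2 / S (x l j)) = real n * (\<Sum>p\<in>P. W p * (\<Sum>k<n. v k * X p ^ k)\<^sup>2)"
      unfolding P_def sum.cartesian_product sum_distrib_left using n
      by (intro sum.cong) (auto simp: W_def X_def)
    finally have "real n * (\<Sum>k<n. (v k)\<^sup>2) \<le> real n * (3.21 ^ n / 2 * (\<Sum>p\<in>P. W p * (\<Sum>k<n. v k * X p ^ k)\<^sup>2))"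
      by (simp add: mult_ac)
    then show "(\<Sum>k<n. (v k)\<^sup>2) \<le> 3.21 ^ n / 2 * (\<Sum>z\<in>Z. \<alpha> z * (\<Sum>k<n. v k * z ^ k)\<^sup>2)"
      unfolding sumZ using n by (simp only: mult_le_cancel_left_pos of_nat_0_less_iff)
  qed
qed

section \<open>Positive semidefinite matrices and local norms\<close>

text \<open>Cholesky factorisation: the last coordinate is split off and the induction hypothesis is
  applied to the Schur complement \<open>B\<close>. If the pivot \<open>c\<close> is 0,
  semidefiniteness forces its whole column to be 0, and with \<open>x / 0 = 0\<close> the same
  formulas stay valid.\<close>

lemma psd_sum_of_rank_ones:
  fixes A :: "nat \<Rightarrow> nat \<Rightarrow> real"
  assumes "\<And>i j. i < m \<Longrightarrow> j < m \<Longrightarrow> A i j = A j i"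
    and "\<And>v. 0 \<le> (\<Sum>i<m. \<Sum>j<m. v i * A i j * v j)"
  shows "\<exists>K. \<forall>i<m. \<forall>j<m. A i j = (\<Sum>a<m. K i a * K j a)"
  using assms
proof (induction m arbitrary: A)
  case 0
  then show ?case by simp
next
  case (Suc m)
  note sym = Suc.prems(1) and psd = Suc.prems(2)
  define q where "q v = (\<Sum>i<Suc m. \<Sum>j<Suc m. v i * A i j * v j)" for v
  have q: "q v = (\<Sum>i<m. \<Sum>j<m. v i * A i j * v j) + 2 * v m * (\<Sum>i<m. A i m * v i) + A m m * (v m)\<^sup>2" for v
  proof -
    have "(\<Sum>j<m. v m * A m j * v j) = v m * (\<Sum>i<m. A i m * v i)"
      unfolding sum_distrib_left using sym[of m] by (intro sum.cong) auto
    moreover have "(\<Sum>i<m. v i * A i m * v m) = v m * (\<Sum>i<m. A i m * v i)"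
      unfolding sum_distrib_left by (intro sum.cong) auto
    ultimately show ?thesis by (simp add: q_def sum.distrib power2_eq_square)
  qed
  have qpos: "0 \<le> q v" for v using psd by (simp only: q_def)
  define c where "c = A m m"
  define B where "B i j = A i j - A i m * A j m / c" for i j
  have c0: "0 \<le> c" using qpos[of "\<lambda>i. if i = m then 1 else 0"] unfolding q by (simp add: c_def)
  have zero: "A i m = 0" if "c = 0" "i < m" for i
  proof (rule ccontr)
    assume ne: "A i m \<noteq> 0"
    \<comment> \<open>Chosen to give the form the value -1 at \<open>v\<close>.\<close>
    define s where "s = - (A i i + 1) / (2 * A i m)"
    define v where "v k = (if k = i then 1 else if k = m then s else 0)" for k
    have 1: "(\<Sum>k<m. A k m * v k) = A i m"
    proof -
      have "(\<Sum>k<m. A k m * v k) = (\<Sum>k<m. if k = i then A i m else 0)"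
        by (intro sum.cong) (auto simp: v_def)
      then show ?thesis using that by simp
    qed
    have 2: "(\<Sum>k<m. \<Sum>j<m. v k * A k j * v j) = A i i"
    proof -
      have "(\<Sum>j<m. v k * A k j * v j) = (\<Sum>j<m. if j = i then v k * A k i else 0)" for k
        by (intro sum.cong) (auto simp: v_def)
      then have "(\<Sum>k<m. \<Sum>j<m. v k * A k j * v j) = (\<Sum>k<m. if k = i then A i i else 0)"
        using that by (intro sum.cong) (auto simp: v_def)
      then show ?thesis using that by simp
    qed
    have "q v = A i i + 2 * s * A i m"
      unfolding q 1 2 using that by (simp add: v_def c_def)
    also have "\<dots> = - 1" using ne by (simp add: s_def field_simps)
    finally show False using qpos[of v] by simp
  qed
  have "\<exists>K. \<forall>i<m. \<forall>j<m. B i j = (\<Sum>a<m. K i a * K j a)"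
  proof (rule Suc.IH)
    show "B i j = B j i" if "i < m" "j < m" for i j using sym[of i j] that by (simp add: B_def)
    fix v :: "nat \<Rightarrow> real"
    define l where "l = (\<Sum>i<m. A i m * v i)"
    have "(\<Sum>i<m. \<Sum>j<m. v i * B i j * v j) = (\<Sum>i<m. \<Sum>j<m. v i * A i j * v j) - (\<Sum>i<m. \<Sum>j<m. (A i m * v i) * (A j m * v j)) / c"
      unfolding sum_subtractf[symmetric] sum_divide_distrib
      by (intro sum.cong refl) (simp add: B_def algebra_simps)
    also have "(\<Sum>i<m. \<Sum>j<m. (A i m * v i) * (A j m * v j)) = l\<^sup>2"
      by (simp add: l_def power2_eq_square sum_product)
    \<comment> \<open>For \<open>c > 0\<close> the entry \<open>- l / c\<close> minimises the form
      in the last coordinate; for \<open>c = 0\<close> both sides are the form on the first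
      \<open>m\<close> coordinates.\<close>
    also have "(\<Sum>i<m. \<Sum>j<m. v i * A i j * v j) - l\<^sup>2 / c = q (v(m := - l / c))"
    proof -
      have "q (v(m := - l / c)) = (\<Sum>i<m. \<Sum>j<m. v i * A i j * v j) + 2 * (- l / c) * l + c * (- l / c)\<^sup>2"
        unfolding q by (simp add: l_def c_def)
      then show ?thesis by (cases "c = 0") (simp_all add: power2_eq_square field_simps)
    qed
    finally show "0 \<le> (\<Sum>i<m. \<Sum>j<m. v i * B i j * v j)" using qpos by simp
  qed
  then obtain K where K: "\<And>i j. i < m \<Longrightarrow> j < m \<Longrightarrow> B i j = (\<Sum>a<m. K i a * K j a)" by blast
  define K' where "K' i a = (if a = m then (if i = m then sqrt c else A i m / sqrt c) else if i = m then 0 else K i a)" for i a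
  have K': "(\<Sum>a<Suc m. K' i a * K' j a) = (if i = m \<or> j = m then 0 else \<Sum>a<m. K i a * K j a) + K' i m * K' j m" for i j
    by (simp add: K'_def)
  have "A i j = (\<Sum>a<Suc m. K' i a * K' j a)" if "i < Suc m" "j < Suc m" for i j
  proof (cases "i = m \<or> j = m")
    case True
    then show ?thesis unfolding K' using that c0 zero[of i] zero[of j] sym[of i j]
      by (cases "c = 0") (auto simp: K'_def c_def less_Suc_eq)
  next
    case False
    then have "i < m" "j < m" using that by auto
    then show ?thesis unfolding K' using False K[of i j] c0 zero[of i]
      by (cases "c = 0") (auto simp: K'_def B_def)
  qed
  then show ?case by blast
qed

section \<open>Traces, semidefinite matrices and their inverses\<close>

definition mtrace :: "real mat \<Rightarrow> real" where
  "mtrace A = (\<Sum>i<dim_row A. A $$ (i, i))"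

lemma mult_mat_index_sum:
  fixes A B :: "real mat"
  assumes "A \<in> carrier_mat n k" "B \<in> carrier_mat k l" "i < n" "j < l"
  shows "(A * B) $$ (i, j) = (\<Sum>r<k. A $$ (i, r) * B $$ (r, j))"
  using assms by (auto simp: scalar_prod_def lessThan_atLeast0 intro!: sum.cong)

lemma mtrace_mult:
  "A \<in> carrier_mat n k \<Longrightarrow> B \<in> carrier_mat k n \<Longrightarrow> mtrace (A * B) = (\<Sum>i<n. \<Sum>j<k. A $$ (i, j) * B $$ (j, i))"
  by (simp add: mtrace_def mult_mat_index_sum[of A n k B n] del: index_mult_mat(1))

lemma mtrace_comm:
  assumes "A \<in> carrier_mat n k" "B \<in> carrier_mat k n"
  shows "mtrace (A * B) = mtrace (B * A)"
  unfolding mtrace_mult[OF assms] mtrace_mult[OF assms(2,1)]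
  by (subst sum.swap) (simp add: mult.commute)

lemma mtrace_linear:
  assumes "A \<in> carrier_mat m m" "B \<in> carrier_mat m m"
  shows "mtrace (A + B) = mtrace A + mtrace B" "mtrace (A - B) = mtrace A - mtrace B" "mtrace (c \<cdot>\<^sub>m A) = c * mtrace A"
  using assms by (auto simp: mtrace_def sum.distrib sum_subtractf sum_distrib_left)

definition psd :: "nat \<Rightarrow> real mat \<Rightarrow> bool" where
  "psd m P \<longleftrightarrow> P \<in> carrier_mat m m \<and> P\<^sup>T = P \<and> (\<forall>v\<in>carrier_vec m. 0 \<le> v \<bullet> (P *\<^sub>v v))"

definition pd :: "nat \<Rightarrow> real mat \<Rightarrow> bool" where
  "pd m P \<longleftrightarrow> P \<in> carrier_mat m m \<and> P\<^sup>T = P \<and> (\<forall>v\<in>carrier_vec m. v \<noteq> 0\<^sub>v m \<longrightarrow> 0 < v \<bullet> (P *\<^sub>v v))"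

lemma quadratic_form_sum:
  fixes v :: "real vec"
  assumes "P \<in> carrier_mat m m" "v \<in> carrier_vec m" "w \<in> carrier_vec m"
  shows "v \<bullet> (P *\<^sub>v w) = (\<Sum>i<m. \<Sum>j<m. v $ i * P $$ (i, j) * w $ j)"
  using assms
  by (auto simp: scalar_prod_def mult_mat_vec_def lessThan_atLeast0 sum_distrib_left mult.assoc intro!: sum.cong)

lemma psd_factor:
  assumes "psd m P"
  obtains K where "K \<in> carrier_mat m m" "P = K * K\<^sup>T"
proof -
  have P: "P \<in> carrier_mat m m" and sym: "P\<^sup>T = P" using assms by (auto simp: psd_def)
  have "\<exists>K. \<forall>i<m. \<forall>j<m. P $$ (i, j) = (\<Sum>a<m. K i a * K j a)"
  proof (rule psd_sum_of_rank_ones)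
    show "P $$ (i, j) = P $$ (j, i)" if "i < m" "j < m" for i j
      using P that sym by (metis carrier_matD index_transpose_mat(1))
    fix v
    have "0 \<le> vec m v \<bullet> (P *\<^sub>v vec m v)" using assms by (simp add: psd_def)
    also have "\<dots> = (\<Sum>i<m. \<Sum>j<m. v i * P $$ (i, j) * v j)"
      by (subst quadratic_form_sum[OF P]) auto
    finally show "0 \<le> (\<Sum>i<m. \<Sum>j<m. v i * P $$ (i, j) * v j)" .
  qed
  then obtain K where K: "\<And>i j. i < m \<Longrightarrow> j < m \<Longrightarrow> P $$ (i, j) = (\<Sum>a<m. K i a * K j a)" by blast
  define L where "L = mat m m (\<lambda>(i, a). K i a)"
  have L: "L \<in> carrier_mat m m" by (simp add: L_def)
  have "P = L * L\<^sup>T"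
  proof (rule eq_matI)
    fix i j assume "i < dim_row (L * L\<^sup>T)" "j < dim_col (L * L\<^sup>T)"
    then have ij: "i < m" "j < m" using L by auto
    have "(L * L\<^sup>T) $$ (i, j) = (\<Sum>a<m. L $$ (i, a) * L\<^sup>T $$ (a, j))"
      using L ij by (intro mult_mat_index_sum) auto
    then show "P $$ (i, j) = (L * L\<^sup>T) $$ (i, j)"
      using K ij by (simp add: L_def)
  qed (use P L in auto)
  then show thesis using that L by blast
qed

lemma mtrace_sq_sym:
  assumes "C \<in> carrier_mat m m" "C\<^sup>T = C"
  shows "mtrace (C * C) = (\<Sum>a<m. \<Sum>b<m. (C $$ (a, b))\<^sup>2)"
proof -
  have "C $$ (b, a) = C $$ (a, b)" if "a < m" "b < m" for a b
    using assms that by (metis carrier_matD index_transpose_mat(1))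
  then show ?thesis unfolding mtrace_mult[OF assms(1,1)] by (simp add: power2_eq_square)
qed

text \<open>Cyclicity of the trace turns the left side into \<open>mtrace (C * C)\<close> for a
  symmetric \<open>C\<close>, hence into a sum of squares. This gives the positivity in
  \<open>mtrace_psd_nonneg\<close> and the Frobenius form of the local norm in
  \<open>local_form_le\<close>.\<close>

lemma mtrace_congruence:
  assumes "K \<in> carrier_mat m m" "B \<in> carrier_mat m m" "B\<^sup>T = B" "P = K * K\<^sup>T"
  defines "C \<equiv> K\<^sup>T * B * K"
  shows "mtrace (P * B * P * B) = (\<Sum>a<m. \<Sum>b<m. (C $$ (a, b))\<^sup>2)"
proof -
  have car: "A * D \<in> carrier_mat m m" if "A \<in> carrier_mat m m" "D \<in> carrier_mat m m" for A D :: "real mat"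
    using that by auto
  have C: "C \<in> carrier_mat m m" using assms by auto
  have KT: "K\<^sup>T \<in> carrier_mat m m" using assms by auto
  have sym: "C\<^sup>T = C"
    using assms(1,2,3) KT unfolding C_def
    by (simp add: transpose_mult[of _ m m _ m] assoc_mult_mat[of _ m m _ m _ m] mult_carrier_mat[of _ m m _ m])
  have "P * B * P * B = K * (K\<^sup>T * B * K * K\<^sup>T * B)"
    using assms(1,2,4) KT by (simp add: assoc_mult_mat[of _ m m _ m _ m] mult_carrier_mat[of _ m m _ m])
  then have "mtrace (P * B * P * B) = mtrace (K\<^sup>T * B * K * K\<^sup>T * B * K)"
    using mtrace_comm[of K m m "K\<^sup>T * B * K * K\<^sup>T * B"] assms(1,2) KT car by (simp only:)
  also have "K\<^sup>T * B * K * K\<^sup>T * B * K = C * C"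
    using assms(1,2) KT unfolding C_def by (simp add: assoc_mult_mat[of _ m m _ m _ m] mult_carrier_mat[of _ m m _ m])
  finally show ?thesis using mtrace_sq_sym[OF C sym] by simp
qed

lemma mtrace_psd_nonneg:
  assumes "psd m P" "B \<in> carrier_mat m m" "B\<^sup>T = B"
  shows "0 \<le> mtrace (P * B * P * B)"
proof -
  obtain K where "K \<in> carrier_mat m m" "P = K * K\<^sup>T" using psd_factor[OF assms(1)] .
  then show ?thesis using mtrace_congruence[of K m B P] assms by (simp add: sum_nonneg)
qed

lemma pd_imp_psd: "pd m P \<Longrightarrow> psd m P"
  unfolding pd_def psd_def
proof (intro conjI ballI; elim conjE)
  fix v :: "real vec" assume "P \<in> carrier_mat m m" "\<forall>v\<in>carrier_vec m. v \<noteq> 0\<^sub>v m \<longrightarrow> 0 < v \<bullet> (P *\<^sub>v v)" "v \<in> carrier_vec m"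
  then show "0 \<le> v \<bullet> (P *\<^sub>v v)" by (cases "v = 0\<^sub>v m") (auto intro: less_imp_le)
qed auto

lemma pd_det_pos:
  assumes "pd m P"
  shows "det P > 0"
proof -
  have P: "P \<in> carrier_mat m m" using assms by (simp add: pd_def)
  obtain K where K: "K \<in> carrier_mat m m" "P = K * K\<^sup>T" using psd_factor[OF pd_imp_psd[OF assms]] .
  have "det P = (det K)\<^sup>2" using K by (simp add: det_mult[of _ m] det_transpose power2_eq_square)
  moreover have "det P \<noteq> 0"
  proof
    assume "det P = 0"
    then obtain v where "v \<in> carrier_vec m" "v \<noteq> 0\<^sub>v m" "P *\<^sub>v v = 0\<^sub>v m"
      using det_0_iff_vec_prod_zero_field[OF P] by auto
    then show False using assms unfolding pd_def by force
  qed
  ultimately show ?thesis by simp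
qed

lemma scalar_prod_self_sum: "w \<in> carrier_vec m \<Longrightarrow> w \<bullet> w = (\<Sum>i<m. (w $ i)\<^sup>2)" for w :: "real vec"
  by (auto simp: scalar_prod_def lessThan_atLeast0 power2_eq_square)

lemma scalar_prod_self_pos:
  fixes w :: "real vec"
  assumes "w \<in> carrier_vec m" "w \<noteq> 0\<^sub>v m"
  shows "0 < w \<bullet> w"
proof -
  obtain i where "i < m" "w $ i \<noteq> 0" using assms by (metis carrier_vecD dim_vec index_zero_vec eq_vecI)
  then show ?thesis unfolding scalar_prod_self_sum[OF assms(1)] by (intro sum_pos2[of _ i]) auto
qed

text \<open>The form at \<open>v\<close> is the squared norm of
  \<open>K\<^sup>T *\<^sub>v v\<close>; if that vector were 0, then \<open>v\<close> would be in the
  kernel of \<open>P\<close>.\<close>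

lemma psd_det_imp_pd:
  assumes "psd m P" "det P \<noteq> 0"
  shows "pd m P"
  unfolding pd_def
proof (intro conjI ballI impI)
  show P: "P \<in> carrier_mat m m" and "P\<^sup>T = P" using assms by (auto simp: psd_def)
  fix v :: "real vec" assume v: "v \<in> carrier_vec m" "v \<noteq> 0\<^sub>v m"
  obtain K where K: "K \<in> carrier_mat m m" "P = K * K\<^sup>T" using psd_factor[OF assms(1)] .
  define w where "w = K\<^sup>T *\<^sub>v v"
  have w: "w \<in> carrier_vec m" using K v by (auto simp: w_def)
  have "v \<bullet> (P *\<^sub>v v) = v \<bullet> (K *\<^sub>v w)" using K v by (simp add: w_def assoc_mult_mat_vec[of _ m m _ m])
  also have "\<dots> = w \<bullet> w"
    using transpose_vec_mult_scalar[of K m m w v] K w v by (simp add: w_def)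
  finally have eq: "v \<bullet> (P *\<^sub>v v) = w \<bullet> w" .
  have "w \<noteq> 0\<^sub>v m"
  proof
    assume "w = 0\<^sub>v m"
    moreover have "K *\<^sub>v 0\<^sub>v m = 0\<^sub>v m" using K by (intro eq_vecI) auto
    ultimately have "P *\<^sub>v v = 0\<^sub>v m" using K v by (simp add: w_def assoc_mult_mat_vec[of _ m m _ m])
    then show False using det_0_iff_vec_prod_zero_field[OF P] assms(2) v by auto
  qed
  then show "0 < v \<bullet> (P *\<^sub>v v)" unfolding eq
    using scalar_prod_self_pos w by blast
qed

text \<open>Cramer's rule makes the entries of the inverse visibly continuous in those of \<open>P\<close>.\<close>

definition minv :: "real mat \<Rightarrow> real mat" where
  "minv P = (1 / det P) \<cdot>\<^sub>m adj_mat P"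

lemma minv_carrier [simp]: "P \<in> carrier_mat m m \<Longrightarrow> minv P \<in> carrier_mat m m"
  by (simp add: minv_def adj_mat)

lemma minv:
  assumes "P \<in> carrier_mat m m" "det P \<noteq> 0"
  shows "P * minv P = 1\<^sub>m m" "minv P * P = 1\<^sub>m m"
proof -
  note adj = adj_mat[OF assms(1)]
  have 1: "(1 / det P) \<cdot>\<^sub>m (det P \<cdot>\<^sub>m 1\<^sub>m m) = (1\<^sub>m m :: real mat)"
    using assms(2) by (intro eq_matI) auto
  show "P * minv P = 1\<^sub>m m" "minv P * P = 1\<^sub>m m"
    using adj assms(1) by (simp_all add: minv_def mult_smult_distrib[of _ m m _ m] mult_smult_assoc_mat[of _ m m _ m] 1)
qed

lemma minv_sym:
  assumes "P \<in> carrier_mat m m" "det P \<noteq> 0" "P\<^sup>T = P"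
  shows "(minv P)\<^sup>T = minv P"
proof -
  have X: "minv P \<in> carrier_mat m m" "(minv P)\<^sup>T \<in> carrier_mat m m" using assms(1) by auto
  have "(minv P)\<^sup>T * P = (P\<^sup>T * minv P)\<^sup>T" using X assms by (simp add: transpose_mult[of _ m m _ m])
  also have "\<dots> = 1\<^sub>m m" using minv[OF assms(1,2)] assms(3) by simp
  finally have "(minv P)\<^sup>T * P * minv P = minv P" using X by simp
  then show ?thesis using X assms(1) minv[OF assms(1,2)] by (simp add: assoc_mult_mat[of _ m m _ m _ m])
qed

lemma pd_minv_psd:
  assumes "pd m P"
  shows "psd m (minv P)"
  unfolding psd_def
proof (intro conjI ballI)
  have P: "P \<in> carrier_mat m m" "P\<^sup>T = P" "det P \<noteq> 0" using assms pd_det_pos[OF assms] by (auto simp: pd_def)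
  show X: "minv P \<in> carrier_mat m m" using P by simp
  show "(minv P)\<^sup>T = minv P" using minv_sym P by blast
  fix v :: "real vec" assume v: "v \<in> carrier_vec m"
  define w where "w = minv P *\<^sub>v v"
  have w: "w \<in> carrier_vec m" using X v by (simp add: w_def)
  have "P *\<^sub>v w = v" using X v P minv[OF P(1,3)] unfolding w_def
    by (simp flip: assoc_mult_mat_vec[of _ m m _ m])
  then have "v \<bullet> (minv P *\<^sub>v v) = w \<bullet> (P *\<^sub>v w)" using w v by (simp add: w_def[symmetric] comm_scalar_prod[of _ m])
  then show "0 \<le> v \<bullet> (minv P *\<^sub>v v)" using pd_imp_psd[OF assms] w by (simp add: psd_def)
qed

section \<open>Local norms and their duality\<close>

lemma discriminant_bound:
  fixes a b c :: real
  assumes "\<And>s. 0 \<le> c + 2 * s * b + s\<^sup>2 * a"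
  shows "b\<^sup>2 \<le> c * a"
proof (cases "a = 0")
  case True
  have "b = 0"
  proof (rule ccontr)
    assume "b \<noteq> 0"
    then show False using assms[of "- (c + 1) / (2 * b)"] True by (simp add: field_simps)
  qed
  then show ?thesis using True by simp
next
  case False
  have a: "a > 0"
  proof (rule ccontr)
    assume "\<not> a > 0"
    then have a: "a < 0" using False by simp
    \<comment> \<open>Large enough for \<open>s * a\<close> to fall below
      \<open>- (\<bar>c\<bar> + 2 * \<bar>b\<bar>)\<close>.\<close>
    define s where "s = (1 + \<bar>c\<bar> + 2 * \<bar>b\<bar>) / (- a) + 1"
    have s1: "s \<ge> 1" using a by (simp add: s_def divide_nonneg_neg divide_nonpos_neg)
    have "c + 2 * s * b + s\<^sup>2 * a \<le> \<bar>c\<bar> * s + 2 * s * \<bar>b\<bar> + s\<^sup>2 * a"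
    proof -
      have "c \<le> \<bar>c\<bar> * 1" by simp
      also have "\<dots> \<le> \<bar>c\<bar> * s" using s1 by (intro mult_left_mono) auto
      finally have "c \<le> \<bar>c\<bar> * s" .
      moreover have "s * b \<le> s * \<bar>b\<bar>" using s1 by (intro mult_left_mono) auto
      ultimately show ?thesis by linarith
    qed
    also have "\<dots> = s * (\<bar>c\<bar> + 2 * \<bar>b\<bar> + s * a)" by (simp add: power2_eq_square algebra_simps)
    also have "s * a = - (1 + \<bar>c\<bar> + 2 * \<bar>b\<bar>) + a" using a by (simp add: s_def field_simps)
    also have "s * (\<bar>c\<bar> + 2 * \<bar>b\<bar> + (- (1 + \<bar>c\<bar> + 2 * \<bar>b\<bar>) + a)) = s * (a - 1)" by simp
    also have "\<dots> < 0" using s1 a by (intro mult_pos_neg) auto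
    finally show False using assms[of s] by simp
  qed
  have "c + 2 * (- b / a) * b + (- b / a)\<^sup>2 * a = c - b\<^sup>2 / a"
    using a by (simp add: power2_eq_square field_simps)
  then have "b\<^sup>2 / a \<le> c" using assms[of "- b / a"] by simp
  then show ?thesis using a by (simp add: divide_le_eq)
qed

text \<open>Both local-norm estimates below instantiate \<open>mtrace (P * B * P * B) \<ge> 0\<close>, so no matrix
  square root or spectral theorem is needed.\<close>

lemma local_norm_bound:
  assumes P: "pd m P" and V: "V \<in> carrier_mat m m" "V\<^sup>T = V" and v: "v \<in> carrier_vec m"
  shows "(v \<bullet> (V *\<^sub>v v))\<^sup>2 \<le> mtrace (minv P * V * minv P * V) * (v \<bullet> (P *\<^sub>v v))\<^sup>2"
proof (rule discriminant_bound)
  fix s :: real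
  have Pc: "P \<in> carrier_mat m m" "P\<^sup>T = P" "det P \<noteq> 0" using P pd_det_pos[OF P] by (auto simp: pd_def)
  define X where "X = minv P"
  have X: "X \<in> carrier_mat m m" "X\<^sup>T = X" "P * X = 1\<^sub>m m" "X * P = 1\<^sub>m m"
    using Pc minv minv_sym by (auto simp: X_def)
  define J where "J = outer_prod v v"
  have J: "J \<in> carrier_mat m m" "J\<^sup>T = J" using v by (auto simp: J_def outer_prod_def intro!: eq_matI)
  define U where "U = V * X"
  have U: "U \<in> carrier_mat m m" using V X by (simp add: U_def)
  \<comment> \<open>With this \<open>B\<close> the trace of \<open>P * B * P * B\<close> is a
    quadratic polynomial in \<open>s\<close>, with constant term
    \<open>mtrace (X * V * X * V)\<close>, linear coefficient
    \<open>2 * (v \<bullet> (V *\<^sub>v v))\<close> and leading coefficient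
    \<open>(v \<bullet> (P *\<^sub>v v))\<^sup>2\<close>. Its nonnegativity is the discriminant
    condition.\<close>
  define B where "B = X * V * X + s \<cdot>\<^sub>m J"
  have B: "B \<in> carrier_mat m m" using X V J by (simp add: B_def)
  have "(s \<cdot>\<^sub>m J)\<^sup>T = s \<cdot>\<^sub>m J"
    by (intro eq_matI) (auto simp: J_def outer_prod_def)
  then have "B\<^sup>T = B" unfolding B_def using X V J
    by (subst transpose_add[of _ m m]) (auto simp: transpose_mult[of _ m m _ m] assoc_mult_mat[of _ m m _ m _ m])
  have PB: "P * B = U + s \<cdot>\<^sub>m (P * J)"
  proof -
    have "P * (X * V * X) = (P * X) * V * X" using Pc X(1) V by (simp add: assoc_mult_mat[of _ m m _ m _ m] mult_carrier_mat[of _ m m _ m])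
    also have "\<dots> = U" using X V by (simp add: U_def)
    finally show ?thesis unfolding B_def using Pc X V J
      by (simp add: mult_add_distrib_mat[of _ m m _ m] mult_smult_distrib[of _ m m _ m])
  qed
  have W: "P * J \<in> carrier_mat m m" using Pc J by simp
  have entry: "(P * J) $$ (i, j) = (P *\<^sub>v v) $ i * v $ j" if "i < m" "j < m" for i j
    using that Pc v J by (auto simp: J_def outer_prod_def scalar_prod_def sum_distrib_left mult_ac intro!: sum.cong)
  have tr2: "mtrace (C * (P * J)) = v \<bullet> (C *\<^sub>v (P *\<^sub>v v))" if C: "C \<in> carrier_mat m m" for C
  proof -
    have "mtrace (C * (P * J)) = (\<Sum>i<m. \<Sum>j<m. C $$ (i, j) * ((P *\<^sub>v v) $ j * v $ i))"
      unfolding mtrace_mult[OF C W] by (intro sum.cong refl) (simp add: entry)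
    also have "\<dots> = v \<bullet> (C *\<^sub>v (P *\<^sub>v v))"
      using v Pc by (subst quadratic_form_sum[OF C]) (auto simp: mult_ac)
    finally show ?thesis .
  qed
  have Uv: "U *\<^sub>v (P *\<^sub>v v) = V *\<^sub>v v"
    using V X Pc v unfolding U_def by (simp flip: assoc_mult_mat_vec[of _ m m _ m])
  have POv: "(P * J) *\<^sub>v (P *\<^sub>v v) = (v \<bullet> (P *\<^sub>v v)) \<cdot>\<^sub>v (P *\<^sub>v v)"
  proof (rule eq_vecI)
    fix i assume "i < dim_vec ((v \<bullet> (P *\<^sub>v v)) \<cdot>\<^sub>v (P *\<^sub>v v))"
    then have i: "i < m" using Pc by simp
    have "((P * J) *\<^sub>v (P *\<^sub>v v)) $ i = (\<Sum>j<m. (P * J) $$ (i, j) * (P *\<^sub>v v) $ j)"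
      using i W Pc v by (auto simp: mult_mat_vec_def scalar_prod_def lessThan_atLeast0 intro!: sum.cong)
    also have "\<dots> = (P *\<^sub>v v) $ i * (\<Sum>j<m. v $ j * (P *\<^sub>v v) $ j)"
      unfolding sum_distrib_left using i by (intro sum.cong refl) (simp add: entry)
    also have "(\<Sum>j<m. v $ j * (P *\<^sub>v v) $ j) = v \<bullet> (P *\<^sub>v v)"
      using Pc by (simp add: scalar_prod_def lessThan_atLeast0)
    finally show "((P * J) *\<^sub>v (P *\<^sub>v v)) $ i = ((v \<bullet> (P *\<^sub>v v)) \<cdot>\<^sub>v (P *\<^sub>v v)) $ i"
      using i Pc by simp
  qed (use Pc J in auto)
  have "0 \<le> mtrace (P * B * P * B)" by (rule mtrace_psd_nonneg[OF pd_imp_psd[OF P] B \<open>B\<^sup>T = B\<close>])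
  also have "P * B * P * B = (U + s \<cdot>\<^sub>m (P * J)) * (U + s \<cdot>\<^sub>m (P * J))"
    unfolding PB[symmetric] using Pc B by (simp add: assoc_mult_mat[of _ m m _ m _ m] mult_carrier_mat[of _ m m _ m])
  also have "\<dots> = U * U + s \<cdot>\<^sub>m ((P * J) * U) + (s \<cdot>\<^sub>m (U * (P * J)) + s \<cdot>\<^sub>m (s \<cdot>\<^sub>m ((P * J) * (P * J))))"
    using U W by (simp add: mult_add_distrib_mat[of _ m m _ m] add_mult_distrib_mat[of _ m m _ _ m]
      mult_smult_distrib[of _ m m _ m] mult_smult_assoc_mat[of _ m m _ m] mult_carrier_mat[of _ m m _ m] add_smult_distrib_left_mat[of _ m m])
  also have "mtrace \<dots> = mtrace (U * U) + s * mtrace ((P * J) * U) + (s * mtrace (U * (P * J)) + s * (s * mtrace ((P * J) * (P * J))))"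
    using U W by (simp add: mtrace_linear[of _ m] mult_carrier_mat[of _ m m _ m] smult_carrier_mat)
  also have "mtrace ((P * J) * U) = mtrace (U * (P * J))" by (rule mtrace_comm[OF W U])
  also have "mtrace (U * (P * J)) = v \<bullet> (V *\<^sub>v v)" unfolding tr2[OF U] Uv ..
  also have "mtrace ((P * J) * (P * J)) = (v \<bullet> (P *\<^sub>v v))\<^sup>2"
    unfolding tr2[OF W] POv using v Pc by (simp add: power2_eq_square)
  also have "mtrace (U * U) = mtrace (X * V * X * V)"
  proof -
    have "mtrace (U * U) = mtrace (V * (X * V * X))" using V X by (simp add: U_def assoc_mult_mat[of _ m m _ m _ m] mult_carrier_mat[of _ m m _ m])
    also have "\<dots> = mtrace (X * V * X * V)" using V X mtrace_comm[of V m m "X * V * X"] mult_carrier_mat[of _ m m _ m] by simp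
    finally show ?thesis .
  qed
  finally show "0 \<le> mtrace (minv P * V * minv P * V) + 2 * s * (v \<bullet> (V *\<^sub>v v)) + s\<^sup>2 * (v \<bullet> (P *\<^sub>v v))\<^sup>2"
    by (simp add: X_def power2_eq_square algebra_simps)
qed

text \<open>Controls how the gradient of \<open>- ln det\<close> changes between \<open>P0\<close>
  and \<open>P'\<close>. It is applied where the difference of traces on the left equals the last
  term on the right, so that the local norm of the step at \<open>P0\<close> bounds that of
  \<open>V\<close> at \<open>P'\<close>.\<close>

lemma local_norm_dual_bound:
  assumes P0: "pd m P0" and P': "pd m P'" and V: "V \<in> carrier_mat m m" "V\<^sup>T = V"
  defines "R \<equiv> P' - P0"
  shows "2 * (mtrace (minv P0 * V) - mtrace (minv P' * V))
    \<le> mtrace (minv P0 * R * minv P0 * R) + mtrace (minv P' * V * minv P' * V)"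
proof -
  define X Y where "X = minv P0" and "Y = minv P'"
  have P: "P0 \<in> carrier_mat m m" "P0\<^sup>T = P0" "det P0 \<noteq> 0" "P' \<in> carrier_mat m m" "P'\<^sup>T = P'" "det P' \<noteq> 0"
    using P0 P' pd_det_pos[OF P0] pd_det_pos[OF P'] by (auto simp: pd_def)
  have X: "X \<in> carrier_mat m m" "X\<^sup>T = X" "P0 * X = 1\<^sub>m m" "X * P0 = 1\<^sub>m m"
    and Y: "Y \<in> carrier_mat m m" "Y\<^sup>T = Y" "P' * Y = 1\<^sub>m m" "Y * P' = 1\<^sub>m m"
    using P minv minv_sym by (auto simp: X_def Y_def)
  note car = mult_carrier_mat[of _ m m _ m]
  note assoc = assoc_mult_mat[of _ m m _ m _ m] car
  have R: "R \<in> carrier_mat m m" using P by (simp add: R_def minus_carrier_mat)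
  define Q W where "Q = R * X" and "W = V * Y"
  have QW: "Q \<in> carrier_mat m m" "W \<in> carrier_mat m m" using R X V Y by (auto simp: Q_def W_def)
  \<comment> \<open>Then \<open>P' * B = Q - W\<close>. The traces of \<open>Q * Q\<close> and
    \<open>W * W\<close> are the two terms on the right of the claim, and the cross term
    \<open>mtrace (W * Q)\<close> is the change of gradient.\<close>
  define B where "B = (X - Y) - Y * V * Y"
  have B: "B \<in> carrier_mat m m" using X Y V by (simp add: B_def minus_carrier_mat)
  have tm: "(A - D)\<^sup>T = A\<^sup>T - D\<^sup>T" if "A \<in> carrier_mat m m" "D \<in> carrier_mat m m" for A D :: "real mat"
    using that by (intro eq_matI) auto
  have "B\<^sup>T = B" unfolding B_def using X Y V
    by (simp add: tm transpose_mult[of _ m m _ m] assoc minus_carrier_mat)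
  have PY: "P' * (Y * V * Y) = W"
  proof -
    have "P' * (Y * V * Y) = (P' * Y) * V * Y" using P Y(1) V by (simp add: assoc)
    then show ?thesis using Y V by (simp add: W_def)
  qed
  have PX: "P' * (X - Y) = Q"
  proof -
    have "P' * (X - Y) = P' * X - 1\<^sub>m m" using P X Y by (simp add: mult_minus_distrib_mat[of _ m m _ m])
    moreover have "Q = P' * X - 1\<^sub>m m" unfolding Q_def R_def using P X by (simp add: minus_mult_distrib_mat[of _ m m _ _ m])
    ultimately show ?thesis by simp
  qed
  have PB: "P' * B = Q - W" unfolding B_def using P X Y V PX PY
    by (simp add: mult_minus_distrib_mat[of _ m m _ m] car minus_carrier_mat)
  have YQ: "Y * Q = X - Y"
  proof -
    have "Y * Q = (Y * P') * (X - Y)" unfolding PX[symmetric] using P X(1) Y(1) by (simp add: assoc minus_carrier_mat)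
    then show ?thesis using X Y by (simp add: minus_carrier_mat left_mult_one_mat[of _ m m])
  qed
  have cross: "mtrace (W * Q) = mtrace (X * V) - mtrace (Y * V)"
  proof -
    have "mtrace (W * Q) = mtrace (V * (X - Y))" unfolding W_def YQ[symmetric] using V Y QW by (simp add: assoc)
    also have "\<dots> = mtrace (V * X) - mtrace (V * Y)" using V X Y
      by (simp add: mult_minus_distrib_mat[of _ m m _ m] mtrace_linear[of _ m] car)
    finally show ?thesis using mtrace_comm[of V m m X] mtrace_comm[of V m m Y] V X Y by simp
  qed
  have "0 \<le> mtrace (P' * B * P' * B)" by (rule mtrace_psd_nonneg[OF pd_imp_psd[OF P'] B \<open>B\<^sup>T = B\<close>])
  also have "P' * B * P' * B = (Q - W) * (Q - W)"
    unfolding PB[symmetric] using P B by (simp add: assoc)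
  also have "\<dots> = (Q * Q - W * Q) - (Q * W - W * W)"
    using QW by (simp add: mult_minus_distrib_mat[of _ m m _ m] minus_mult_distrib_mat[of _ m m _ _ m] minus_carrier_mat)
  also have "mtrace \<dots> = (mtrace (Q * Q) - mtrace (W * Q)) - (mtrace (Q * W) - mtrace (W * W))"
    using QW by (simp add: mtrace_linear[of _ m] car minus_carrier_mat)
  also have "mtrace (Q * W) = mtrace (W * Q)" by (rule mtrace_comm[OF QW])
  also have "mtrace (Q * Q) = mtrace (X * R * X * R)"
    using mtrace_comm[of R m m "X * R * X"] R X by (simp add: Q_def assoc)
  also have "mtrace (W * W) = mtrace (Y * V * Y * V)"
    using mtrace_comm[of V m m "Y * V * Y"] V Y by (simp add: W_def assoc)
  finally show ?thesis unfolding cross by (simp add: X_def Y_def)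
qed

section \<open>Derivatives of determinants and inverses\<close>

lemma has_real_derivative_prod:
  fixes f :: "'i \<Rightarrow> real \<Rightarrow> real"
  assumes "finite I" "\<And>i. i \<in> I \<Longrightarrow> (f i has_real_derivative f' i) (at x)"
  shows "((\<lambda>x. \<Prod>i\<in>I. f i x) has_real_derivative (\<Sum>i\<in>I. f' i * (\<Prod>j\<in>I - {i}. f j x))) (at x)"
  using assms
proof (induction I rule: finite_induct)
  case empty
  then show ?case by simp
next
  case (insert k I)
  have *: "insert k I - {i} = insert k (I - {i})" "k \<notin> I - {i}" if "i \<in> I" for i
    using insert that by auto
  have eq: "(\<Sum>i\<in>insert k I. f' i * (\<Prod>j\<in>insert k I - {i}. f j x))
      = f' k * (\<Prod>j\<in>I. f j x) + (\<Sum>i\<in>I. f' i * (\<Prod>j\<in>I - {i}. f j x)) * f k x"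
    unfolding sum.insert[OF insert.hyps(1,2)] sum_distrib_right
    using insert.hyps * by (intro arg_cong2[where f = "(+)"] sum.cong) (auto simp: mult_ac)
  have "((\<lambda>x. f k x * (\<Prod>i\<in>I. f i x)) has_real_derivative
      f' k * (\<Prod>i\<in>I. f i x) + (\<Sum>i\<in>I. f' i * (\<Prod>j\<in>I - {i}. f j x)) * f k x) (at x)"
    using insert.IH insert.prems by (intro DERIV_mult) auto
  then show ?case unfolding eq using insert.hyps by simp
qed

text \<open>By the Leibniz formula the derivative is the sum over \<open>i\<close> of the
  determinants in which row \<open>i\<close> is differentiated; each of them is then expanded along
  that row.\<close>

lemma det_has_real_derivative:
  fixes M :: "real \<Rightarrow> real mat"
  assumes M: "\<And>s. M s \<in> carrier_mat m m"
    and d: "\<And>i j. i < m \<Longrightarrow> j < m \<Longrightarrow> ((\<lambda>s. M s $$ (i, j)) has_real_derivative D i j) (at x)"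
  shows "((\<lambda>s. det (M s)) has_real_derivative (\<Sum>i<m. \<Sum>j<m. D i j * cofactor (M x) i j)) (at x)"
proof -
  define Q where "Q p i = (\<Prod>k\<in>{0..<m} - {i}. M x $$ (k, p k))" for p i
  define S where "S = {p. p permutes {0..<m}}"
  have pm: "p i < m" if "p \<in> S" "i < m" for p i
    using that permutes_in_image[of p "{0..<m}" i] by (simp add: S_def)
  have det: "det A = (\<Sum>p\<in>S. signof p * (\<Prod>i\<in>{0..<m}. A $$ (i, p i)))" if "A \<in> carrier_mat m m" for A :: "real mat"
    using det_def'[OF that] by (simp add: S_def)
  have "((\<lambda>s. \<Sum>p\<in>S. signof p * (\<Prod>i\<in>{0..<m}. M s $$ (i, p i))) has_real_derivative
     (\<Sum>p\<in>S. signof p * (\<Sum>i\<in>{0..<m}. D i (p i) * Q p i))) (at x)"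
    unfolding Q_def using pm d by (intro DERIV_sum DERIV_cmult has_real_derivative_prod) auto
  moreover have "(\<lambda>s. \<Sum>p\<in>S. signof p * (\<Prod>i\<in>{0..<m}. M s $$ (i, p i))) = (\<lambda>s. det (M s))"
    using det[OF M] by simp
  moreover have "(\<Sum>p\<in>S. signof p * (\<Sum>i\<in>{0..<m}. D i (p i) * Q p i))
      = (\<Sum>i<m. \<Sum>j<m. D i j * cofactor (M x) i j)"
  proof -
    define R where "R i = mat m m (\<lambda>(r, c). if r = i then D i c else M x $$ (r, c))" for i
    have R: "R i \<in> carrier_mat m m" for i by (simp add: R_def)
    have row: "(\<Sum>p\<in>S. signof p * (D i (p i) * Q p i)) = (\<Sum>j<m. D i j * cofactor (M x) i j)"
      if i: "i < m" for i
    proof -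
      have "det (R i) = (\<Sum>p\<in>S. signof p * (D i (p i) * Q p i))"
        unfolding det[OF R]
      proof (intro sum.cong refl arg_cong2[where f = "(*)"])
        fix p assume p: "p \<in> S"
        have "(\<Prod>k\<in>{0..<m}. R i $$ (k, p k)) = R i $$ (i, p i) * (\<Prod>k\<in>{0..<m} - {i}. R i $$ (k, p k))"
          using i by (intro prod.remove) auto
        also have "\<dots> = D i (p i) * Q p i"
          unfolding Q_def using pm[OF p] i by (intro arg_cong2[where f = "(*)"] prod.cong) (auto simp: R_def)
        finally show "(\<Prod>k\<in>{0..<m}. R i $$ (k, p k)) = D i (p i) * Q p i" .
      qed
      moreover have "det (R i) = (\<Sum>j<m. R i $$ (i, j) * cofactor (R i) i j)"
        by (rule laplace_expansion_row[OF R i])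
      moreover have "cofactor (R i) i j = cofactor (M x) i j" for j
      proof -
        have "mat_delete (R i) i j = mat_delete (M x) i j"
          using M[of x] i unfolding mat_delete_def R_def by (intro eq_matI) auto
        then show ?thesis by (simp add: cofactor_def)
      qed
      ultimately show ?thesis using i by (simp add: R_def)
    qed
    have "(\<Sum>p\<in>S. signof p * (\<Sum>i\<in>{0..<m}. D i (p i) * Q p i))
       = (\<Sum>p\<in>S. \<Sum>i<m. signof p * (D i (p i) * Q p i))"
      by (simp add: sum_distrib_left lessThan_atLeast0)
    also have "\<dots> = (\<Sum>i<m. \<Sum>p\<in>S. signof p * (D i (p i) * Q p i))"
      by (rule sum.swap)
    also have "\<dots> = (\<Sum>i<m. \<Sum>j<m. D i j * cofactor (M x) i j)" using row by (intro sum.cong) auto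
    finally show ?thesis .
  qed
  ultimately show ?thesis by simp
qed

lemma continuous_on_det:
  fixes M :: "'a::topological_space \<Rightarrow> real mat"
  assumes M: "\<And>x. M x \<in> carrier_mat m m"
    and c: "\<And>i j. i < m \<Longrightarrow> j < m \<Longrightarrow> continuous_on S (\<lambda>x. M x $$ (i, j))"
  shows "continuous_on S (\<lambda>x. det (M x))"
proof -
  have "continuous_on S (\<lambda>x. \<Sum>p\<in>{p. p permutes {0..<m}}. signof p * (\<Prod>i\<in>{0..<m}. M x $$ (i, p i)))"
  proof (intro continuous_on_sum continuous_on_mult continuous_on_const continuous_on_prod)
    fix p i assume "p \<in> {p. p permutes {0..<m}}" "i \<in> {0..<m}"
    then show "continuous_on S (\<lambda>x. M x $$ (i, p i))"
      using c permutes_in_image[of p "{0..<m}" i] by auto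
  qed
  then show ?thesis using det_def'[OF M] by simp
qed

lemma minv_index:
  assumes "P \<in> carrier_mat m m" "i < m" "j < m"
  shows "minv P $$ (i, j) = cofactor P j i / det P"
  using assms by (simp add: minv_def adj_mat_def)

lemma continuous_on_minv:
  fixes M :: "'a::topological_space \<Rightarrow> real mat"
  assumes M: "\<And>x. M x \<in> carrier_mat m m" and nz: "\<And>x. x \<in> S \<Longrightarrow> det (M x) \<noteq> 0"
    and c: "\<And>i j. i < m \<Longrightarrow> j < m \<Longrightarrow> continuous_on S (\<lambda>x. M x $$ (i, j))"
    and ij: "i < m" "j < m"
  shows "continuous_on S (\<lambda>x. minv (M x) $$ (i, j))"
proof -
  have "continuous_on S (\<lambda>x. det (mat_delete (M x) j i))"
  proof (rule continuous_on_det[where m = "m - 1"])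
    show "mat_delete (M x) j i \<in> carrier_mat (m - 1) (m - 1)" for x
      using M[of x] by (rule mat_delete_carrier)
    fix k l assume "k < m - 1" "l < m - 1"
    then have b: "(if k < j then k else Suc k) < m" "(if l < i then l else Suc l) < m" by auto
    have eq: "(\<lambda>x. mat_delete (M x) j i $$ (k, l)) = (\<lambda>x. M x $$ (if k < j then k else Suc k, if l < i then l else Suc l))"
      using carrier_matD[OF M] \<open>k < m - 1\<close> \<open>l < m - 1\<close> unfolding mat_delete_def by (intro ext) simp
    show "continuous_on S (\<lambda>x. mat_delete (M x) j i $$ (k, l))"
      unfolding eq by (rule c[OF b])
  qed
  then have "continuous_on S (\<lambda>x. (- 1) ^ (j + i) * det (mat_delete (M x) j i) / det (M x))"
    using nz continuous_on_det[OF M c] by (intro continuous_intros) auto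
  then show ?thesis using minv_index[OF M ij] by (simp add: cofactor_def)
qed

text \<open>Jacobi's formula, with the inverse in place of the adjugate.\<close>

lemma det_line_derivative:
  assumes P: "P \<in> carrier_mat m m" "det P \<noteq> 0" and E: "E \<in> carrier_mat m m"
  shows "((\<lambda>s. det (P + s \<cdot>\<^sub>m E)) has_real_derivative det P * mtrace (minv P * E)) (at 0)"
proof -
  have "((\<lambda>s. det (P + s \<cdot>\<^sub>m E)) has_real_derivative (\<Sum>i<m. \<Sum>j<m. E $$ (i, j) * cofactor (P + 0 \<cdot>\<^sub>m E) i j)) (at 0)"
  proof (rule det_has_real_derivative)
    show "P + s \<cdot>\<^sub>m E \<in> carrier_mat m m" for s using P E by simp
    fix i j assume "i < m" "j < m"
    then have "(\<lambda>s. (P + s \<cdot>\<^sub>m E) $$ (i, j)) = (\<lambda>s. P $$ (i, j) + s * E $$ (i, j))" using P E by auto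
    then show "((\<lambda>s. (P + s \<cdot>\<^sub>m E) $$ (i, j)) has_real_derivative E $$ (i, j)) (at 0)"
      by (auto intro!: derivative_eq_intros)
  qed
  also have "P + 0 \<cdot>\<^sub>m E = P" using P E by (intro eq_matI) auto
  also have "(\<Sum>i<m. \<Sum>j<m. E $$ (i, j) * cofactor P i j) = det P * mtrace (minv P * E)"
  proof -
    have X: "minv P \<in> carrier_mat m m" using P by simp
    have "mtrace (minv P * E) = (\<Sum>j<m. \<Sum>i<m. cofactor P i j / det P * E $$ (i, j))"
      unfolding mtrace_mult[OF X E] by (intro sum.cong refl) (simp add: minv_index[OF P(1)])
    also have "\<dots> = (\<Sum>i<m. \<Sum>j<m. cofactor P i j / det P * E $$ (i, j))" by (rule sum.swap)
    also have "det P * \<dots> = (\<Sum>i<m. \<Sum>j<m. E $$ (i, j) * cofactor P i j)"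
      unfolding sum_distrib_left using P(2) by (intro sum.cong refl) simp
    finally show ?thesis ..
  qed
  finally show ?thesis .
qed

text \<open>The resolvent identity \<open>X s - X 0 = - s * X s * D * X 0\<close> makes the
  difference quotient exactly \<open>- g s\<close>, and the derivative follows from continuity of
  the inverse.\<close>

lemma minv_line_derivative:
  assumes P: "P \<in> carrier_mat m m" "det P > 0" and D: "D \<in> carrier_mat m m" and E: "E \<in> carrier_mat m m"
  shows "((\<lambda>s. mtrace (minv (P + s \<cdot>\<^sub>m D) * E)) has_real_derivative - mtrace (minv P * D * minv P * E)) (at 0)"
    and "\<forall>\<^sub>F s in nhds 0. det (P + s \<cdot>\<^sub>m D) > 0"
proof -
  define Q where "Q s = P + s \<cdot>\<^sub>m D" for s
  have Q: "Q s \<in> carrier_mat m m" for s using P D by (simp add: Q_def)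
  have Q0: "Q 0 = P" unfolding Q_def using P D by (intro eq_matI) auto
  have cQ: "continuous_on S (\<lambda>s. Q s $$ (i, j))" if "i < m" "j < m" for S i j
  proof -
    have "(\<lambda>s. Q s $$ (i, j)) = (\<lambda>s. P $$ (i, j) + s * D $$ (i, j))" using that P D by (auto simp: Q_def)
    then show ?thesis by (simp only:) (intro continuous_intros)
  qed
  define T where "T = {s. det (Q s) > 0}"
  have "continuous_on UNIV (\<lambda>s. det (Q s))" using continuous_on_det[OF Q cQ] .
  then have "open T" unfolding T_def by (intro open_Collect_less continuous_on_const)
  have T0: "0 \<in> T" using P Q0 by (simp add: T_def)
  show ev: "\<forall>\<^sub>F s in nhds 0. det (P + s \<cdot>\<^sub>m D) > 0"
    using eventually_nhds_in_open[OF \<open>open T\<close> T0] by (simp add: T_def Q_def)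
  define X where "X s = minv (Q s)" for s
  have X: "X s \<in> carrier_mat m m" for s using Q by (simp add: X_def)
  have cX: "isCont (\<lambda>s. X s $$ (i, j)) 0" if "i < m" "j < m" for i j
  proof -
    have "continuous_on T (\<lambda>s. X s $$ (i, j))" unfolding X_def
      by (rule continuous_on_minv[OF Q _ cQ that]) (auto simp: T_def)
    then show ?thesis using continuous_on_eq_continuous_at[OF \<open>open T\<close>] T0 by blast
  qed
  define W where "W = D * X 0 * E"
  have W: "W \<in> carrier_mat m m" using D X E by (auto simp: W_def mult_carrier_mat)
  define g where "g s = mtrace (X s * W)" for s
  have g_eq: "g = (\<lambda>s. \<Sum>i<m. \<Sum>j<m. X s $$ (i, j) * W $$ (j, i))"
    unfolding g_def using mtrace_mult[OF X W] by auto
  have "isCont g 0" unfolding g_eq using cX by (auto intro!: continuous_intros)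
  then have "(g \<longlongrightarrow> g 0) (at 0)" by (simp add: isCont_def)
  moreover have diff: "mtrace (X s * E) - mtrace (X 0 * E) = - s * g s" if s: "s \<in> T" for s
  proof -
    have inv: "X s * Q s = 1\<^sub>m m" "P * X 0 = 1\<^sub>m m"
      using minv[OF Q[of s]] minv[OF Q[of 0]] s T0 Q0 by (auto simp: X_def T_def)
    note car = mult_carrier_mat[of _ m m _ m] smult_carrier_mat minus_carrier_mat
    note assoc = assoc_mult_mat[of _ m m _ m _ m] car
    have "s * g s = mtrace ((s \<cdot>\<^sub>m (X s * D)) * (X 0 * E))"
      using D E X by (simp add: g_def W_def mtrace_linear[of _ m] assoc mult_smult_assoc_mat[of _ m m _ m])
    also have "s \<cdot>\<^sub>m (X s * D) = 1\<^sub>m m - X s * P"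
    proof (rule eq_matI)
      fix i j assume "i < dim_row (1\<^sub>m m - X s * P)" "j < dim_col (1\<^sub>m m - X s * P)"
      then have ij: "i < m" "j < m" using P X[of s] by auto
      have "X s * P + s \<cdot>\<^sub>m (X s * D) = 1\<^sub>m m" using inv(1) P D X[of s] unfolding Q_def
        by (simp add: mult_add_distrib_mat[of _ m m _ m] mult_smult_distrib[of _ m m _ m] car)
      then have "(X s * P + s \<cdot>\<^sub>m (X s * D)) $$ (i, j) = (1\<^sub>m m :: real mat) $$ (i, j)" by simp
      moreover have "dim_row (X s) = m" "dim_col P = m" "dim_col D = m" using X[of s] P D by auto
      ultimately show "(s \<cdot>\<^sub>m (X s * D)) $$ (i, j) = (1\<^sub>m m - X s * P) $$ (i, j)"
        using ij by (simp del: index_mult_mat(1))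
    qed (use X[of s] P D in auto)
    also have "(1\<^sub>m m - X s * P) * (X 0 * E) = X 0 * E - X s * E"
    proof -
      have "X s * P * (X 0 * E) = X s * ((P * X 0) * E)" using X[of s] X[of 0] P(1) E by (simp add: assoc)
      also have "\<dots> = X s * E" using inv E by simp
      finally show ?thesis using X[of s] X[of 0] P(1) E by (simp add: minus_mult_distrib_mat[of _ m m _ _ m] car)
    qed
    also have "mtrace \<dots> = mtrace (X 0 * E) - mtrace (X s * E)" using X E by (simp add: mtrace_linear[of _ m] car)
    finally show ?thesis by simp
  qed
  have "\<forall>\<^sub>F s in nhds 0. s \<in> T" using eventually_nhds_in_open[OF \<open>open T\<close> T0] .
  then have "\<forall>\<^sub>F s in at 0. - g s = (mtrace (X (0 + s) * E) - mtrace (X 0 * E)) / s"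
    unfolding eventually_at_filter by (rule eventually_mono) (simp add: diff)
  ultimately have "((\<lambda>s. (mtrace (X (0 + s) * E) - mtrace (X 0 * E)) / s) \<longlongrightarrow> - g 0) (at 0)"
    by (intro Lim_transform_eventually[OF tendsto_minus])
  then have "((\<lambda>s. mtrace (X s * E)) has_real_derivative - g 0) (at 0)"
    by (simp add: DERIV_def)
  moreover have "g 0 = mtrace (minv P * D * minv P * E)"
    using X[of 0] D E unfolding g_def W_def X_def Q0
    by (simp add: assoc_mult_mat[of _ m m _ m _ m] mult_carrier_mat[of _ m m _ m])
  ultimately show "((\<lambda>s. mtrace (minv (P + s \<cdot>\<^sub>m D) * E)) has_real_derivative - mtrace (minv P * D * minv P * E)) (at 0)"
    by (simp add: X_def Q_def)
qed

section \<open>Hankel matrices and the dual cone\<close>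

abbreviation (input) coeff_space :: "nat \<Rightarrow> real vec set" where
  "coeff_space d \<equiv> carrier_vec (2 * d + 1)"

lemma hankel_carrier [simp]:
  "hankel d x \<in> carrier_mat (d + 1) (d + 1)" "hankel d x \<in> carrier_mat (Suc d) (Suc d)"
  by (simp_all add: hankel_def)

lemma hankel_sym: "(hankel d x)\<^sup>T = hankel d x"
  by (auto simp: hankel_def add.commute intro!: eq_matI)

lemma hankel_add:
  "x \<in> coeff_space d \<Longrightarrow> u \<in> coeff_space d \<Longrightarrow> hankel d (x + u) = hankel d x + hankel d u"
  by (auto simp: hankel_def intro!: eq_matI)

lemma hankel_smult:
  "x \<in> coeff_space d \<Longrightarrow> hankel d (a \<cdot>\<^sub>v x) = a \<cdot>\<^sub>m hankel d x"
  by (auto simp: hankel_def intro!: eq_matI)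

lemma hankel_quadratic_form:
  assumes "v \<in> carrier_vec (d + 1)"
  shows "v \<bullet> (hankel d x *\<^sub>v v) = (\<Sum>i<d + 1. \<Sum>j<d + 1. v $ i * x $ (i + j) * v $ j)"
  unfolding quadratic_form_sum[OF hankel_carrier(1) assms assms]
  by (intro sum.cong refl) (simp add: hankel_def)

section \<open>Moment functionals and sums of squares\<close>

definition moment_functional :: "nat \<Rightarrow> real vec \<Rightarrow> real poly \<Rightarrow> real" where
  "moment_functional d y p = (\<Sum>k<2 * d + 1. coeff p k * y $ k)"

lemma coeff_vec_scalar_prod:
  "y \<in> coeff_space d \<Longrightarrow> coeff_vec d p \<bullet> y = moment_functional d y p"
  by (auto simp: coeff_vec_def moment_functional_def scalar_prod_def lessThan_atLeast0 intro!: sum.cong)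

lemma moment_functional_add: "moment_functional d y (p + q) = moment_functional d y p + moment_functional d y q"
  by (simp add: moment_functional_def sum.distrib algebra_simps)

lemma moment_functional_sum: "moment_functional d y (\<Sum>i\<in>A. f i) = (\<Sum>i\<in>A. moment_functional d y (f i))"
  by (induction A rule: infinite_finite_induct) (auto simp: moment_functional_add, auto simp: moment_functional_def)

lemma moment_functional_monom: "k < 2 * d + 1 \<Longrightarrow> moment_functional d y (monom c k) = c * y $ k"
proof -
  assume k: "k < 2 * d + 1"
  have "moment_functional d y (monom c k) = (\<Sum>i<2 * d + 1. if i = k then c * y $ k else 0)"
    unfolding moment_functional_def by (intro sum.cong) auto
  then show ?thesis using k by simp
qed

lemma moment_functional_square:
  assumes "degree q \<le> d"
  shows "moment_functional d y (q ^ 2) = (\<Sum>i<d + 1. \<Sum>j<d + 1. coeff q i * y $ (i + j) * coeff q j)"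
proof -
  have q: "q = (\<Sum>i<d + 1. monom (coeff q i) i)"
    using poly_as_sum_of_monoms'[OF assms] by (simp add: lessThan_Suc_atMost)
  have "q ^ 2 = (\<Sum>i<d + 1. \<Sum>j<d + 1. monom (coeff q i * coeff q j) (i + j))"
    unfolding power2_eq_square by (subst (1 2) q) (simp only: sum_product mult_monom)
  then have "moment_functional d y (q ^ 2) = (\<Sum>i<d + 1. \<Sum>j<d + 1. moment_functional d y (monom (coeff q i * coeff q j) (i + j)))"
    by (simp only: moment_functional_sum)
  also have "\<dots> = (\<Sum>i<d + 1. \<Sum>j<d + 1. coeff q i * y $ (i + j) * coeff q j)"
    by (intro sum.cong refl) (subst moment_functional_monom, auto)
  finally show ?thesis .
qed

lemma coeff_square_double:
  fixes q :: "real poly"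
  assumes "degree q \<le> D"
  shows "coeff (q ^ 2) (2 * D) = (coeff q D)\<^sup>2"
proof -
  have "coeff (q ^ 2) (2 * D) = (\<Sum>i\<le>2 * D. coeff q i * coeff q (2 * D - i))"
    by (simp add: power2_eq_square coeff_mult)
  also have "\<dots> = (\<Sum>i\<le>2 * D. if i = D then (coeff q D)\<^sup>2 else 0)"
  proof (intro sum.cong refl)
    fix i assume "i \<in> {..2 * D}"
    show "coeff q i * coeff q (2 * D - i) = (if i = D then (coeff q D)\<^sup>2 else 0)"
    proof (cases "i = D")
      case True
      then show ?thesis by (simp add: power2_eq_square)
    next
      case False
      then have "degree q < i \<or> degree q < 2 * D - i" using assms by auto
      then show ?thesis using False by (auto simp: coeff_eq_0)
    qed
  qed
  also have "\<dots> = (coeff q D)\<^sup>2" by simp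
  finally show ?thesis .
qed

text \<open>Leading terms of squares cannot cancel.\<close>

lemma degree_le_of_sum_of_squares:
  fixes qs :: "real poly list"
  assumes "degree (\<Sum>q\<leftarrow>qs. q ^ 2) \<le> 2 * d" "q \<in> set qs"
  shows "degree q \<le> d"
proof (rule ccontr)
  assume "\<not> degree q \<le> d"
  define D where "D = Max (degree ` set qs)"
  have le: "degree r \<le> D" if "r \<in> set qs" for r using that by (simp add: D_def)
  have "D > d" using le[OF assms(2)] \<open>\<not> degree q \<le> d\<close> by simp
  have "D \<in> degree ` set qs" unfolding D_def using assms(2) by (intro Max_in) auto
  then obtain r where r: "r \<in> set qs" "degree r = D" by auto
  have c: "coeff (\<Sum>q\<leftarrow>rs. q ^ 2) (2 * D) = (\<Sum>q\<leftarrow>rs. (coeff q D)\<^sup>2)" if "set rs \<subseteq> set qs" for rs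
    using that le by (induction rs) (auto simp: coeff_square_double)
  have "r \<noteq> 0" using r \<open>D > d\<close> by auto
  then have "0 < (coeff r D)\<^sup>2" using r by auto
  also have "\<dots> \<le> (\<Sum>q\<leftarrow>qs. (coeff q D)\<^sup>2)"
    using r(1) by (intro member_le_sum_list) auto
  also have "\<dots> = coeff (\<Sum>q\<leftarrow>qs. q ^ 2) (2 * D)" using c by simp
  finally have "2 * D \<le> degree (\<Sum>q\<leftarrow>qs. q ^ 2)" by (intro le_degree) auto
  then show False using assms(1) \<open>D > d\<close> by simp
qed

lemma poly_of_vec:
  fixes v :: "real vec"
  shows "i < d + 1 \<Longrightarrow> coeff (\<Sum>k<d + 1. monom (v $ k) k) i = v $ i"
    and "degree (\<Sum>k<d + 1. monom (v $ k) k) \<le> d"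
proof -
  have "coeff (\<Sum>k<d + 1. monom (v $ k) k) i = (\<Sum>k<d + 1. if k = i then v $ i else 0)"
    unfolding coeff_sum by (intro sum.cong) auto
  then show "i < d + 1 \<Longrightarrow> coeff (\<Sum>k<d + 1. monom (v $ k) k) i = v $ i" by simp
  show "degree (\<Sum>k<d + 1. monom (v $ k) k) \<le> d"
    by (intro degree_sum_le) (auto intro!: order.trans[OF degree_monom_le])
qed

text \<open>Evaluating the functional of \<open>y\<close> at \<open>q ^ 2\<close> gives the Hankel
  form at the coefficients of \<open>q\<close>. From right to left every square in a representation
  must have degree at most \<open>2 * d\<close>, which \<open>sum_of_squares\<close> does not state
  and \<open>degree_le_of_sum_of_squares\<close> supplies.\<close>

lemma sos_dual_iff_psd:
  assumes y: "y \<in> coeff_space d"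
  shows "y \<in> sos_dual d \<longleftrightarrow> psd (d + 1) (hankel d y)"
proof
  assume dual: "y \<in> sos_dual d"
  show "psd (d + 1) (hankel d y)" unfolding psd_def
  proof (intro conjI ballI hankel_carrier(1) hankel_sym)
    fix v :: "real vec" assume v: "v \<in> carrier_vec (d + 1)"
    define q where "q = (\<Sum>i<d + 1. monom (v $ i) i)"
    note cq = poly_of_vec(1)[where v = v and d = d, folded q_def] and deg = poly_of_vec(2)[where v = v and d = d, folded q_def]
    have "degree (q ^ 2) \<le> 2 * d" using deg degree_power_le[of q 2] by linarith
    moreover have "sum_of_squares (q ^ 2)" unfolding sum_of_squares_def by (intro exI[of _ "[q]"]) simp
    ultimately have "coeff_vec d (q ^ 2) \<in> sos_cone d" unfolding sos_cone_def by blast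
    then have "0 \<le> coeff_vec d (q ^ 2) \<bullet> y" using dual by (simp add: sos_dual_def)
    also have "\<dots> = v \<bullet> (hankel d y *\<^sub>v v)"
      unfolding coeff_vec_scalar_prod[OF y] moment_functional_square[OF deg] hankel_quadratic_form[OF v]
      by (intro sum.cong refl) (simp add: cq)
    finally show "0 \<le> v \<bullet> (hankel d y *\<^sub>v v)" .
  qed
next
  assume psd: "psd (d + 1) (hankel d y)"
  have "0 \<le> x \<bullet> y" if "x \<in> sos_cone d" for x
  proof -
    from that obtain p qs where p: "x = coeff_vec d p" "degree p \<le> 2 * d" "p = (\<Sum>q\<leftarrow>qs. q ^ 2)"
      unfolding sos_cone_def sum_of_squares_def by blast
    have "0 \<le> moment_functional d y (\<Sum>q\<leftarrow>rs. q ^ 2)" if "set rs \<subseteq> set qs" for rs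
      using that
    proof (induction rs)
      case Nil
      then show ?case by (simp add: moment_functional_def)
    next
      case (Cons q rs)
      have deg: "degree q \<le> d" using degree_le_of_sum_of_squares[of qs d q] p Cons.prems by auto
      have "moment_functional d y (q ^ 2) = vec (d + 1) (coeff q) \<bullet> (hankel d y *\<^sub>v vec (d + 1) (coeff q))"
        unfolding moment_functional_square[OF deg] by (subst hankel_quadratic_form) auto
      also have "\<dots> \<ge> 0" using psd by (simp add: psd_def)
      finally show ?case using Cons by (simp add: moment_functional_add)
    qed
    then show ?thesis using p y by (simp add: coeff_vec_scalar_prod)
  qed
  then show "y \<in> sos_dual d" using y by (simp add: sos_dual_def)
qed

lemma sos_cone_carrier: "x \<in> sos_cone d \<Longrightarrow> x \<in> coeff_space d"
  by (auto simp: sos_cone_def coeff_vec_def)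

lemma sos_dual_carrier: "y \<in> sos_dual d \<Longrightarrow> y \<in> coeff_space d"
  by (simp add: sos_dual_def)

lemma interior_of_vec_top:
  "x \<in> vec_top n interior_of S \<longleftrightarrow>
    x \<in> carrier_vec n \<and> (\<exists>r>0. \<forall>y\<in>carrier_vec n. l2_norm (y - x) < r \<longrightarrow> y \<in> S)"
proof -
  interpret Metric_space "carrier_vec n" "l2_dist n" by (rule Metric_space_l2_dist)
  have d: "l2_dist n x y = l2_norm (y - x)" if "x \<in> carrier_vec n" "y \<in> carrier_vec n" for x y
    using that by (simp add: l2_dist_eq_l2_norm commute[of x y])
  have "x \<in> vec_top n interior_of S \<longleftrightarrow> x \<in> carrier_vec n \<and> (\<exists>r>0. mball x r \<subseteq> S)"
  proof
    assume "x \<in> vec_top n interior_of S"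
    then obtain T where T: "openin mtopology T" "x \<in> T" "T \<subseteq> S"
      by (auto simp: vec_top_def interior_of_def)
    then show "x \<in> carrier_vec n \<and> (\<exists>r>0. mball x r \<subseteq> S)"
      unfolding openin_mtopology by blast
  next
    assume "x \<in> carrier_vec n \<and> (\<exists>r>0. mball x r \<subseteq> S)"
    then obtain r where "x \<in> carrier_vec n" "r > 0" "mball x r \<subseteq> S" by blast
    then show "x \<in> vec_top n interior_of S"
      unfolding vec_top_def interior_of_def using openin_mball[of x r] by (auto intro!: exI[of _ "mball x r"])
  qed
  also have "\<dots> \<longleftrightarrow> x \<in> carrier_vec n \<and> (\<exists>r>0. \<forall>y\<in>carrier_vec n. l2_norm (y - x) < r \<longrightarrow> y \<in> S)"
    using d by (auto simp: subset_iff)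
  finally show ?thesis .
qed

lemma frontier_of_vec_top_approx:
  assumes "x \<in> vec_top n frontier_of S" "r > 0"
  shows "x \<in> carrier_vec n" "\<exists>y\<in>S. y \<in> carrier_vec n \<and> l2_norm (y - x) < r"
proof -
  interpret Metric_space "carrier_vec n" "l2_dist n" by (rule Metric_space_l2_dist)
  have "x \<in> mtopology closure_of S" using assms by (auto simp: vec_top_def frontier_of_def)
  then have x: "x \<in> carrier_vec n" and "\<exists>y\<in>S. y \<in> mball x r"
    using assms(2) by (auto simp: metric_closure_of)
  then show "x \<in> carrier_vec n" "\<exists>y\<in>S. y \<in> carrier_vec n \<and> l2_norm (y - x) < r"
    by (auto simp: l2_dist_eq_l2_norm commute[of x])
qed

section \<open>The Hessian of the barrier\<close>

lemma sum_over_antidiagonals: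
  fixes f :: "nat \<Rightarrow> nat \<Rightarrow> real"
  shows "(\<Sum>k<2 * d + 1. \<Sum>i<d + 1. \<Sum>j<d + 1. if k = i + j then f i j else 0) = (\<Sum>i<d + 1. \<Sum>j<d + 1. f i j)"
proof -
  have "(\<Sum>k<2 * d + 1. \<Sum>i<d + 1. \<Sum>j<d + 1. if k = i + j then f i j else 0)
      = (\<Sum>i<d + 1. \<Sum>j<d + 1. \<Sum>k<2 * d + 1. if k = i + j then f i j else 0)" by (rule sum_rotate)
  also have "\<dots> = (\<Sum>i<d + 1. \<Sum>j<d + 1. f i j)"
    by (intro sum.cong refl) (subst sum.delta, auto)
  finally show ?thesis .
qed

lemma mtrace_hankel:
  assumes "A \<in> carrier_mat (d + 1) (d + 1)"
  shows "mtrace (A * hankel d w) = (\<Sum>i<d + 1. \<Sum>j<d + 1. A $$ (i, j) * w $ (i + j))"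
  unfolding mtrace_mult[OF assms hankel_carrier(1)]
  by (intro sum.cong refl) (simp add: hankel_def add.commute)

lemma mtrace_hankel_expand:
  assumes "A \<in> carrier_mat (d + 1) (d + 1)"
  shows "mtrace (A * hankel d w) = (\<Sum>k<2 * d + 1. w $ k * mtrace (A * hankel d (unit_vec (2 * d + 1) k)))"
proof -
  have "(\<Sum>k<2 * d + 1. w $ k * mtrace (A * hankel d (unit_vec (2 * d + 1) k)))
      = (\<Sum>k<2 * d + 1. \<Sum>i<d + 1. \<Sum>j<d + 1. if k = i + j then A $$ (i, j) * w $ (i + j) else 0)"
    unfolding mtrace_hankel[OF assms] sum_distrib_left by (intro sum.cong refl) auto
  also have "\<dots> = (\<Sum>i<d + 1. \<Sum>j<d + 1. A $$ (i, j) * w $ (i + j))"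
    by (rule sum_over_antidiagonals)
  finally show ?thesis by (simp add: mtrace_hankel[OF assms])
qed

text \<open>Jacobi's formula evaluates the inner derivative, and differentiating the inverse
  evaluates the outer one.\<close>

lemma hessian_eq:
  assumes y: "y \<in> coeff_space d" and pd: "pd (d + 1) (hankel d y)"
    and ij: "i < 2 * d + 1" "j < 2 * d + 1"
  defines "X \<equiv> minv (hankel d y)" and "E \<equiv> \<lambda>k. hankel d (unit_vec (2 * d + 1) k)"
  shows "hessian d y $$ (i, j) = mtrace (X * E i * X * E j)"
proof -
  let ?e = "unit_vec (2 * d + 1)"
  define P where "P = hankel d y"
  have P: "P \<in> carrier_mat (d + 1) (d + 1)" "det P > 0" using pd_det_pos[OF pd] by (simp_all add: P_def)
  have E: "E k \<in> carrier_mat (d + 1) (d + 1)" for k by (simp add: E_def)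
  have bar: "barrier d (y + a \<cdot>\<^sub>v ?e i + b \<cdot>\<^sub>v ?e j) = - ln (det (P + a \<cdot>\<^sub>m E i + b \<cdot>\<^sub>m E j))" for a b
    using y hankel_add[of "y + a \<cdot>\<^sub>v ?e i" d "b \<cdot>\<^sub>v ?e j"]
      hankel_add[of y d "a \<cdot>\<^sub>v ?e i"]
    unfolding barrier_def P_def E_def by (simp only: hankel_smult unit_vec_carrier smult_carrier_vec add_carrier_vec)
  have inner: "deriv (\<lambda>b. barrier d (y + a \<cdot>\<^sub>v ?e i + b \<cdot>\<^sub>v ?e j)) 0
      = - mtrace (minv (P + a \<cdot>\<^sub>m E i) * E j)" if a: "det (P + a \<cdot>\<^sub>m E i) > 0" for a
  proof -
    define Q where "Q = P + a \<cdot>\<^sub>m E i"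
    have Q: "Q \<in> carrier_mat (d + 1) (d + 1)" "det Q > 0" using P E a by (simp_all add: Q_def)
    have Q0: "Q + 0 \<cdot>\<^sub>m E j = Q" using Q E[of j] by (intro eq_matI) auto
    have "((\<lambda>b. - ln (det (Q + b \<cdot>\<^sub>m E j))) has_real_derivative - (det Q * mtrace (minv Q * E j) / det (Q + 0 \<cdot>\<^sub>m E j))) (at 0)"
      using det_line_derivative[OF Q(1) _ E, of j] Q Q0 by (auto intro!: derivative_eq_intros)
    then have "((\<lambda>b. - ln (det (Q + b \<cdot>\<^sub>m E j))) has_real_derivative - mtrace (minv Q * E j)) (at 0)"
      using Q Q0 by simp
    then show ?thesis unfolding bar Q_def[symmetric] by (rule DERIV_imp_deriv)
  qed
  \<comment> \<open>The formula for the inner derivative holds only while the determinant stays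
    positive, so the functions of \<open>a\<close> are compared as germs at 0.\<close>
  have "\<forall>\<^sub>F a in nhds 0. deriv (\<lambda>b. barrier d (y + a \<cdot>\<^sub>v ?e i + b \<cdot>\<^sub>v ?e j)) 0
      = - mtrace (minv (P + a \<cdot>\<^sub>m E i) * E j)"
    using minv_line_derivative(2)[OF P E E] by (rule eventually_mono) (rule inner)
  then have "deriv (\<lambda>a. deriv (\<lambda>b. barrier d (y + a \<cdot>\<^sub>v ?e i + b \<cdot>\<^sub>v ?e j)) 0) 0
      = deriv (\<lambda>a. - mtrace (minv (P + a \<cdot>\<^sub>m E i) * E j)) 0"
    by (intro deriv_cong_ev) auto
  also have "\<dots> = mtrace (minv P * E i * minv P * E j)"
    using DERIV_minus[OF minv_line_derivative(1)[OF P E E, of i j]] by (intro DERIV_imp_deriv) simp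
  finally show ?thesis using ij by (simp add: hessian_def X_def P_def)
qed

text \<open>By \<open>hessian_bilinear\<close> this is the Hessian of the barrier at
  \<open>y\<close> as a bilinear form; its diagonal is the squared local norm.\<close>

definition local_form :: "nat \<Rightarrow> real vec \<Rightarrow> real vec \<Rightarrow> real vec \<Rightarrow> real" where
  "local_form d y u w = mtrace (minv (hankel d y) * hankel d u * minv (hankel d y) * hankel d w)"

lemma hessian_bilinear:
  assumes y: "y \<in> coeff_space d" and pd: "pd (d + 1) (hankel d y)"
    and u: "u \<in> coeff_space d" and w: "w \<in> coeff_space d"
  shows "u \<bullet> (hessian d y *\<^sub>v w) = local_form d y u w"
proof -
  define X where "X = minv (hankel d y)"
  define E where "E k = hankel d (unit_vec (2 * d + 1) k)" for k
  have X: "X \<in> carrier_mat (d + 1) (d + 1)" by (simp add: X_def)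
  have E: "E k \<in> carrier_mat (d + 1) (d + 1)" "hankel d v \<in> carrier_mat (d + 1) (d + 1)" for k v by (simp_all add: E_def)
  note car = mult_carrier_mat[of _ "d + 1" "d + 1" _ "d + 1"]
  note assoc = assoc_mult_mat[of _ "d + 1" "d + 1" _ "d + 1" _ "d + 1"] car
  have H: "hessian d y \<in> carrier_mat (2 * d + 1) (2 * d + 1)" by (simp add: hessian_def)
  have cyc: "mtrace (X * A * X * B) = mtrace (X * B * X * A)"
    if "A \<in> carrier_mat (d + 1) (d + 1)" "B \<in> carrier_mat (d + 1) (d + 1)" for A B
    using that X mtrace_comm[of "X * A" "d + 1" "d + 1" "X * B"] by (simp add: assoc)
  have "u \<bullet> (hessian d y *\<^sub>v w) = (\<Sum>i<2 * d + 1. u $ i * (\<Sum>j<2 * d + 1. w $ j * mtrace (X * E i * X * E j)))"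
    unfolding quadratic_form_sum[OF H u w] sum_distrib_left
    by (intro sum.cong refl) (simp add: hessian_eq[OF y pd] X_def E_def)
  also have "\<dots> = (\<Sum>i<2 * d + 1. u $ i * mtrace (X * E i * X * hankel d w))"
    unfolding E_def using X by (subst (2) mtrace_hankel_expand) (auto intro!: car)
  also have "\<dots> = (\<Sum>i<2 * d + 1. u $ i * mtrace (X * hankel d w * X * E i))"
    using cyc E by simp
  also have "\<dots> = mtrace (X * hankel d w * X * hankel d u)"
    unfolding E_def using X by (subst (2) mtrace_hankel_expand) (auto intro!: car)
  also have "\<dots> = local_form d y u w" using cyc E by (simp add: local_form_def X_def)
  finally show ?thesis .
qed

text \<open>Column \<open>a\<close> of \<open>K\<close>, with \<open>K * K\<^sup>T\<close> the
  inverse Hankel matrix, is read as a polynomial with value \<open>k a z\<close> at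
  \<open>z\<close>. The squares of these polynomials sum to \<open>t\<close>, and the entries of
  \<open>K\<^sup>T * hankel d u * K\<close> pair \<open>u\<close> with the coefficients of their
  pairwise products. \<open>low\<close> trades the norms of those coefficient vectors for values at
  \<open>Z\<close>, where the double sum over products becomes the square of the value of
  \<open>t\<close>.\<close>

lemma local_form_le:
  assumes pd: "pd (d + 1) (hankel d y)" and u: "u \<in> coeff_space d"
    and t: "t \<in> coeff_space d" "\<And>w. w \<in> coeff_space d \<Longrightarrow> t \<bullet> w = mtrace (minv (hankel d y) * hankel d w)"
    and Z: "finite Z" "\<And>z. z \<in> Z \<Longrightarrow> 0 < \<alpha> z" "(\<Sum>z\<in>Z. \<alpha> z * (\<Sum>k<2 * d + 1. z ^ (2 * k))) = 1"
    and low: "\<And>v. (\<Sum>k<2 * d + 1. (v k)\<^sup>2) \<le> c * (\<Sum>z\<in>Z. \<alpha> z * (\<Sum>k<2 * d + 1. v k * z ^ k)\<^sup>2)"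
    and c: "0 \<le> c"
  shows "local_form d y u u \<le> c * (t \<bullet> t) * (u \<bullet> u)"
proof -
  define X where "X = minv (hankel d y)"
  have X: "X \<in> carrier_mat (d + 1) (d + 1)" by (simp add: X_def)
  obtain K where K: "K \<in> carrier_mat (d + 1) (d + 1)" "X = K * K\<^sup>T"
    using psd_factor[OF pd_minv_psd[OF pd]] unfolding X_def by blast
  \<comment> \<open>\<open>l a b\<close> holds the coefficients of the product of the polynomials in
    columns \<open>a\<close> and \<open>b\<close>.\<close>
  define l where "l a b k = (\<Sum>i<d + 1. \<Sum>j<d + 1. if k = i + j then K $$ (i, a) * K $$ (j, b) else 0)" for a b k
  have l: "(\<Sum>k<2 * d + 1. l a b k * v k) = (\<Sum>i<d + 1. \<Sum>j<d + 1. K $$ (i, a) * v (i + j) * K $$ (j, b))" for a b v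
  proof -
    have "(\<Sum>k<2 * d + 1. l a b k * v k) = (\<Sum>k<2 * d + 1. \<Sum>i<d + 1. \<Sum>j<d + 1. if k = i + j then K $$ (i, a) * v (i + j) * K $$ (j, b) else 0)"
      unfolding l_def sum_distrib_right by (intro sum.cong refl) auto
    also have "\<dots> = (\<Sum>i<d + 1. \<Sum>j<d + 1. K $$ (i, a) * v (i + j) * K $$ (j, b))"
      by (rule sum_over_antidiagonals)
    finally show ?thesis .
  qed
  have lf: "local_form d y u u = (\<Sum>a<d + 1. \<Sum>b<d + 1. (\<Sum>k<2 * d + 1. l a b k * u $ k)\<^sup>2)"
  proof -
    have KT: "K\<^sup>T \<in> carrier_mat (d + 1) (d + 1)" using K by simp
    have "(K\<^sup>T * hankel d u * K) $$ (a, b) = (\<Sum>k<2 * d + 1. l a b k * u $ k)" if "a < d + 1" "b < d + 1" for a b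
    proof -
      have "(K\<^sup>T * hankel d u * K) $$ (a, b) = (\<Sum>j<d + 1. (\<Sum>i<d + 1. K\<^sup>T $$ (a, i) * hankel d u $$ (i, j)) * K $$ (j, b))"
        using that mult_mat_index_sum[OF mult_carrier_mat[OF KT hankel_carrier(1)] K(1), of a b u] mult_mat_index_sum[OF KT hankel_carrier(1), of a _ u]
        by simp
      also have "\<dots> = (\<Sum>j<d + 1. \<Sum>i<d + 1. K $$ (i, a) * u $ (i + j) * K $$ (j, b))"
        unfolding sum_distrib_right using that K by (intro sum.cong refl) (simp add: hankel_def)
      also have "\<dots> = (\<Sum>i<d + 1. \<Sum>j<d + 1. K $$ (i, a) * u $ (i + j) * K $$ (j, b))" by (rule sum.swap)
      finally show ?thesis unfolding l .
    qed
    then show ?thesis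
      unfolding local_form_def X_def[symmetric] mtrace_congruence[OF K(1) hankel_carrier(1) hankel_sym K(2)]
      by simp
  qed
  define N where "N = (\<Sum>a<d + 1. \<Sum>b<d + 1. \<Sum>k<2 * d + 1. (l a b k)\<^sup>2)"
  have "local_form d y u u \<le> (\<Sum>a<d + 1. \<Sum>b<d + 1. (\<Sum>k<2 * d + 1. (l a b k)\<^sup>2) * (\<Sum>k<2 * d + 1. (u $ k)\<^sup>2))"
    unfolding lf by (intro sum_mono Cauchy_Schwarz_ineq_sum)
  also have "\<dots> = N * (u \<bullet> u)"
    unfolding N_def scalar_prod_self_sum[OF u] sum_distrib_right ..
  finally have 1: "local_form d y u u \<le> N * (u \<bullet> u)" .
  define k where "k a z = (\<Sum>i<d + 1. K $$ (i, a) * z ^ i)" for a and z :: real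
  \<comment> \<open>\<open>t\<close> is the adjoint Hankel map applied to
    \<open>X = K * K\<^sup>T\<close>; pairing it with the moment vector of the point
    \<open>z\<close> exhibits its value as a sum of squares.\<close>
  have tz: "(\<Sum>a<d + 1. (k a z)\<^sup>2) = (\<Sum>i<2 * d + 1. t $ i * z ^ i)" for z
  proof -
    define q where "q = vec (2 * d + 1) (\<lambda>i. z ^ i)"
    have "(\<Sum>i<2 * d + 1. t $ i * z ^ i) = t \<bullet> q"
      by (auto simp: q_def scalar_prod_def lessThan_atLeast0)
    also have "\<dots> = (\<Sum>i<d + 1. \<Sum>j<d + 1. X $$ (i, j) * q $ (i + j))"
      using t(2)[of q] mtrace_hankel[OF X, of q] by (simp add: q_def X_def)
    also have "\<dots> = (\<Sum>i<d + 1. \<Sum>j<d + 1. \<Sum>a<d + 1. (K $$ (i, a) * z ^ i) * (K $$ (j, a) * z ^ j))"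
    proof (intro sum.cong refl)
      fix i j assume ij: "i \<in> {..<d + 1}" "j \<in> {..<d + 1}"
      have "X $$ (i, j) = (\<Sum>a<d + 1. K $$ (i, a) * K\<^sup>T $$ (a, j))"
        unfolding K(2) using ij K(1) by (intro mult_mat_index_sum) auto
      also have "\<dots> = (\<Sum>a<d + 1. K $$ (i, a) * K $$ (j, a))" using ij K(1) by (intro sum.cong) auto
      finally have "X $$ (i, j) * (z ^ i * z ^ j) = (\<Sum>a<d + 1. (K $$ (i, a) * z ^ i) * (K $$ (j, a) * z ^ j))"
        by (simp only: sum_distrib_right) (intro sum.cong refl, simp)
      then show "X $$ (i, j) * q $ (i + j) = (\<Sum>a<d + 1. (K $$ (i, a) * z ^ i) * (K $$ (j, a) * z ^ j))"
        using ij by (simp add: q_def power_add)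
    qed
    also have "\<dots> = (\<Sum>a<d + 1. \<Sum>i<d + 1. \<Sum>j<d + 1. (K $$ (i, a) * z ^ i) * (K $$ (j, a) * z ^ j))"
      by (rule sum_rotate[symmetric])
    also have "\<dots> = (\<Sum>a<d + 1. (k a z)\<^sup>2)" by (simp only: k_def power2_eq_square sum_product)
    finally show ?thesis ..
  qed
  have lz: "(\<Sum>r<2 * d + 1. l a b r * z ^ r) = k a z * k b z" for a b z
    unfolding l k_def sum_product by (intro sum.cong refl) (simp add: power_add)
  have "N \<le> (\<Sum>a<d + 1. \<Sum>b<d + 1. c * (\<Sum>z\<in>Z. \<alpha> z * (k a z * k b z)\<^sup>2))"
    unfolding N_def lz[symmetric] by (intro sum_mono low)
  also have "\<dots> = c * (\<Sum>z\<in>Z. \<alpha> z * (\<Sum>a<d + 1. \<Sum>b<d + 1. (k a z * k b z)\<^sup>2))"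
    by (simp only: sum_distrib_left[symmetric] sum_rotate[symmetric])
  also have "\<dots> = c * (\<Sum>z\<in>Z. \<alpha> z * (\<Sum>i<2 * d + 1. t $ i * z ^ i)\<^sup>2)"
  proof -
    have "(\<Sum>a<d + 1. \<Sum>b<d + 1. (k a z * k b z)\<^sup>2) = (\<Sum>i<2 * d + 1. t $ i * z ^ i)\<^sup>2" for z
      unfolding tz[symmetric] by (simp only: power2_eq_square[of "sum _ _"] sum_product power_mult_distrib)
    then show ?thesis by simp
  qed
  \<comment> \<open>Cauchy-Schwarz separates the norm of \<open>t\<close> from the sum of even
    powers, whose weighted total is 1 by normalisation.\<close>
  also have "\<dots> \<le> c * (\<Sum>z\<in>Z. \<alpha> z * ((t \<bullet> t) * (\<Sum>k<2 * d + 1. z ^ (2 * k))))"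
  proof (intro mult_left_mono sum_mono c)
    fix z assume "z \<in> Z"
    then show "0 \<le> \<alpha> z" using Z by (auto intro: less_imp_le)
    have "(\<Sum>i<2 * d + 1. t $ i * z ^ i)\<^sup>2 \<le> (\<Sum>i<2 * d + 1. (t $ i)\<^sup>2) * (\<Sum>i<2 * d + 1. (z ^ i)\<^sup>2)"
      by (rule Cauchy_Schwarz_ineq_sum)
    also have "(\<Sum>i<2 * d + 1. (z ^ i)\<^sup>2) = (\<Sum>i<2 * d + 1. z ^ (2 * i))"
      by (intro sum.cong refl) (simp add: mult.commute flip: power_mult)
    finally show "(\<Sum>i<2 * d + 1. t $ i * z ^ i)\<^sup>2 \<le> (t \<bullet> t) * (\<Sum>k<2 * d + 1. z ^ (2 * k))"
      by (simp only: scalar_prod_self_sum[OF t(1)])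
  qed
  also have "(\<Sum>z\<in>Z. \<alpha> z * ((t \<bullet> t) * (\<Sum>k<2 * d + 1. z ^ (2 * k)))) = (t \<bullet> t) * (\<Sum>z\<in>Z. \<alpha> z * (\<Sum>k<2 * d + 1. z ^ (2 * k)))"
    unfolding sum_distrib_left by (intro sum.cong refl) simp
  also have "c * \<dots> = c * (t \<bullet> t)" unfolding Z(3) by simp
  finally have "N * (u \<bullet> u) \<le> c * (t \<bullet> t) * (u \<bullet> u)"
    by (intro mult_right_mono) (simp_all add: scalar_prod_self_sum[OF u] sum_nonneg)
  with 1 show ?thesis by simp
qed

section \<open>Perturbation of certificates\<close>

lemma l2_norm_sq: "(l2_norm v)\<^sup>2 = v \<bullet> v"
  by (auto simp: l2_norm_def L2_set_def scalar_prod_def lessThan_atLeast0 power2_eq_square sum_nonneg intro!: sum.cong)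

lemma l2_norm_nonneg [simp]: "0 \<le> l2_norm v"
  by (simp add: l2_norm_def)

lemma l2_norm_smult: "l2_norm (a \<cdot>\<^sub>v v) = \<bar>a\<bar> * l2_norm v"
proof (rule power2_eq_imp_eq)
  show "(l2_norm (a \<cdot>\<^sub>v v))\<^sup>2 = (\<bar>a\<bar> * l2_norm v)\<^sup>2"
    unfolding power_mult_distrib l2_norm_sq by (simp add: power2_eq_square)
qed auto

lemma abs_index_le_l2_norm: "i < dim_vec v \<Longrightarrow> \<bar>v $ i\<bar> \<le> l2_norm v"
  unfolding l2_norm_def using member_le_L2_set[of "{..<dim_vec v}" i "\<lambda>i. \<bar>v $ i\<bar>"] by (simp add: L2_set_def)

text \<open>Test vectors with at most two nonzero entries already reach every coordinate of
  \<open>x\<close>. They serve both for the injectivity of the Hankel map and for the coordinate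
  bound on the dual cone.\<close>

lemma hankel_form_units:
  fixes s :: real
  assumes "i \<le> d" "j \<le> d"
    and v_def: "v = unit_vec (d + 1) i + s \<cdot>\<^sub>v unit_vec (d + 1) j"
  shows "v \<bullet> (hankel d x *\<^sub>v v) = x $ (2 * i) + 2 * s * x $ (i + j) + s\<^sup>2 * x $ (2 * j)"
proof -
  have c: "unit_vec (d + 1) i \<in> carrier_vec (d + 1)" "unit_vec (d + 1) j \<in> carrier_vec (d + 1)" by auto
  have u: "unit_vec (d + 1) a \<bullet> (hankel d x *\<^sub>v unit_vec (d + 1) b) = x $ (a + b)" if "a \<le> d" "b \<le> d" for a b
  proof -
    have "unit_vec (d + 1) a \<bullet> (hankel d x *\<^sub>v unit_vec (d + 1) b) = (hankel d x *\<^sub>v unit_vec (d + 1) b) $ a"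
      using that by (intro scalar_prod_left_unit mult_mat_vec_carrier[OF hankel_carrier(1) unit_vec_carrier]) simp
    also have "\<dots> = row (hankel d x) a \<bullet> unit_vec (d + 1) b" using that by (simp add: hankel_def)
    also have "\<dots> = row (hankel d x) a $ b" using that by (intro scalar_prod_right_unit) auto
    also have "\<dots> = x $ (a + b)" using that by (simp add: hankel_def)
    finally show ?thesis .
  qed
  have Hv: "hankel d x *\<^sub>v v = hankel d x *\<^sub>v unit_vec (d + 1) i + s \<cdot>\<^sub>v (hankel d x *\<^sub>v unit_vec (d + 1) j)"
    unfolding v_def using c
    by (subst mult_add_distrib_mat_vec[OF hankel_carrier(1)]) (auto simp: mult_mat_vec[OF hankel_carrier(2)])
  have cc: "hankel d x *\<^sub>v unit_vec (d + 1) i \<in> carrier_vec (d + 1)" "hankel d x *\<^sub>v unit_vec (d + 1) j \<in> carrier_vec (d + 1)"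
    by (rule mult_mat_vec_carrier[OF hankel_carrier(1) unit_vec_carrier])+
  have gen: "(p + s \<cdot>\<^sub>v q) \<bullet> (a + s \<cdot>\<^sub>v b) = p \<bullet> a + s * (p \<bullet> b) + s * (q \<bullet> a) + s\<^sup>2 * (q \<bullet> b)"
    if "p \<in> carrier_vec N" "q \<in> carrier_vec N" "a \<in> carrier_vec N" "b \<in> carrier_vec N" for N and p q a b :: "real vec"
    using that by (simp add: add_scalar_prod_distrib[of _ N] scalar_prod_add_distrib[of _ N] power2_eq_square distrib_left)
  show ?thesis
    unfolding Hv unfolding v_def gen[OF c cc] u[OF assms(1,1)] u[OF assms(1,2)] u[OF assms(2,1)] u[OF assms(2,2)] add.commute[of j i]
    by (simp flip: mult_2)
qed

lemma index_split:
  fixes k :: nat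
  assumes "k < 2 * d + 1"
  obtains i j where "i \<le> d" "j \<le> d" "i + j = k"
  using assms that[of "min k d" "k - min k d"] by auto

lemma hankel_form_zero:
  assumes "x \<in> coeff_space d" "\<And>v. v \<in> carrier_vec (d + 1) \<Longrightarrow> v \<bullet> (hankel d x *\<^sub>v v) = 0"
  shows "x = 0\<^sub>v (2 * d + 1)"
proof (rule eq_vecI)
  fix k assume "k < dim_vec (0\<^sub>v (2 * d + 1) :: real vec)"
  then have k: "k < 2 * d + 1" by simp
  then obtain i j where ij: "i \<le> d" "j \<le> d" "i + j = k" using index_split by blast
  have "x $ (2 * i) + 2 * s * x $ k + s\<^sup>2 * x $ (2 * j) = 0" for s
    using hankel_form_units[OF ij(1,2) refl, where x = x and s = s] assms(2)[of "unit_vec (d + 1) i + s \<cdot>\<^sub>v unit_vec (d + 1) j"] ij(3) by simp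
  from this[of 1] this[of "- 1"] show "x $ k = 0\<^sub>v (2 * d + 1) $ k" using k by simp
qed (use assms in auto)

text \<open>The test vectors with \<open>s = 1\<close> and \<open>s = - 1\<close> give
  \<open>2 * \<bar>y $ (i + j)\<bar> \<le> y $ (2 * i) + y $ (2 * j)\<close>, and each diagonal
  entry is at most the trace.\<close>

lemma sos_dual_index_bound:
  assumes "y \<in> sos_dual d" "k < 2 * d + 1"
  shows "\<bar>y $ k\<bar> \<le> (\<Sum>i<d + 1. y $ (2 * i))"
proof -
  have psd: "psd (d + 1) (hankel d y)" using assms(1) sos_dual_iff_psd[OF sos_dual_carrier] by blast
  have form: "0 \<le> y $ (2 * i) + 2 * s * y $ (i + j) + s\<^sup>2 * y $ (2 * j)" if "i \<le> d" "j \<le> d" for i j s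
    using psd hankel_form_units[OF that refl, where x = y and s = s] unfolding psd_def by (metis add_carrier_vec smult_carrier_vec unit_vec_carrier)
  have nn: "0 \<le> y $ (2 * i)" if "i < d + 1" for i using form[of i i 0] that by simp
  have le: "y $ (2 * i) \<le> (\<Sum>i<d + 1. y $ (2 * i))" if "i \<le> d" for i
    using that nn by (intro member_le_sum) auto
  obtain i j where ij: "i \<le> d" "j \<le> d" "i + j = k" using index_split assms(2) by blast
  show ?thesis using form[OF ij(1,2), of 1] form[OF ij(1,2), of "- 1"] le[OF ij(1)] le[OF ij(2)] ij(3) by simp
qed

section \<open>The vector \<open>e\<close> and the minimum over the dual cone\<close>

lemma frobenius_one_hankel: "frobenius_prod (1\<^sub>m (d + 1)) (hankel d x) = (\<Sum>i<d + 1. x $ (2 * i))"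
proof -
  have "frobenius_prod (1\<^sub>m (d + 1)) (hankel d x) = (\<Sum>i<d + 1. \<Sum>j<d + 1. if j = i then x $ (2 * i) else 0)"
    unfolding frobenius_prod_def by (intro sum.cong) (auto simp: hankel_def mult_2)
  then show ?thesis by simp
qed

lemma coeff_vec_even:
  assumes "x \<in> coeff_space d"
  shows "coeff_vec d (\<Sum>i\<le>d. monom 1 (2 * i)) \<bullet> x = (\<Sum>i<d + 1. x $ (2 * i))"
  unfolding coeff_vec_scalar_prod[OF assms] moment_functional_sum
  by (intro sum.cong) (auto simp: moment_functional_monom)

lemma e_vec_eq: "e_vec d = coeff_vec d (\<Sum>i\<le>d. monom 1 (2 * i))"
  unfolding e_vec_def hankel_adjoint_def
proof (rule the_equality)
  let ?e = "coeff_vec d (\<Sum>i\<le>d. monom 1 (2 * i))"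
  have c: "?e \<in> coeff_space d" by (simp add: coeff_vec_def)
  show "?e \<in> coeff_space d \<and> (\<forall>x\<in>coeff_space d. ?e \<bullet> x = frobenius_prod (1\<^sub>m (d + 1)) (hankel d x))"
    using c frobenius_one_hankel coeff_vec_even by metis
  fix v assume v: "v \<in> coeff_space d \<and> (\<forall>x\<in>coeff_space d. v \<bullet> x = frobenius_prod (1\<^sub>m (d + 1)) (hankel d x))"
  show "v = ?e"
  proof (rule eq_vecI)
    fix k assume "k < dim_vec ?e"
    then have k: "k < 2 * d + 1" using c by simp
    then have "v \<bullet> unit_vec (2 * d + 1) k = ?e \<bullet> unit_vec (2 * d + 1) k"
      using v by (simp only: frobenius_one_hankel coeff_vec_even unit_vec_carrier)
    then show "v $ k = ?e $ k" using v c k by (simp only: scalar_prod_right_unit)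
  qed (use v c in auto)
qed

lemma e_vec_scalar_prod:
  "x \<in> coeff_space d \<Longrightarrow> e_vec d \<bullet> x = (\<Sum>i<d + 1. x $ (2 * i))"
  unfolding e_vec_eq by (rule coeff_vec_even)

lemma e_vec_carrier [simp]: "e_vec d \<in> coeff_space d"
  by (simp add: e_vec_eq coeff_vec_def)

lemma linf_norm_le_e_vec:
  assumes "y \<in> sos_dual d"
  shows "linf_norm y \<le> e_vec d \<bullet> y"
  unfolding linf_norm_def e_vec_scalar_prod[OF sos_dual_carrier[OF assms]]
  using sos_dual_index_bound[OF assms] sos_dual_carrier[OF assms] by (intro Max.boundedI) auto

lemma unit_vec_0_sos_dual: "unit_vec (2 * d + 1) 0 \<in> sos_dual d"
proof -
  have c: "unit_vec (2 * d + 1) 0 \<in> coeff_space d" by simp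
  have "0 \<le> v \<bullet> (hankel d (unit_vec (2 * d + 1) 0) *\<^sub>v v)" if "v \<in> carrier_vec (d + 1)" for v
  proof -
    have "v \<bullet> (hankel d (unit_vec (2 * d + 1) 0) *\<^sub>v v) = (\<Sum>i<d + 1. \<Sum>j<d + 1. if j = 0 then (if i = 0 then (v $ 0)\<^sup>2 else 0) else 0)"
      unfolding hankel_quadratic_form[OF that] by (intro sum.cong) (auto simp: power2_eq_square)
    then show ?thesis by simp
  qed
  then show ?thesis unfolding sos_dual_iff_psd[OF c] psd_def using hankel_sym by simp
qed

text \<open>The minimum is exactly 1: \<open>linf_norm_le_e_vec\<close> is the lower bound, and the
  moment vector of the unit mass at 0 attains it.\<close>

lemma k1_min:
  "\<exists>k \<in> k1_values d (e_vec d). (\<forall>r \<in> k1_values d (e_vec d). k \<le> r) \<and> k \<ge> 1"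
proof (rule bexI[of _ 1], intro conjI ballI)
  let ?u = "unit_vec (2 * d + 1) 0 :: real vec"
  have "linf_norm ?u = 1" unfolding linf_norm_def
    by (intro Max_eqI) auto
  moreover have "e_vec d \<bullet> ?u = 1"
  proof -
    have "e_vec d \<bullet> ?u = (\<Sum>i<d + 1. if i = 0 then 1 else 0)"
      unfolding e_vec_scalar_prod[OF unit_vec_carrier] by (intro sum.cong) auto
    then show ?thesis by simp
  qed
  ultimately show "1 \<in> k1_values d (e_vec d)"
    unfolding k1_values_def using unit_vec_0_sos_dual[of d] by (auto intro!: exI[of _ ?u])
  fix r assume "r \<in> k1_values d (e_vec d)"
  then obtain v where "r = e_vec d \<bullet> v" "v \<in> sos_dual d" "linf_norm v = 1" by (auto simp: k1_values_def)
  then show "1 \<le> r" using linf_norm_le_e_vec by force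
qed simp

section \<open>Steps of bounded local norm\<close>

text \<open>The Dikin ellipsoid: \<open>local_norm_bound\<close> dominates the form of
  \<open>hankel d r\<close> by that of \<open>hankel d y\<close>, with the local norm of
  \<open>r\<close> as factor.\<close>

lemma pd_perturb:
  assumes pd: "pd (d + 1) (hankel d y)" and y: "y \<in> coeff_space d" and r: "r \<in> coeff_space d"
  shows "local_form d y r r < 1 \<Longrightarrow> pd (d + 1) (hankel d (y + r))"
    and "local_form d y r r \<le> 1 \<Longrightarrow> psd (d + 1) (hankel d (y + r))"
proof -
  have form: "v \<bullet> (hankel d (y + r) *\<^sub>v v) = v \<bullet> (hankel d y *\<^sub>v v) + v \<bullet> (hankel d r *\<^sub>v v)" if "v \<in> carrier_vec (d + 1)" for v
    unfolding hankel_quadratic_form[OF that] sum.distrib[symmetric]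
    using y r by (intro sum.cong refl) (simp add: algebra_simps)
  have bound: "(v \<bullet> (hankel d r *\<^sub>v v))\<^sup>2 \<le> local_form d y r r * (v \<bullet> (hankel d y *\<^sub>v v))\<^sup>2" if "v \<in> carrier_vec (d + 1)" for v
    unfolding local_form_def by (rule local_norm_bound[OF pd hankel_carrier(1) hankel_sym that])
  have nn: "0 \<le> v \<bullet> (hankel d y *\<^sub>v v)" if "v \<in> carrier_vec (d + 1)" for v
    using pd_imp_psd[OF pd] that by (simp add: psd_def)
  show "pd (d + 1) (hankel d (y + r))" if lt: "local_form d y r r < 1"
    unfolding pd_def
  proof (intro conjI ballI impI hankel_carrier(1) hankel_sym)
    fix v :: "real vec" assume v: "v \<in> carrier_vec (d + 1)" "v \<noteq> 0\<^sub>v (d + 1)"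
    then have pos: "0 < v \<bullet> (hankel d y *\<^sub>v v)" using pd by (simp add: pd_def)
    have "(v \<bullet> (hankel d r *\<^sub>v v))\<^sup>2 < (v \<bullet> (hankel d y *\<^sub>v v))\<^sup>2"
    proof (rule le_less_trans[OF bound[OF v(1)]])
      have "local_form d y r r * (v \<bullet> (hankel d y *\<^sub>v v))\<^sup>2 < 1 * (v \<bullet> (hankel d y *\<^sub>v v))\<^sup>2"
        using lt pos by (intro mult_strict_right_mono) auto
      then show "local_form d y r r * (v \<bullet> (hankel d y *\<^sub>v v))\<^sup>2 < (v \<bullet> (hankel d y *\<^sub>v v))\<^sup>2" by simp
    qed
    then have "\<bar>v \<bullet> (hankel d r *\<^sub>v v)\<bar> < v \<bullet> (hankel d y *\<^sub>v v)" using abs_le_square_iff[of "v \<bullet> (hankel d y *\<^sub>v v)" "v \<bullet> (hankel d r *\<^sub>v v)"] pos by linarith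
    then show "0 < v \<bullet> (hankel d (y + r) *\<^sub>v v)" unfolding form[OF v(1)] by linarith
  qed
  show "psd (d + 1) (hankel d (y + r))" if le: "local_form d y r r \<le> 1"
    unfolding psd_def
  proof (intro conjI ballI impI hankel_carrier(1) hankel_sym)
    fix v :: "real vec" assume v: "v \<in> carrier_vec (d + 1)"
    have "(v \<bullet> (hankel d r *\<^sub>v v))\<^sup>2 \<le> 1 * (v \<bullet> (hankel d y *\<^sub>v v))\<^sup>2"
      by (rule order.trans[OF bound[OF v] mult_right_mono[OF le]]) simp
    then have "\<bar>v \<bullet> (hankel d r *\<^sub>v v)\<bar> \<le> v \<bullet> (hankel d y *\<^sub>v v)" using abs_le_square_iff[of "v \<bullet> (hankel d r *\<^sub>v v)" "v \<bullet> (hankel d y *\<^sub>v v)"] nn[OF v] by linarith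
    then show "0 \<le> v \<bullet> (hankel d (y + r) *\<^sub>v v)" unfolding form[OF v] by linarith
  qed
qed

lemma local_form_le_gradient:
  assumes pd: "pd (d + 1) (hankel d y)" and u: "u \<in> coeff_space d"
    and t: "t \<in> coeff_space d" "\<And>w. w \<in> coeff_space d \<Longrightarrow> t \<bullet> w = mtrace (minv (hankel d y) * hankel d w)"
  shows "local_form d y u u \<le> 3.21 ^ (2 * d + 1) / 2 * (t \<bullet> t) * (u \<bullet> u)"
proof -
  have pos: "0 < 2 * d + 1" by simp
  obtain Z :: "real set" and \<alpha> :: "real \<Rightarrow> real" where Z: "finite Z" "\<forall>z\<in>Z. \<alpha> z > 0"
    "(\<Sum>z\<in>Z. \<alpha> z * (\<Sum>k<2 * d + 1. z ^ (2 * k))) = 1"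
    "\<forall>v. (\<Sum>k<2 * d + 1. (v k)\<^sup>2) \<le> 3.21 ^ (2 * d + 1) / 2 * (\<Sum>z\<in>Z. \<alpha> z * (\<Sum>k<2 * d + 1. v k * z ^ k)\<^sup>2)"
    using discrete_norming_measure[of "2 * d + 1", OF pos] by (elim exE conjE) (rule that)
  show ?thesis
    by (rule local_form_le[OF pd u t(1) _ Z(1) _ Z(3)]) (erule t(2), erule Z(2)[rule_format], rule Z(4)[rule_format], simp)
qed

text \<open>An instance of \<open>local_form_le_gradient\<close> in which \<open>t\<close> is taken
  to be minus the gradient of the barrier at \<open>y\<close>.\<close>

lemma local_form_bounded:
  assumes pd: "pd (d + 1) (hankel d y)"
  obtains L where "L > 0" "\<And>u. u \<in> coeff_space d \<Longrightarrow> local_form d y u u \<le> L * (u \<bullet> u)"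
proof -
  define t where "t = vec (2 * d + 1) (\<lambda>k. mtrace (minv (hankel d y) * hankel d (unit_vec (2 * d + 1) k)))"
  have X: "minv (hankel d y) \<in> carrier_mat (d + 1) (d + 1)" by (rule minv_carrier[OF hankel_carrier(1)])
  have tc: "t \<in> coeff_space d" by (simp add: t_def)
  have t: "t \<bullet> w = mtrace (minv (hankel d y) * hankel d w)" if "w \<in> coeff_space d" for w
    unfolding mtrace_hankel_expand[OF X, of w] using that
    by (auto simp: t_def scalar_prod_def lessThan_atLeast0 mult.commute intro!: sum.cong)
  define L where "L = 3.21 ^ (2 * d + 1) / 2 * (t \<bullet> t)"
  have b: "local_form d y u u \<le> L * (u \<bullet> u)" if "u \<in> coeff_space d" for u
    unfolding L_def by (rule local_form_le_gradient[OF pd that tc t])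
  have "0 \<le> L" by (simp add: L_def scalar_prod_self_sum[OF tc] sum_nonneg)
  show thesis
  proof (rule that[of "L + 1"])
    fix u :: "real vec" assume u: "u \<in> coeff_space d"
    have "0 \<le> u \<bullet> u" by (simp add: scalar_prod_self_sum[OF u] sum_nonneg)
    then show "local_form d y u u \<le> (L + 1) * (u \<bullet> u)" using b[OF u] by (simp add: algebra_simps)
  qed (use \<open>0 \<le> L\<close> in simp)
qed

lemma pd_interior_sos_dual:
  assumes pd: "pd (d + 1) (hankel d y)" and y: "y \<in> coeff_space d"
  shows "y \<in> vec_top (2 * d + 1) interior_of sos_dual d"
proof -
  obtain L where L: "L > 0" "\<And>u. u \<in> coeff_space d \<Longrightarrow> local_form d y u u \<le> L * (u \<bullet> u)"
    using local_form_bounded[OF pd] by blast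
  have "z \<in> sos_dual d" if z: "z \<in> coeff_space d" "l2_norm (z - y) < 1 / sqrt L" for z
  proof -
    have u: "z - y \<in> coeff_space d" using z y by simp
    have "(l2_norm (z - y))\<^sup>2 \<le> (1 / sqrt L)\<^sup>2" using z(2) by (intro power_mono) auto
    then have "(z - y) \<bullet> (z - y) \<le> 1 / L" using L(1) by (simp add: l2_norm_sq power_divide)
    then have "local_form d y (z - y) (z - y) \<le> 1" using L(2)[OF u] L(1) by (simp add: field_simps)
    then have "psd (d + 1) (hankel d (y + (z - y)))" by (rule pd_perturb(2)[OF pd y u])
    moreover have "y + (z - y) = z" using y z by (intro eq_vecI) auto
    ultimately show ?thesis using sos_dual_iff_psd[OF z(1)] by simp
  qed
  then show ?thesis unfolding interior_of_vec_top using y L(1) by (intro conjI exI[of _ "1 / sqrt L"]) auto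
qed

text \<open>Let \<open>w\<close> be the inverse Hessian at \<open>y' = y + r\<close> applied to
  \<open>t\<close>. It suffices that \<open>w / c\<close> differs from \<open>y'\<close> by a vector
  \<open>V\<close> of local norm at most 1 at \<open>y'\<close>. The Hessian maps \<open>V\<close>
  to the difference of minus the gradients at \<open>y\<close> and at \<open>y'\<close>, so the
  squared norm of \<open>V\<close> is the change of gradient in
  \<open>local_norm_dual_bound\<close>.\<close>

lemma dual_certificate_near:
  assumes y: "y \<in> coeff_space d" and pd: "pd (d + 1) (hankel d y)"
    and r: "r \<in> coeff_space d" "local_form d y r r < 1"
    and t: "t \<in> sos_cone d" "0 < c"
      "\<And>u. u \<in> coeff_space d \<Longrightarrow> t \<bullet> u = c * mtrace (minv (hankel d y) * hankel d u)"
  shows "dual_certificate d (y + r) t"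
proof -
  define y' where "y' = y + r"
  have y': "y' \<in> coeff_space d" using y r by (simp add: y'_def)
  have pd': "pd (d + 1) (hankel d y')" unfolding y'_def by (rule pd_perturb(1)[OF pd y r])
  define H where "H = hessian d y'"
  have H: "H \<in> carrier_mat (2 * d + 1) (2 * d + 1)" by (simp add: H_def hessian_def)
  have tc: "t \<in> coeff_space d" using t(1) by (rule sos_cone_carrier)
  \<comment> \<open>A kernel vector of the Hessian has local norm 0, so its Hankel form vanishes and
    \<open>hankel_form_zero\<close> applies.\<close>
  have "det H \<noteq> 0"
  proof
    assume "det H = 0"
    then obtain v where v: "v \<in> coeff_space d" "v \<noteq> 0\<^sub>v (2 * d + 1)" "H *\<^sub>v v = 0\<^sub>v (2 * d + 1)"
      using det_0_iff_vec_prod_zero_field[OF H] by auto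
    have "local_form d y' v v = 0" using hessian_bilinear[OF y' pd' v(1) v(1)] v(1,3) by (simp add: H_def)
    then have "w \<bullet> (hankel d v *\<^sub>v w) = 0" if "w \<in> carrier_vec (d + 1)" for w
      using local_norm_bound[OF pd' hankel_carrier(1) hankel_sym that, of v] by (simp add: local_form_def)
    then show False using hankel_form_zero[OF v(1)] v(2) by blast
  qed
  then have "H \<in> Units (ring_mat TYPE(real) (2 * d + 1) ())" by (rule det_non_zero_imp_unit[OF H])
  then obtain B where B: "mat_inverse H = Some B" using mat_inverse(1)[OF H, of "()"] by (cases "mat_inverse H") auto
  have HB: "H * B = 1\<^sub>m (2 * d + 1)" "B \<in> carrier_mat (2 * d + 1) (2 * d + 1)" using mat_inverse(2)[OF H B] by auto
  define w where "w = B *\<^sub>v t"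
  have w: "w \<in> coeff_space d" using HB tc by (simp add: w_def)
  have Hw: "H *\<^sub>v w = t" unfolding w_def using HB H tc by (simp flip: assoc_mult_mat_vec[of _ "2 * d + 1" "2 * d + 1" _ "2 * d + 1"])
  define V where "V = (1 / c) \<cdot>\<^sub>v w - y'"
  have V: "V \<in> coeff_space d" using w y' by (simp add: V_def)
  have "V \<bullet> (H *\<^sub>v ((1 / c) \<cdot>\<^sub>v w)) = mtrace (minv (hankel d y) * hankel d V)"
    using t(2) t(3)[OF V] V tc Hw w H by (simp add: mult_mat_vec[OF H w] comm_scalar_prod[OF V tc])
  \<comment> \<open>Logarithmic homogeneity of the barrier: the Hessian maps its base point to minus
    the gradient.\<close>
  moreover have "V \<bullet> (H *\<^sub>v y') = mtrace (minv (hankel d y') * hankel d V)"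
  proof -
    have X: "minv (hankel d y') \<in> carrier_mat (d + 1) (d + 1)" by (rule minv_carrier[OF hankel_carrier(1)])
    have I: "minv (hankel d y') * hankel d y' = 1\<^sub>m (d + 1)" using minv(2)[OF hankel_carrier(1)] pd_det_pos[OF pd'] by auto
    have car: "A * C \<in> carrier_mat (d + 1) (d + 1)" if "A \<in> carrier_mat (d + 1) (d + 1)" "C \<in> carrier_mat (d + 1) (d + 1)" for A C :: "real mat"
      using that by (rule mult_carrier_mat)
    have "V \<bullet> (H *\<^sub>v y') = mtrace (minv (hankel d y') * hankel d V * (minv (hankel d y') * hankel d y'))"
      unfolding H_def hessian_bilinear[OF y' pd' V y'] local_form_def
      by (subst assoc_mult_mat[OF car[OF X hankel_carrier(1)] X hankel_carrier(1)]) (rule refl)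
    then show ?thesis unfolding I using right_mult_one_mat[OF car[OF X hankel_carrier(1)]] by simp
  qed
  moreover have "V \<bullet> (H *\<^sub>v V) = V \<bullet> (H *\<^sub>v ((1 / c) \<cdot>\<^sub>v w)) - V \<bullet> (H *\<^sub>v y')"
  proof -
    have "H *\<^sub>v V = H *\<^sub>v ((1 / c) \<cdot>\<^sub>v w) - H *\<^sub>v y'"
      unfolding V_def using H w y' by (intro mult_minus_distrib_mat_vec) auto
    then show ?thesis using V H w y' by (simp add: scalar_prod_minus_distrib[of _ "2 * d + 1"] mult_mat_vec_carrier[OF H])
  qed
  ultimately have lV: "local_form d y' V V = mtrace (minv (hankel d y) * hankel d V) - mtrace (minv (hankel d y') * hankel d V)"
    using hessian_bilinear[OF y' pd' V V] by (simp add: H_def)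
  have hr: "hankel d y' - hankel d y = hankel d r"
    using hankel_add[OF y r(1)] by (intro eq_matI) (auto simp: y'_def hankel_def)
  \<comment> \<open>The squared norm of \<open>V\<close> occurs on both sides, so it is at most that
    of \<open>r\<close> at \<open>y\<close>.\<close>
  have "2 * local_form d y' V V \<le> local_form d y r r + local_form d y' V V"
    using local_norm_dual_bound[OF pd pd' hankel_carrier(1) hankel_sym, of V] unfolding lV[symmetric] hr local_form_def[symmetric] .
  then have "local_form d y' V V \<le> 1" using r(2) by simp
  then have psd: "psd (d + 1) (hankel d (y' + V))" by (rule pd_perturb(2)[OF pd' y' V])
  have "y' + V = (1 / c) \<cdot>\<^sub>v w" unfolding V_def using y' w by (intro eq_vecI) auto
  then have in_dual: "(1 / c) \<cdot>\<^sub>v w \<in> sos_dual d" using psd sos_dual_iff_psd[of "(1 / c) \<cdot>\<^sub>v w" d] w by simp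
  have "0 \<le> x \<bullet> w" if x: "x \<in> sos_cone d" for x
  proof -
    have "0 \<le> x \<bullet> ((1 / c) \<cdot>\<^sub>v w)" using in_dual x by (simp add: sos_dual_def)
    also have "\<dots> = (x \<bullet> w) / c" using sos_cone_carrier[OF x] w by simp
    finally show ?thesis using t(2) by (simp add: zero_le_divide_iff)
  qed
  then have "B *\<^sub>v t \<in> sos_dual d" using w by (simp add: sos_dual_def w_def)
  then show ?thesis unfolding dual_certificate_def y'_def[symmetric]
    using t(1) pd_interior_sos_dual[OF pd' y'] B by (simp add: H_def)
qed

section \<open>Existence of certificates\<close>

lemma abs_scalar_prod_le:
  assumes "u \<in> carrier_vec n" "v \<in> carrier_vec n"
  shows "\<bar>u \<bullet> v\<bar> \<le> l2_norm u * l2_norm v"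
proof (rule power2_le_imp_le)
  have "(u \<bullet> v)\<^sup>2 = (\<Sum>i<n. u $ i * v $ i)\<^sup>2" using assms by (simp add: scalar_prod_def lessThan_atLeast0)
  also have "\<dots> \<le> (\<Sum>i<n. (u $ i)\<^sup>2) * (\<Sum>i<n. (v $ i)\<^sup>2)" by (rule Cauchy_Schwarz_ineq_sum)
  also have "\<dots> = (l2_norm u * l2_norm v)\<^sup>2"
    unfolding power_mult_distrib l2_norm_sq scalar_prod_self_sum[OF assms(1)] scalar_prod_self_sum[OF assms(2)] ..
  finally show "\<bar>u \<bullet> v\<bar>\<^sup>2 \<le> (l2_norm u * l2_norm v)\<^sup>2" by simp
qed simp

lemma frontier_sos_cone_scalar_prod:
  assumes x: "x \<in> vec_top (2 * d + 1) frontier_of sos_cone d" and y: "y \<in> sos_dual d"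
  shows "0 \<le> x \<bullet> y"
proof (rule ccontr)
  assume "\<not> 0 \<le> x \<bullet> y"
  then have neg: "x \<bullet> y < 0" by simp
  have yc: "y \<in> coeff_space d" using y by (rule sos_dual_carrier)
  \<comment> \<open>A cone point within this distance of \<open>x\<close> would still pair
    negatively with \<open>y\<close>; the \<open>+ 1\<close> keeps the denominator positive.\<close>
  define r where "r = - (x \<bullet> y) / (l2_norm y + 1)"
  have n1: "0 < l2_norm y + 1" using l2_norm_nonneg[of y] by linarith
  have "r > 0" unfolding r_def using neg n1 by (intro divide_pos_pos) auto
  from frontier_of_vec_top_approx[OF x this] obtain w
    where xc: "x \<in> coeff_space d" and w: "w \<in> sos_cone d" "w \<in> coeff_space d" "l2_norm (w - x) < r"
    by blast
  have "(w - x) \<bullet> y = w \<bullet> y - x \<bullet> y" using w(2) xc yc by (intro minus_scalar_prod_distrib)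
  moreover have "0 \<le> w \<bullet> y" using y w(1) by (simp add: sos_dual_def)
  ultimately have "- (x \<bullet> y) \<le> \<bar>(w - x) \<bullet> y\<bar>" by linarith
  also have "\<dots> \<le> l2_norm (w - x) * l2_norm y" using w(2) xc yc by (intro abs_scalar_prod_le) auto
  also have "\<dots> \<le> r * l2_norm y" using w(3) by (intro mult_right_mono) auto
  also have "\<dots> < r * (l2_norm y + 1)" using \<open>r > 0\<close> by simp
  also have "r * (l2_norm y + 1) = - (x \<bullet> y)"
    unfolding r_def using n1 by simp
  finally show False by simp
qed

text \<open>Moving from \<open>t\<close> against \<open>y\<close> by half the radius of a ball
  around \<open>t\<close> stays in the cone. The estimate makes the slices
  \<open>t \<bullet> y = m\<close> of the dual cone bounded.\<close>

lemma interior_sos_cone_lower_bound: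
  assumes t: "t \<in> vec_top (2 * d + 1) interior_of sos_cone d"
  obtains \<rho> where "\<rho> > 0" "\<And>y. y \<in> sos_dual d \<Longrightarrow> \<rho> * l2_norm y \<le> t \<bullet> y"
proof -
  from t obtain r where tc: "t \<in> coeff_space d" and r: "r > 0"
    "\<And>z. z \<in> coeff_space d \<Longrightarrow> l2_norm (z - t) < r \<Longrightarrow> z \<in> sos_cone d"
    unfolding interior_of_vec_top by blast
  have "r / 2 * l2_norm y \<le> t \<bullet> y" if y: "y \<in> sos_dual d" for y
  proof (cases "l2_norm y = 0")
    case True
    have "t \<in> sos_cone d" using r(2)[OF tc] r(1) tc by (simp add: l2_norm_def L2_set_def)
    then have "0 \<le> t \<bullet> y" using y by (simp add: sos_dual_def)
    then show ?thesis using True by simp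
  next
    case False
    then have pos: "l2_norm y > 0" using l2_norm_nonneg[of y] by linarith
    have yc: "y \<in> coeff_space d" using y by (rule sos_dual_carrier)
    define a where "a = - (r / (2 * l2_norm y))"
    define z where "z = t + a \<cdot>\<^sub>v y"
    have "z - t = a \<cdot>\<^sub>v y" unfolding z_def using tc yc by (intro eq_vecI) auto
    then have "l2_norm (z - t) = r / 2" using pos r(1) by (simp add: l2_norm_smult a_def)
    then have "z \<in> sos_cone d" using r tc yc by (simp add: z_def)
    then have "0 \<le> z \<bullet> y" using y by (simp add: sos_dual_def)
    also have "z \<bullet> y = t \<bullet> y + a * (l2_norm y)\<^sup>2"
      unfolding z_def l2_norm_sq using tc yc by (simp add: add_scalar_prod_distrib[of _ "2 * d + 1"])
    also have "a * (l2_norm y)\<^sup>2 = - (r / 2 * l2_norm y)" using pos by (simp add: a_def power2_eq_square)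
    finally show ?thesis by simp
  qed
  then show thesis using that[of "r / 2"] r(1) by simp
qed

text \<open>Compactness is taken from the product topology on functions; a vector of dimension
  \<open>n\<close> is encoded as a function pinned to 0 from index \<open>n\<close> on.\<close>

lemma compact_box:
  "compact (PiE UNIV (\<lambda>i::nat. if i < n then {- B..B} else {0}) :: (nat \<Rightarrow> real) set)"
proof -
  have "compactin (product_topology (\<lambda>i. euclidean) UNIV) (PiE UNIV (\<lambda>i::nat. if i < n then {- B..B::real} else {0}))"
    by (subst compactin_PiE) (auto simp: compactin_euclidean_iff)
  then show ?thesis by (simp add: euclidean_product_topology compactin_euclidean_iff)
qed

lemma continuous_on_eval [continuous_intros]: "continuous_on S (\<lambda>f :: nat \<Rightarrow> real. f i)"
  by (rule continuous_on_subset[OF continuous_on_product_coordinates]) auto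

lemma pd_hankel_smult:
  assumes "pd (d + 1) (hankel d y)" "y \<in> coeff_space d" "a > 0"
  shows "pd (d + 1) (hankel d (a \<cdot>\<^sub>v y))"
  unfolding pd_def
proof (intro conjI ballI impI hankel_carrier(1) hankel_sym)
  fix v :: "real vec" assume v: "v \<in> carrier_vec (d + 1)" "v \<noteq> 0\<^sub>v (d + 1)"
  have "v \<bullet> (hankel d (a \<cdot>\<^sub>v y) *\<^sub>v v) = a * (v \<bullet> (hankel d y *\<^sub>v v))"
    unfolding hankel_quadratic_form[OF v(1)] sum_distrib_left using assms(2)
    by (intro sum.cong refl) simp
  then show "0 < v \<bullet> (hankel d (a \<cdot>\<^sub>v y) *\<^sub>v v)" using assms v by (simp add: pd_def)
qed

text \<open>For the moments of the counting measure on the \<open>d + 1\<close> points 0 to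
  \<open>d\<close> the Hankel form is a sum of squared values of a polynomial of degree at most
  \<open>d\<close>, and these cannot all vanish unless the polynomial does.\<close>

lemma pd_hankel_exists: "\<exists>y\<in>coeff_space d. pd (d + 1) (hankel d y)"
proof
  define y where "y = vec (2 * d + 1) (\<lambda>k. \<Sum>l<d + 1. real l ^ k)"
  show "y \<in> coeff_space d" by (simp add: y_def)
  show "pd (d + 1) (hankel d y)"
    unfolding pd_def
  proof (intro conjI ballI impI hankel_carrier(1) hankel_sym)
    fix v :: "real vec" assume v: "v \<in> carrier_vec (d + 1)" "v \<noteq> 0\<^sub>v (d + 1)"
    define q where "q = (\<Sum>i<d + 1. monom (v $ i) i)"
    have pq: "poly q x = (\<Sum>i<d + 1. v $ i * x ^ i)" for x by (simp add: q_def poly_sum poly_monom)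
    note cq = poly_of_vec(1)[where v = v and d = d, folded q_def] and deg = poly_of_vec(2)[where v = v and d = d, folded q_def]
    have "v \<bullet> (hankel d y *\<^sub>v v) = (\<Sum>i<d + 1. \<Sum>j<d + 1. \<Sum>l<d + 1. (v $ i * real l ^ i) * (v $ j * real l ^ j))"
      unfolding hankel_quadratic_form[OF v(1)]
    proof (intro sum.cong refl)
      fix i j assume "i \<in> {..<d + 1}" "j \<in> {..<d + 1}"
      then have "y $ (i + j) = (\<Sum>l<d + 1. real l ^ i * real l ^ j)" by (simp add: y_def power_add)
      then show "v $ i * y $ (i + j) * v $ j = (\<Sum>l<d + 1. (v $ i * real l ^ i) * (v $ j * real l ^ j))"
        by (simp only: sum_distrib_left sum_distrib_right) (intro sum.cong refl, simp)
    qed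
    also have "\<dots> = (\<Sum>l<d + 1. \<Sum>i<d + 1. \<Sum>j<d + 1. (v $ i * real l ^ i) * (v $ j * real l ^ j))" by (rule sum_rotate[symmetric])
    also have "\<dots> = (\<Sum>l<d + 1. (poly q (real l))\<^sup>2)" by (simp only: pq power2_eq_square sum_product)
    also have "\<dots> > 0"
    proof -
      have "\<exists>l<d + 1. poly q (real l) \<noteq> 0"
      proof (rule ccontr)
        assume "\<not> ?thesis"
        then have "q = 0"
        proof (intro poly_eqI_degree[where A = "real ` {..<d + 1}"])
          have "card (real ` {..<d + 1}) = d + 1" by (subst card_image) auto
          then show "degree q < card (real ` {..<d + 1})" "degree 0 < card (real ` {..<d + 1})" using deg by auto
        qed auto
        then have "v = 0\<^sub>v (d + 1)" using cq v(1) by (intro eq_vecI) (auto simp flip: cq)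
        then show False using v(2) by simp
      qed
      then obtain l where "l < d + 1" "poly q (real l) \<noteq> 0" by blast
      then show ?thesis by (intro sum_pos2[of _ l]) auto
    qed
    finally show "0 < v \<bullet> (hankel d y *\<^sub>v v)" .
  qed
qed

text \<open>The maximiser of \<open>det \<circ> hankel d\<close> on the slice \<open>t \<bullet> y = d + 1\<close> of the dual cone is
  the point where minus the gradient of the barrier equals \<open>t\<close>.\<close>

lemma gradient_certificate_exists:
  assumes t: "t \<in> vec_top (2 * d + 1) interior_of sos_cone d"
  obtains y where "y \<in> coeff_space d" "pd (d + 1) (hankel d y)"
    "\<And>u. u \<in> coeff_space d \<Longrightarrow> t \<bullet> u = mtrace (minv (hankel d y) * hankel d u)"
proof -
  define n where "n = 2 * d + 1"
  \<comment> \<open>At the maximiser \<open>mtrace (X * hankel d y)\<close> is the trace of the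
    identity, which is \<open>d + 1\<close>; with this level of the slice the Lagrange multiplier is
    1.\<close>
  define m where "m = real (d + 1)"
  have m: "m > 0" by (simp add: m_def)
  have tc: "t \<in> carrier_vec n" using t by (auto simp: interior_of_vec_top n_def)
  obtain \<rho> where \<rho>: "\<rho> > 0" "\<And>y. y \<in> sos_dual d \<Longrightarrow> \<rho> * l2_norm y \<le> t \<bullet> y"
    using interior_sos_cone_lower_bound[OF t] by blast
  define B where "B = m / \<rho>"
  define box where "box = PiE UNIV (\<lambda>i::nat. if i < n then {- B..B} else {0})"
  define F where "F = {f \<in> box. psd (d + 1) (hankel d (vec n f)) \<and> t \<bullet> vec n f = m}"
  define G where "G f = det (hankel d (vec n f))" for f
  have rep: "\<exists>f\<in>F. vec n f = y" if y: "y \<in> carrier_vec n" "psd (d + 1) (hankel d y)" "t \<bullet> y = m" for y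
  proof
    define f where "f i = (if i < n then y $ i else 0)" for i
    show "vec n f = y" using y(1) by (intro eq_vecI) (auto simp: f_def)
    moreover have "f \<in> box"
    proof -
      have "y \<in> sos_dual d" using y sos_dual_iff_psd unfolding n_def by blast
      then have "l2_norm y \<le> B" using \<rho>(2)[of y] \<rho>(1) y(3) by (simp add: B_def field_simps)
      then have "\<bar>y $ i\<bar> \<le> B" if "i < n" for i
        using abs_index_le_l2_norm[of i y] y(1) that by simp
      then show ?thesis by (auto simp: box_def f_def abs_le_iff)  (metis neg_le_iff_le minus_le_iff)+
    qed
    ultimately show "f \<in> F" using y by (simp add: F_def)
  qed
  have "compact F"
  proof -
    have "closed {f. 0 \<le> v \<bullet> (hankel d (vec n f) *\<^sub>v v)}" if "v \<in> carrier_vec (d + 1)" for v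
    proof -
      have eq: "v \<bullet> (hankel d (vec n f) *\<^sub>v v) = (\<Sum>i<d + 1. \<Sum>j<d + 1. v $ i * f (i + j) * v $ j)" for f
        unfolding hankel_quadratic_form[OF that] by (intro sum.cong refl) (auto simp: n_def)
      show ?thesis unfolding eq by (intro closed_Collect_le continuous_intros)
    qed
    then have "closed (\<Inter>v\<in>carrier_vec (d + 1). {f. 0 \<le> v \<bullet> (hankel d (vec n f) *\<^sub>v v)})"
      by (intro closed_INT) auto
    moreover have "closed {f. t \<bullet> vec n f = m}"
    proof -
      have eq: "t \<bullet> vec n f = (\<Sum>i<n. t $ i * f i)" for f by (auto simp: scalar_prod_def lessThan_atLeast0)
      show ?thesis unfolding eq by (intro closed_Collect_eq continuous_intros)
    qed
    ultimately have "compact (box \<inter> ((\<Inter>v\<in>carrier_vec (d + 1). {f. 0 \<le> v \<bullet> (hankel d (vec n f) *\<^sub>v v)}) \<inter> {f. t \<bullet> vec n f = m}))"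
      unfolding box_def by (intro compact_Int_closed compact_box closed_Int)
    also have "box \<inter> ((\<Inter>v\<in>carrier_vec (d + 1). {f. 0 \<le> v \<bullet> (hankel d (vec n f) *\<^sub>v v)}) \<inter> {f. t \<bullet> vec n f = m}) = F"
      unfolding F_def psd_def using hankel_carrier(1) hankel_sym by blast
    finally show ?thesis .
  qed
  \<comment> \<open>One feasible point of positive determinant makes the maximiser definite and not
    just semidefinite.\<close>
  have feas: "\<exists>f\<in>F. G f > 0"
  proof -
    obtain y1 where y1: "y1 \<in> carrier_vec n" "pd (d + 1) (hankel d y1)" using pd_hankel_exists unfolding n_def by blast
    have dual: "y1 \<in> sos_dual d" using y1 pd_imp_psd sos_dual_iff_psd unfolding n_def by blast
    have "l2_norm y1 \<noteq> 0"
    proof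
      assume "l2_norm y1 = 0"
      then have "y1 $ 0 = 0" using abs_index_le_l2_norm[of 0 y1] y1(1) by (simp add: n_def)
      moreover define v :: "real vec" where "v = unit_vec (d + 1) 0 + 0 \<cdot>\<^sub>v unit_vec (d + 1) 0"
      ultimately have "v \<bullet> (hankel d y1 *\<^sub>v v) = 0"
        using hankel_form_units[of 0 d 0 v 0 y1] by simp
      moreover have "v \<in> carrier_vec (d + 1)" by (simp add: v_def)
      moreover have "v $ 0 = 1" by (simp add: v_def)
      then have "v \<noteq> 0\<^sub>v (d + 1)" by auto
      ultimately show False using y1(2) unfolding pd_def by (metis less_irrefl)
    qed
    then have "0 < \<rho> * l2_norm y1" using \<rho>(1) l2_norm_nonneg[of y1] by (intro mult_pos_pos) linarith+
    then have ty: "t \<bullet> y1 > 0" using \<rho>(2)[OF dual] by linarith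
    define a where "a = m / (t \<bullet> y1)"
    have a: "a > 0" using m ty by (simp add: a_def)
    define y where "y = a \<cdot>\<^sub>v y1"
    have yc: "y \<in> carrier_vec n" using y1 by (simp add: y_def)
    have ypd: "pd (d + 1) (hankel d y)"
      unfolding y_def using pd_hankel_smult[OF y1(2) _ a] y1(1) by (simp add: n_def)
    have "t \<bullet> y = m" using ty tc y1(1) by (simp add: y_def a_def)
    then obtain f where "f \<in> F" "vec n f = y" using rep[OF yc pd_imp_psd[OF ypd]] by blast
    then show ?thesis using pd_det_pos[OF ypd] by (auto simp: G_def)
  qed
  have "continuous_on F G" unfolding G_def
  proof (rule continuous_on_det[OF hankel_carrier(1)])
    fix i j assume "i < d + 1" "j < d + 1"
    then have "(\<lambda>f. hankel d (vec n f) $$ (i, j)) = (\<lambda>f. f (i + j))" by (auto simp: hankel_def n_def)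
    then show "continuous_on F (\<lambda>f. hankel d (vec n f) $$ (i, j))" by (simp only:) (intro continuous_intros)
  qed
  then obtain f where f: "f \<in> F" "\<And>g. g \<in> F \<Longrightarrow> G g \<le> G f"
    using continuous_attains_sup[OF \<open>compact F\<close>] feas by blast
  define y where "y = vec n f"
  have yc: "y \<in> carrier_vec n" by (simp add: y_def)
  have ty: "t \<bullet> y = m" and ypsd: "psd (d + 1) (hankel d y)" using f(1) by (auto simp: F_def y_def)
  have Gpos: "det (hankel d y) > 0" using feas f(2) by (force simp: G_def y_def)
  then have ypd: "pd (d + 1) (hankel d y)" using psd_det_imp_pd[OF ypsd] by simp
  define X where "X = minv (hankel d y)"
  have X: "X \<in> carrier_mat (d + 1) (d + 1)" unfolding X_def by (rule minv_carrier[OF hankel_carrier(1)])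
  have crit: "mtrace (X * hankel d u) = 0" if u: "u \<in> carrier_vec n" "t \<bullet> u = 0" for u
  proof -
    define l where "l = local_form d y u u"
    \<comment> \<open>For \<open>\<bar>s\<bar> < \<delta>\<close> the step
      \<open>s \<cdot>\<^sub>v u\<close> has local norm at most 1, so
      \<open>y + s \<cdot>\<^sub>v u\<close> stays in the dual cone and 0 is a local maximum of the
      determinant along \<open>u\<close>.\<close>
    define \<delta> where "\<delta> = 1 / (sqrt (\<bar>l\<bar> + 1) + 1)"
    have \<delta>: "\<delta> > 0" by (simp add: \<delta>_def add_nonneg_pos)
    have "det (hankel d y + s \<cdot>\<^sub>m hankel d u) \<le> det (hankel d y + 0 \<cdot>\<^sub>m hankel d u)" if s: "\<bar>0 - s\<bar> < \<delta>" for s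
    proof -
      have su: "s \<cdot>\<^sub>v u \<in> coeff_space d" using u by (simp add: n_def)
      have lf: "local_form d y (s \<cdot>\<^sub>v u) (s \<cdot>\<^sub>v u) = s\<^sup>2 * l"
      proof -
        have H: "hankel d (s \<cdot>\<^sub>v u) = s \<cdot>\<^sub>m hankel d u" using u by (intro hankel_smult) (simp add: n_def)
        define U where "U = hankel d u"
        have U: "U \<in> carrier_mat (d + 1) (d + 1)" unfolding U_def by (rule hankel_carrier(1))
        note XU = mult_carrier_mat[OF X U] and XUX = mult_carrier_mat[OF mult_carrier_mat[OF X U] X]
        have "X * (s \<cdot>\<^sub>m U) * X * (s \<cdot>\<^sub>m U) = s \<cdot>\<^sub>m (s \<cdot>\<^sub>m (X * U * X * U))"
          unfolding mult_smult_distrib[OF X U] mult_smult_assoc_mat[OF XU X]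
            mult_smult_assoc_mat[OF XUX smult_carrier_mat[OF U]] mult_smult_distrib[OF XUX U] ..
        moreover note mult_carrier_mat[OF XUX U]
        ultimately show ?thesis unfolding local_form_def l_def H X_def[symmetric] U_def[symmetric]
          by (simp only: mtrace_linear(3)[of _ "d + 1"] smult_carrier_mat power2_eq_square mult.assoc)
      qed
      have "s\<^sup>2 * l \<le> 1"
      proof -
        have sq: "sqrt (\<bar>l\<bar> + 1) > 0" by (simp add: add_nonneg_pos)
        have "\<bar>s\<bar> \<le> 1 / sqrt (\<bar>l\<bar> + 1)"
        proof -
          have "\<delta> \<le> 1 / sqrt (\<bar>l\<bar> + 1)" unfolding \<delta>_def by (intro divide_left_mono mult_pos_pos) (use sq in linarith)+
          then show ?thesis using s by linarith
        qed
        then have "\<bar>s\<bar>\<^sup>2 \<le> (1 / sqrt (\<bar>l\<bar> + 1))\<^sup>2" by (intro power_mono) auto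
        then have "s\<^sup>2 \<le> 1 / (\<bar>l\<bar> + 1)" by (simp add: power_divide)
        then have "s\<^sup>2 * (\<bar>l\<bar> + 1) \<le> 1" by (simp add: le_divide_eq)
        moreover have "s\<^sup>2 * l \<le> s\<^sup>2 * (\<bar>l\<bar> + 1)" by (intro mult_left_mono) auto
        ultimately show ?thesis by linarith
      qed
      then have psd': "psd (d + 1) (hankel d (y + s \<cdot>\<^sub>v u))"
        using pd_perturb(2)[OF ypd _ su] yc lf by (simp add: n_def)
      have "y + s \<cdot>\<^sub>v u \<in> carrier_vec n" using yc u by simp
      moreover have "t \<bullet> (y + s \<cdot>\<^sub>v u) = m" using tc yc u ty by (simp add: scalar_prod_add_distrib[of _ n])
      ultimately obtain g where "g \<in> F" "vec n g = y + s \<cdot>\<^sub>v u" using rep psd' by blast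
      then have "det (hankel d (y + s \<cdot>\<^sub>v u)) \<le> det (hankel d y)" using f(2)[of g] by (simp add: G_def y_def)
      moreover have "hankel d (y + s \<cdot>\<^sub>v u) = hankel d y + s \<cdot>\<^sub>m hankel d u"
        using yc u by (simp add: hankel_add hankel_smult n_def)
      moreover have "hankel d y + 0 \<cdot>\<^sub>m hankel d u = hankel d y" by (intro eq_matI) (auto simp: hankel_def)
      ultimately show ?thesis by simp
    qed
    then have "det (hankel d y) * mtrace (X * hankel d u) = 0"
      unfolding X_def using Gpos
      by (intro DERIV_local_max[OF det_line_derivative[OF hankel_carrier(1)[of d y] _ hankel_carrier(1)[of d u]] \<delta>]) auto
    then show ?thesis using Gpos by simp
  qed
  have Xy: "mtrace (X * hankel d y) = m"
    using minv(2)[OF hankel_carrier(1)[of d y]] Gpos by (simp add: X_def mtrace_def m_def)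
  have "t \<bullet> u = mtrace (X * hankel d u)" if u: "u \<in> carrier_vec n" for u
  proof -
    \<comment> \<open>Makes \<open>u + a \<cdot>\<^sub>v y\<close> tangent to the slice, so that
      \<open>crit\<close> applies to it.\<close>
    define a where "a = - ((t \<bullet> u) / m)"
    have "t \<bullet> (u + a \<cdot>\<^sub>v y) = 0" using tc u yc ty m by (simp add: scalar_prod_add_distrib[of _ n] a_def)
    moreover have "u + a \<cdot>\<^sub>v y \<in> carrier_vec n" using u yc by simp
    ultimately have "mtrace (X * hankel d (u + a \<cdot>\<^sub>v y)) = 0" using crit by blast
    also have "hankel d (u + a \<cdot>\<^sub>v y) = hankel d u + a \<cdot>\<^sub>m hankel d y"
      using u yc by (simp add: hankel_add hankel_smult n_def)
    also have "mtrace (X * (hankel d u + a \<cdot>\<^sub>m hankel d y)) = mtrace (X * hankel d u) + a * m"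
    proof -
      have c: "X * hankel d u \<in> carrier_mat (d + 1) (d + 1)" "X * hankel d y \<in> carrier_mat (d + 1) (d + 1)"
        using X hankel_carrier(1) by (auto intro!: mult_carrier_mat simp del: One_nat_def)
      have "X * (hankel d u + a \<cdot>\<^sub>m hankel d y) = X * hankel d u + a \<cdot>\<^sub>m (X * hankel d y)"
        using mult_add_distrib_mat[OF X hankel_carrier(1)[of d u] smult_carrier_mat[OF hankel_carrier(1)[of d y]], of a]
          mult_smult_distrib[OF X hankel_carrier(1)[of d y], of a] by simp
      then show ?thesis using c mtrace_linear(1)[OF c(1) smult_carrier_mat[OF c(2)], of a] mtrace_linear(3)[OF c(2,2), of a] Xy by simp
    qed
    finally show ?thesis using m by (simp add: a_def)
  qed
  then show thesis using that[of y] yc ypd by (simp add: n_def X_def)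
qed

section \<open>Bounds\<close>

text \<open>\<open>cond_number\<close> takes \<open>Max\<close> and \<open>Min\<close> over the real
  eigenvalues, so this set must be nonempty. A complex eigenvalue is real because the hermitian form
  of \<open>M\<close> is, and the real or the imaginary part of its eigenvector is a real
  eigenvector.\<close>

lemma symmetric_mat_has_eigenvalue:
  fixes M :: "real mat"
  assumes M: "M \<in> carrier_mat n n" "M\<^sup>T = M" and n: "n > 0"
  shows "\<exists>l. eigenvalue M l"
proof -
  define A where "A = map_mat complex_of_real M"
  have A: "A \<in> carrier_mat n n" using M by (simp add: A_def)
  have "degree (char_poly A) = n" using degree_monic_char_poly[OF A] by simp
  then have "\<not> constant (poly (char_poly A))" using n by (simp add: constant_degree)
  then obtain \<mu> where "poly (char_poly A) \<mu> = 0" using fundamental_theorem_of_algebra by blast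
  then have "eigenvalue A \<mu>" using eigenvalue_root_char_poly[OF A] by blast
  then obtain v where v: "v \<in> carrier_vec n" "v \<noteq> 0\<^sub>v n" "A *\<^sub>v v = \<mu> \<cdot>\<^sub>v v"
    using A unfolding eigenvalue_def eigenvector_def by auto
  have sym: "M $$ (i, j) = M $$ (j, i)" if "i < n" "j < n" for i j
    using M that by (metis carrier_matD index_transpose_mat(1))
  have row: "(\<Sum>j<n. of_real (M $$ (i, j)) * v $ j) = \<mu> * v $ i" if "i < n" for i
  proof -
    have "(A *\<^sub>v v) $ i = (\<Sum>j<n. of_real (M $$ (i, j)) * v $ j)"
      using that A M v(1) by (auto simp: A_def scalar_prod_def lessThan_atLeast0 intro!: sum.cong)
    then show ?thesis using v(1,3) that by simp
  qed
  define S where "S = (\<Sum>i<n. \<Sum>j<n. cnj (v $ i) * of_real (M $$ (i, j)) * v $ j)"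
  have S1: "S = \<mu> * of_real (\<Sum>i<n. (cmod (v $ i))\<^sup>2)"
  proof -
    have "S = (\<Sum>i<n. cnj (v $ i) * (\<mu> * v $ i))"
      unfolding S_def row[symmetric, OF lessThan_iff[THEN iffD1]]
      by (intro sum.cong refl) (simp add: row[symmetric] sum_distrib_left mult.assoc)
    also have "\<dots> = (\<Sum>i<n. \<mu> * of_real ((cmod (v $ i))\<^sup>2))"
      by (intro sum.cong refl) (simp only: complex_norm_square mult_ac)
    finally show ?thesis by (simp only: of_real_sum sum_distrib_left)
  qed
  have "cnj S = (\<Sum>i<n. \<Sum>j<n. v $ i * of_real (M $$ (i, j)) * cnj (v $ j))" by (simp add: S_def)
  also have "\<dots> = (\<Sum>j<n. \<Sum>i<n. v $ i * of_real (M $$ (i, j)) * cnj (v $ j))" by (rule sum.swap)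
  also have "\<dots> = S" unfolding S_def by (intro sum.cong refl) (use sym in \<open>auto simp: mult_ac\<close>)
  finally have "Im S = 0" by (metis complex_cnj_cancel_iff Reals_cnj_iff complex_is_Real_iff)
  obtain k where k: "k < n" "v $ k \<noteq> 0" using v(1,2) by (metis carrier_vecD eq_vecI index_zero_vec)
  then have "0 < (\<Sum>i<n. (cmod (v $ i))\<^sup>2)" by (intro sum_pos2[of _ k]) auto
  then have im: "Im \<mu> = 0" using \<open>Im S = 0\<close> unfolding S1 by simp
  have eig: "eigenvalue M (Re \<mu>)" if g: "\<And>i. i < n \<Longrightarrow> (\<Sum>j<n. M $$ (i, j) * g j) = Re \<mu> * g i" and nz: "g k \<noteq> 0" for g
  proof -
    have "M *\<^sub>v vec n g = Re \<mu> \<cdot>\<^sub>v vec n g"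
      using M g by (intro eq_vecI) (auto simp: scalar_prod_def lessThan_atLeast0)
    moreover have "vec n g \<noteq> 0\<^sub>v n" using nz k(1) by (metis index_vec index_zero_vec(1))
    ultimately show ?thesis using M unfolding eigenvalue_def eigenvector_def
      by (auto intro!: exI[of _ "vec n g"])
  qed
  have re: "(\<Sum>j<n. M $$ (i, j) * Re (v $ j)) = Re \<mu> * Re (v $ i)" if "i < n" for i
    using arg_cong[OF row[OF that], of Re] im by simp
  have im': "(\<Sum>j<n. M $$ (i, j) * Im (v $ j)) = Re \<mu> * Im (v $ i)" if "i < n" for i
    using arg_cong[OF row[OF that], of Im] im by simp
  show ?thesis
    using eig[OF re] eig[OF im'] k(2) by (cases "Re (v $ k) = 0") (auto simp: complex_eq_iff)
qed

lemma finite_eigenvalues: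
  fixes M :: "real mat"
  assumes "M \<in> carrier_mat n n"
  shows "finite {l. eigenvalue M l}"
proof -
  have "{l. eigenvalue M l} = {l. poly (char_poly M) l = 0}" using eigenvalue_root_char_poly[OF assms] by simp
  moreover have "char_poly M \<noteq> 0" using degree_monic_char_poly[OF assms] by auto
  ultimately show ?thesis using poly_roots_finite by simp
qed

text \<open>All eigenvalues lie between \<open>1 / c\<close> and 1: the lower bound is the norming
  inequality, the upper one Cauchy-Schwarz with the normalisation. Unisolvence is the count
  \<open>2 * d + 1 \<le> card Z\<close>.\<close>

lemma well_conditioned_moment_mat:
  "\<exists>(s::nat) (z :: nat \<Rightarrow> real) (\<alpha> :: nat \<Rightarrow> real).
     inj_on z {1..s} \<and> unisolvent (2 * d) (z ` {1..s}) \<and> (\<forall>i \<in> {1..s}. \<alpha> i > 0) \<and>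
     cond_number (moment_mat d s z \<alpha>) \<le> 3.21 ^ (2 * d + 1) / 2"
proof -
  define n where "n = 2 * d + 1"
  define c :: real where "c = 3.21 ^ n / 2"
  have c: "c > 0" by (simp add: c_def)
  have n: "n > 0" by (simp add: n_def)
  obtain Z :: "real set" and a :: "real \<Rightarrow> real" where Z: "finite Z" "n \<le> card Z" "\<forall>z\<in>Z. a z > 0"
    "(\<Sum>z\<in>Z. a z * (\<Sum>k<n. z ^ (2 * k))) = 1"
    "\<forall>v. (\<Sum>k<n. (v k)\<^sup>2) \<le> c * (\<Sum>z\<in>Z. a z * (\<Sum>k<n. v k * z ^ k)\<^sup>2)"
    using discrete_norming_measure[OF n, folded c_def] by (elim exE conjE) (rule that)
  obtain h where h: "bij_betw h {1..card Z} Z" using ex_bij_betw_nat_finite_1[OF Z(1)] by blast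
  define M where "M = moment_mat d (card Z) h (a \<circ> h)"
  have M: "M \<in> carrier_mat n n" by (simp add: M_def moment_mat_def n_def)
  have entry: "M $$ (i, j) = (\<Sum>z\<in>Z. a z * (z ^ i * z ^ j))" if "i < n" "j < n" for i j
  proof -
    have "M $$ (i, j) = (\<Sum>k = 1..card Z. (a \<circ> h) k * (h k ^ i * h k ^ j))"
      using that by (simp add: M_def moment_mat_def n_def outer_prod_def monomials_def)
    also have "\<dots> = (\<Sum>z\<in>Z. a z * (z ^ i * z ^ j))"
      using sum.reindex_bij_betw[OF h, of "\<lambda>z. a z * (z ^ i * z ^ j)"] by simp
    finally show ?thesis .
  qed
  have sym: "M\<^sup>T = M" using M entry by (intro eq_matI) (auto simp: mult.commute)
  have form: "v \<bullet> (M *\<^sub>v v) = (\<Sum>z\<in>Z. a z * (\<Sum>k<n. v $ k * z ^ k)\<^sup>2)" if v: "v \<in> carrier_vec n" for v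
  proof -
    have "v \<bullet> (M *\<^sub>v v) = (\<Sum>i<n. \<Sum>j<n. \<Sum>z\<in>Z. a z * ((v $ i * z ^ i) * (v $ j * z ^ j)))"
      unfolding quadratic_form_sum[OF M v v] using entry
      by (intro sum.cong refl) (simp add: sum_distrib_left sum_distrib_right mult_ac)
    also have "\<dots> = (\<Sum>z\<in>Z. \<Sum>i<n. \<Sum>j<n. a z * ((v $ i * z ^ i) * (v $ j * z ^ j)))" by (rule sum_rotate[symmetric])
    finally have "v \<bullet> (M *\<^sub>v v) = \<dots>" .
    moreover have "(\<Sum>k<n. v $ k * z ^ k)\<^sup>2 = (\<Sum>i<n. \<Sum>j<n. (v $ i * z ^ i) * (v $ j * z ^ j))" for z
      by (simp only: power2_eq_square sum_product)
    ultimately show ?thesis by (simp only: sum_distrib_left)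
  qed
  have eig: "1 / c \<le> l \<and> l \<le> 1" if ev: "eigenvalue M l" for l
  proof -
    obtain v where v: "v \<in> carrier_vec n" "v \<noteq> 0\<^sub>v n" "M *\<^sub>v v = l \<cdot>\<^sub>v v"
      using ev M unfolding eigenvalue_def eigenvector_def by auto
    have pos: "0 < v \<bullet> v" using v by (intro scalar_prod_self_pos)
    have lv: "l * (v \<bullet> v) = (\<Sum>z\<in>Z. a z * (\<Sum>k<n. v $ k * z ^ k)\<^sup>2)"
      using form[OF v(1)] v by simp
    have "v \<bullet> v \<le> c * (\<Sum>z\<in>Z. a z * (\<Sum>k<n. v $ k * z ^ k)\<^sup>2)"
      unfolding scalar_prod_self_sum[OF v(1)] using Z(5) by blast
    then have "v \<bullet> v \<le> c * (l * (v \<bullet> v))" by (simp only: lv)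
    then have "1 * (v \<bullet> v) \<le> (c * l) * (v \<bullet> v)" by simp
    then have "1 \<le> c * l" using pos by (simp only: mult_le_cancel_right_pos)
    then have 1: "1 / c \<le> l" using c by (simp add: divide_le_eq mult.commute)
    have "l * (v \<bullet> v) \<le> (\<Sum>z\<in>Z. a z * ((v \<bullet> v) * (\<Sum>k<n. z ^ (2 * k))))"
      unfolding lv
    proof (intro sum_mono mult_left_mono)
      fix z assume "z \<in> Z"
      then show "0 \<le> a z" using Z(3) by (auto intro: less_imp_le)
      have "(\<Sum>k<n. v $ k * z ^ k)\<^sup>2 \<le> (\<Sum>k<n. (v $ k)\<^sup>2) * (\<Sum>k<n. (z ^ k)\<^sup>2)" by (rule Cauchy_Schwarz_ineq_sum)
      also have "(\<Sum>k<n. (z ^ k)\<^sup>2) = (\<Sum>k<n. z ^ (2 * k))" by (intro sum.cong refl) (simp add: mult.commute flip: power_mult)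
      finally show "(\<Sum>k<n. v $ k * z ^ k)\<^sup>2 \<le> (v \<bullet> v) * (\<Sum>k<n. z ^ (2 * k))" by (simp only: scalar_prod_self_sum[OF v(1)])
    qed
    also have "\<dots> = (\<Sum>z\<in>Z. (v \<bullet> v) * (a z * (\<Sum>k<n. z ^ (2 * k))))"
      by (intro sum.cong refl) (simp only: mult.left_commute)
    also have "\<dots> = (v \<bullet> v) * (\<Sum>z\<in>Z. a z * (\<Sum>k<n. z ^ (2 * k)))" by (rule sum_distrib_left[symmetric])
    also have "\<dots> = 1 * (v \<bullet> v)" unfolding Z(4) by simp
    finally have "l \<le> 1" using pos by (simp only: mult_le_cancel_right_pos)
    with 1 show ?thesis by simp
  qed
  define E where "E = {l. eigenvalue M l}"
  have E: "finite E" "E \<noteq> {}" using finite_eigenvalues[OF M] symmetric_mat_has_eigenvalue[OF M sym n] by (auto simp: E_def)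
  have "Max E \<le> 1" "1 / c \<le> Min E" using E eig by (auto simp: E_def)
  then have "Max E / Min E \<le> 1 / (1 / c)" using c by (intro frac_le) auto
  then have "cond_number M \<le> c" by (simp add: cond_number_def E_def)
  moreover have "inj_on h {1..card Z}" "h ` {1..card Z} = Z" using h by (auto simp: bij_betw_def)
  moreover have "unisolvent (2 * d) Z"
    unfolding unisolvent_def
  proof (intro allI impI)
    fix p r :: "real poly" assume "degree p \<le> 2 * d \<and> degree r \<le> 2 * d \<and> (\<forall>z\<in>Z. poly p z = poly r z)"
    then show "p = r" using Z(2) by (intro poly_eqI_degree[where A = Z]) (auto simp: n_def)
  qed
  moreover have "\<forall>i\<in>{1..card Z}. (a \<circ> h) i > 0" using Z(3) h by (auto simp: bij_betw_def)
  ultimately show ?thesis unfolding M_def c_def n_def by (intro exI[of _ "card Z"] exI[of _ h] exI[of _ "a \<circ> h"]) simp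
qed

section \<open>Rounding to an integer certificate\<close>

lemma minv_smult:
  assumes P: "P \<in> carrier_mat m m" "det P \<noteq> 0" and k: "k \<noteq> 0"
  shows "minv (k \<cdot>\<^sub>m P) = (1 / k) \<cdot>\<^sub>m minv P"
proof -
  have kP: "k \<cdot>\<^sub>m P \<in> carrier_mat m m" "det (k \<cdot>\<^sub>m P) \<noteq> 0" using P k by (simp_all add: det_smult)
  have X: "minv P \<in> carrier_mat m m" "minv (k \<cdot>\<^sub>m P) \<in> carrier_mat m m" using P(1) kP(1) by auto
  have "minv (k \<cdot>\<^sub>m P) = minv (k \<cdot>\<^sub>m P) * (P * minv P)" using minv(1)[OF P] X by simp
  also have "\<dots> = (minv (k \<cdot>\<^sub>m P) * P) * minv P" by (rule assoc_mult_mat[OF X(2) P(1) X(1), symmetric])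
  also have "minv (k \<cdot>\<^sub>m P) * P = (1 / k) \<cdot>\<^sub>m (minv (k \<cdot>\<^sub>m P) * (k \<cdot>\<^sub>m P))"
    using X P(1) k by (simp add: mult_smult_distrib[of _ m m _ m]) (intro eq_matI, auto)
  also have "\<dots> = (1 / k) \<cdot>\<^sub>m 1\<^sub>m m" using minv(2)[OF kP] by simp
  also have "(1 / k) \<cdot>\<^sub>m 1\<^sub>m m * minv P = (1 / k) \<cdot>\<^sub>m minv P" using X by (simp add: mult_smult_assoc_mat[of _ m m _ m])
  finally show ?thesis .
qed

text \<open>The first conclusion is recorded for the logarithmic estimate, where it makes
  \<open>l2_norm t / \<epsilon>\<close> at least 1.\<close>

lemma integer_certificate:
  assumes d: "d \<ge> 1" and t: "t \<in> vec_top (2 * d + 1) interior_of sos_cone d" and \<epsilon>: "\<epsilon> > 0"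
    and fr: "t - \<epsilon> \<cdot>\<^sub>v e_vec d \<in> vec_top (2 * d + 1) frontier_of sos_cone d"
  shows "\<epsilon> \<le> l2_norm t"
    and "\<exists>y. y \<in> vec_top (2 * d + 1) interior_of sos_dual d \<and> integer_vec y \<and> dual_certificate d y t \<and>
      linf_norm y \<le> 1 / 2 + 4 * real d powr (3 / 2) * 3.21 powr (real d + 1 / 2) * (l2_norm t / \<epsilon>)"
proof -
  define n where "n = 2 * d + 1"
  obtain y where yc: "y \<in> coeff_space d" and pd: "pd (d + 1) (hankel d y)"
    and grad: "\<And>u. u \<in> coeff_space d \<Longrightarrow> t \<bullet> u = mtrace (minv (hankel d y) * hankel d u)"
    using gradient_certificate_exists[OF t] by blast
  have tc: "t \<in> coeff_space d" and "\<exists>r>0. \<forall>z\<in>coeff_space d. l2_norm (z - t) < r \<longrightarrow> z \<in> sos_cone d"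
    using t unfolding interior_of_vec_top by blast+
  moreover have "l2_norm (t - t) = 0" by (simp add: l2_norm_def L2_set_def)
  ultimately have ts: "t \<in> sos_cone d" by auto
  have slack: "\<epsilon> * (e_vec d \<bullet> u) \<le> t \<bullet> u" if u: "u \<in> sos_dual d" for u
  proof -
    have uc: "u \<in> coeff_space d" using u by (rule sos_dual_carrier)
    have "0 \<le> (t - \<epsilon> \<cdot>\<^sub>v e_vec d) \<bullet> u" by (rule frontier_sos_cone_scalar_prod[OF fr u])
    also have "\<dots> = t \<bullet> u - \<epsilon> * (e_vec d \<bullet> u)"
      using tc uc e_vec_carrier[of d] by (subst minus_scalar_prod_distrib[of _ "2 * d + 1"]) auto
    finally show ?thesis by simp
  qed
  show T: "\<epsilon> \<le> l2_norm t"
  proof -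
    let ?u = "unit_vec (2 * d + 1) 0 :: real vec"
    have u: "?u \<in> sos_dual d" by (rule unit_vec_0_sos_dual)
    have "e_vec d \<bullet> ?u = (\<Sum>i<d + 1. if i = 0 then 1 else 0)"
      unfolding e_vec_scalar_prod[OF unit_vec_carrier] by (intro sum.cong) auto
    then have "e_vec d \<bullet> ?u = 1" by simp
    moreover have "t \<bullet> ?u = t $ 0" using tc by (intro scalar_prod_right_unit) auto
    ultimately have "\<epsilon> \<le> t $ 0" using slack[OF u] by simp
    also have "\<dots> \<le> l2_norm t" using abs_index_le_l2_norm[of 0 t] tc by simp
    finally show ?thesis .
  qed
  have ydual: "y \<in> sos_dual d" using pd_imp_psd[OF pd] sos_dual_iff_psd[OF yc] by blast
  have ty: "t \<bullet> y = real (d + 1)"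
    unfolding grad[OF yc] using minv(2)[OF hankel_carrier(1)[of d y]] pd_det_pos[OF pd] by (simp add: mtrace_def)
  \<comment> \<open>Here the boundary condition fixes the size of \<open>y\<close>:
    \<open>\<epsilon> * (e_vec d \<bullet> y) \<le> t \<bullet> y = d + 1\<close>, and
    \<open>e_vec d \<bullet> y\<close> dominates every coordinate.\<close>
  have ybound: "\<bar>y $ k\<bar> \<le> real (d + 1) / \<epsilon>" if "k < 2 * d + 1" for k
  proof -
    have "\<bar>y $ k\<bar> \<le> e_vec d \<bullet> y" using sos_dual_index_bound[OF ydual that] by (simp add: e_vec_scalar_prod[OF yc])
    also have "\<dots> \<le> real (d + 1) / \<epsilon>" using slack[OF ydual] ty \<epsilon> by (simp add: le_divide_eq mult.commute)
    finally show ?thesis .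
  qed
  define g :: real where "g = 3.21 powr (real d + 1 / 2)"
  have g2: "g\<^sup>2 = 3.21 ^ (2 * d + 1)"
  proof -
    have e: "real d + 1 / 2 + (real d + 1 / 2) = real (2 * d + 1)" by simp
    show ?thesis unfolding g_def power2_eq_square powr_add[symmetric] e by (rule powr_realpow) simp
  qed
  \<comment> \<open>Rounding moves each coordinate by at most 1/2, so the error has squared norm at
    most \<open>(2 * d + 1) / 4\<close> and squared local norm at \<open>y\<close> at most
    \<open>\<kappa>\<^sup>2 / 4\<close>. Passing to the multiple \<open>\<kappa>\<close> of
    \<open>y\<close> divides this by \<open>\<kappa>\<^sup>2\<close> and leaves 1/4.\<close>
  define \<kappa> where "\<kappa> = sqrt ((2 * real d + 1) / 2) * g * l2_norm t"
  have \<kappa>: "\<kappa> > 0" using T \<epsilon> by (simp add: \<kappa>_def g_def)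
  have \<kappa>2: "\<kappa>\<^sup>2 = (2 * real d + 1) / 2 * 3.21 ^ (2 * d + 1) * (t \<bullet> t)"
    unfolding \<kappa>_def power_mult_distrib g2 l2_norm_sq by simp
  define y0 where "y0 = \<kappa> \<cdot>\<^sub>v y"
  have y0c: "y0 \<in> coeff_space d" using yc by (simp add: y0_def)
  have Hy0: "hankel d y0 = \<kappa> \<cdot>\<^sub>m hankel d y" unfolding y0_def by (rule hankel_smult[OF yc])
  have X0: "minv (hankel d y0) = (1 / \<kappa>) \<cdot>\<^sub>m minv (hankel d y)"
    unfolding Hy0 using pd_det_pos[OF pd] \<kappa> by (intro minv_smult[OF hankel_carrier(1)]) auto
  have pd0: "pd (d + 1) (hankel d y0)" unfolding y0_def by (rule pd_hankel_smult[OF pd yc \<kappa>])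
  define yb where "yb = vec (2 * d + 1) (\<lambda>k. of_int (round (\<kappa> * y $ k)) :: real)"
  define r where "r = yb - y0"
  have ybc: "yb \<in> coeff_space d" by (simp add: yb_def)
  have rc: "r \<in> coeff_space d" unfolding r_def using ybc y0c by (rule minus_carrier_vec)
  have rk: "\<bar>r $ k\<bar> \<le> 1 / 2" if "k < 2 * d + 1" for k
    using that yc of_int_round_abs_le[of "\<kappa> * y $ k"] by (simp add: r_def yb_def y0_def)
  have rr: "r \<bullet> r \<le> (2 * real d + 1) / 4"
  proof -
    have "(\<Sum>k<2 * d + 1. (r $ k)\<^sup>2) \<le> (\<Sum>k<2 * d + 1. 1 / 4)"
    proof (rule sum_mono)
      fix k assume "k \<in> {..<2 * d + 1}"
      then have "\<bar>r $ k\<bar>\<^sup>2 \<le> (1 / 2)\<^sup>2" using rk by (intro power_mono) auto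
      then show "(r $ k)\<^sup>2 \<le> 1 / 4" by (simp add: power2_eq_square)
    qed
    then show ?thesis unfolding scalar_prod_self_sum[OF rc] by simp
  qed
  have lf: "local_form d y0 r r < 1"
  proof -
    have "local_form d y r r \<le> 3.21 ^ (2 * d + 1) / 2 * (t \<bullet> t) * (r \<bullet> r)"
      by (rule local_form_le_gradient[OF pd rc tc grad])
    also have "\<dots> \<le> 3.21 ^ (2 * d + 1) / 2 * (t \<bullet> t) * ((2 * real d + 1) / 4)"
      using rr by (intro mult_left_mono) (auto simp flip: l2_norm_sq)
    also have "\<dots> = \<kappa>\<^sup>2 / 4" unfolding \<kappa>2 by simp
    finally have le: "local_form d y r r \<le> \<kappa>\<^sup>2 / 4" .
    have "local_form d y0 r r = local_form d y r r / \<kappa>\<^sup>2"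
    proof -
      define X U where "X = minv (hankel d y)" and "U = hankel d r"
      have X: "X \<in> carrier_mat (d + 1) (d + 1)" unfolding X_def by (rule minv_carrier[OF hankel_carrier(1)])
      have U: "U \<in> carrier_mat (d + 1) (d + 1)" unfolding U_def by (rule hankel_carrier(1))
      note XU = mult_carrier_mat[OF X U] and XUX = mult_carrier_mat[OF mult_carrier_mat[OF X U] X]
      have "(1 / \<kappa>) \<cdot>\<^sub>m X * U * ((1 / \<kappa>) \<cdot>\<^sub>m X) * U = (1 / \<kappa>) \<cdot>\<^sub>m ((1 / \<kappa>) \<cdot>\<^sub>m (X * U * X * U))"
        unfolding mult_smult_assoc_mat[OF X U] mult_smult_assoc_mat[OF XU smult_carrier_mat[OF X]] mult_smult_distrib[OF XU X]
          mult_smult_assoc_mat[OF smult_carrier_mat[OF XUX] U] mult_smult_assoc_mat[OF XUX U] ..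
      then have "mtrace ((1 / \<kappa>) \<cdot>\<^sub>m X * U * ((1 / \<kappa>) \<cdot>\<^sub>m X) * U) = (1 / \<kappa>) * ((1 / \<kappa>) * mtrace (X * U * X * U))"
        using mult_carrier_mat[OF XUX U] by (simp only: mtrace_linear(3)[of _ "d + 1"] smult_carrier_mat)
      then show ?thesis unfolding local_form_def X0 X_def[symmetric] U_def[symmetric] by (simp add: power2_eq_square)
    qed
    also have "\<dots> \<le> 1 / 4" using le \<kappa> by (simp add: divide_le_eq)
    finally show ?thesis by simp
  qed
  have yb: "yb = y0 + r" unfolding r_def using ybc y0c by (intro eq_vecI) auto
  have cert: "dual_certificate d yb t"
    unfolding yb
  proof (rule dual_certificate_near[OF y0c pd0 rc lf ts \<kappa>])
    fix u :: "real vec" assume u: "u \<in> coeff_space d"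
    have X: "minv (hankel d y) \<in> carrier_mat (d + 1) (d + 1)" by (rule minv_carrier[OF hankel_carrier(1)])
    show "t \<bullet> u = \<kappa> * mtrace (minv (hankel d y0) * hankel d u)"
      unfolding X0 grad[OF u] mult_smult_assoc_mat[OF X hankel_carrier(1)]
      using mtrace_linear(3)[OF mult_carrier_mat[OF X hankel_carrier(1)] mult_carrier_mat[OF X hankel_carrier(1)], of "1 / \<kappa>" u] \<kappa> by simp
  qed
  have "linf_norm yb \<le> 1 / 2 + \<kappa> * (real (d + 1) / \<epsilon>)"
    unfolding linf_norm_def
  proof (intro Max.boundedI)
    fix b assume "b \<in> (\<lambda>i. \<bar>yb $ i\<bar>) ` {..<dim_vec yb}"
    then obtain k where k: "k < 2 * d + 1" "b = \<bar>yb $ k\<bar>" using ybc by auto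
    have "b = \<bar>\<kappa> * y $ k + r $ k\<bar>" using k yc rc unfolding yb y0_def by simp
    also have "\<dots> \<le> \<kappa> * \<bar>y $ k\<bar> + 1 / 2" using rk[OF k(1)] \<kappa> abs_triangle_ineq[of "\<kappa> * y $ k" "r $ k"] by (simp add: abs_mult)
    also have "\<kappa> * \<bar>y $ k\<bar> \<le> \<kappa> * (real (d + 1) / \<epsilon>)" using ybound[OF k(1)] \<kappa> by (intro mult_left_mono) auto
    finally show "b \<le> 1 / 2 + \<kappa> * (real (d + 1) / \<epsilon>)" by simp
  qed (use ybc in auto)
  also have "\<kappa> * (real (d + 1) / \<epsilon>) = (sqrt ((2 * real d + 1) / 2) * real (d + 1)) * (g * (l2_norm t / \<epsilon>))"
    by (simp add: \<kappa>_def)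
  also have "\<dots> \<le> (4 * real d powr (3 / 2)) * (g * (l2_norm t / \<epsilon>))"
  proof (rule mult_right_mono)
    \<comment> \<open>For \<open>d \<ge> 1\<close> one has
      \<open>(2 * d + 1) / 2 \<le> 4 * d\<close> and \<open>d + 1 \<le> 2 * d\<close>; the two
      factors 2 that result make up the 4.\<close>
    have "sqrt ((2 * real d + 1) / 2) \<le> sqrt (4 * real d)" using d by (intro real_sqrt_le_mono) auto
    also have "\<dots> = 2 * sqrt (real d)" by (simp add: real_sqrt_mult)
    finally have "sqrt ((2 * real d + 1) / 2) * real (d + 1) \<le> (2 * sqrt (real d)) * (2 * real d)"
      using d by (intro mult_mono) auto
    also have "\<dots> = 4 * (real d powr 1 * real d powr (1 / 2))" using d by (simp add: powr_half_sqrt)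
    also have "\<dots> = 4 * real d powr (3 / 2)" unfolding powr_add[symmetric] by simp
    finally show "sqrt ((2 * real d + 1) / 2) * real (d + 1) \<le> 4 * real d powr (3 / 2)" .
  qed (use \<epsilon> in \<open>simp add: g_def\<close>)
  finally have "linf_norm yb \<le> 1 / 2 + 4 * real d powr (3 / 2) * g * (l2_norm t / \<epsilon>)" by (simp only: mult.assoc add_left_mono)
  moreover have "integer_vec yb" by (simp add: integer_vec_def yb_def)
  ultimately show "\<exists>y. y \<in> vec_top (2 * d + 1) interior_of sos_dual d \<and> integer_vec y \<and> dual_certificate d y t \<and>
      linf_norm y \<le> 1 / 2 + 4 * real d powr (3 / 2) * 3.21 powr (real d + 1 / 2) * (l2_norm t / \<epsilon>)"
    using cert unfolding g_def by (intro exI[of _ yb]) (auto simp: dual_certificate_def)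
qed

text \<open>From \<open>\<epsilon> \<le> T\<close> the main term \<open>A\<close> is at least 1, so
  doubling it absorbs the 1/2. With \<open>ln x \<le> x - 1\<close> at 8, at \<open>d\<close> and at
  3.21, the constant term is at most \<open>7 + 221 / 200\<close> and the coefficient of
  \<open>d\<close> at most \<open>3 / 2 + 221 / 100\<close>; 9 exceeds both.\<close>

lemma ln_certificate_bound:
  assumes d: "d \<ge> 1" and \<epsilon>: "0 < \<epsilon>" "\<epsilon> \<le> T" and x: "0 \<le> x"
    "x \<le> 1 / 2 + 4 * real d powr (3 / 2) * 3.21 powr (real d + 1 / 2) * (T / \<epsilon>)"
  shows "ln x \<le> 9 * (1 + real d + ln T + ln (1 / \<epsilon>))"
proof -
  define A where "A = 4 * real d powr (3 / 2) * 3.21 powr (real d + 1 / 2) * (T / \<epsilon>)"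
  have Te: "1 \<le> T / \<epsilon>" using \<epsilon> by simp
  have d1: "1 \<le> real d powr (3 / 2)" using d by (intro ge_one_powr_ge_zero) auto
  have g1: "1 \<le> (3.21::real) powr (real d + 1 / 2)" by (intro ge_one_powr_ge_zero) auto
  have L: "ln (T / \<epsilon>) = ln T + ln (1 / \<epsilon>)" using \<epsilon> by (simp add: ln_div)
  have L0: "0 \<le> ln (T / \<epsilon>)" using Te by simp
  show ?thesis
  proof (cases "x = 0")
    \<comment> \<open>\<open>ln 0 = 0\<close>, and the right side is nonnegative because
      \<open>T / \<epsilon>\<close> is at least 1.\<close>
    case True
    then show ?thesis using L L0 by simp
  next
    case False
    have "1 * 1 * 1 * 1 \<le> A" unfolding A_def using d1 g1 Te by (intro mult_mono) auto
    then have "x \<le> 2 * A" using x(2) unfolding A_def[symmetric] by simp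
    then have "ln x \<le> ln (2 * A)" using False x(1) by (intro ln_mono) auto
    also have "2 * A = 8 * real d powr (3 / 2) * 3.21 powr (real d + 1 / 2) * (T / \<epsilon>)" by (simp add: A_def)
    also have "ln \<dots> = ln 8 + 3 / 2 * ln (real d) + (real d + 1 / 2) * ln 3.21 + ln (T / \<epsilon>)"
    proof -
      have "ln (a * b * c * e) = ln a + ln b + ln c + ln e" if "0 < a" "0 < b" "0 < c" "0 < e" for a b c e :: real
        using that by (simp add: ln_mult)
      from this[of 8 "real d powr (3 / 2)" "3.21 powr (real d + 1 / 2)" "T / \<epsilon>"] show ?thesis
        using d \<epsilon> by (simp only: ln_powr) simp
    qed
    also have "\<dots> \<le> 7 + 3 / 2 * real d + (221 / 100 * real d + 221 / 200) + ln (T / \<epsilon>)"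
    proof -
      have "ln (8::real) \<le> 7" using ln_le_minus_one[of "8::real"] by simp
      moreover have "ln (real d) \<le> real d" using d ln_le_minus_one[of "real d"] by simp
      moreover have "(real d + 1 / 2) * ln 3.21 \<le> (real d + 1 / 2) * (221 / 100)"
        using ln_le_minus_one[of "3.21::real"] by (intro mult_left_mono) auto
      then have "(real d + 1 / 2) * ln 3.21 \<le> 221 / 100 * real d + 221 / 200"
        by (simp add: algebra_simps)
      ultimately show ?thesis by linarith
    qed
    also have "\<dots> \<le> 9 * (1 + real d + ln (T / \<epsilon>))"
    proof -
      have "7 + 3 / 2 * a + (221 / 100 * a + 221 / 200) + l \<le> 9 * (1 + a + l)" if "0 \<le> a" "0 \<le> l" for a l :: real
        using that by (simp add: field_simps)
      then show ?thesis using L0 by simp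
    qed
    finally show ?thesis unfolding L by (simp add: add.assoc)
  qed
qed

lemma linf_norm_nonneg: "dim_vec v > 0 \<Longrightarrow> 0 \<le> linf_norm v"
  unfolding linf_norm_def by (rule order.trans[OF abs_ge_zero Max_ge]) auto

lemma integer_certificate_bounds:
  assumes d: "d \<ge> 1" and a: "t \<in> vec_top (2 * d + 1) interior_of sos_cone d" "\<epsilon> > 0"
    "t - \<epsilon> \<cdot>\<^sub>v e_vec d \<in> vec_top (2 * d + 1) frontier_of sos_cone d"
  shows "\<exists>y :: real vec. y \<in> vec_top (2 * d + 1) interior_of sos_dual d \<and> integer_vec y \<and>
    dual_certificate d y t \<and>
    linf_norm y \<le> 1 / 2 + 4 * real d powr (3 / 2) * 3.21 powr (real d + 1 / 2) * (real_of_int \<lceil>l2_norm t\<rceil> / \<epsilon>) \<and>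
    ln (linf_norm y) \<le> 9 * (1 + real d + ln (l2_norm t) + ln (1 / \<epsilon>))"
proof -
  obtain y where y: "y \<in> vec_top (2 * d + 1) interior_of sos_dual d" "integer_vec y" "dual_certificate d y t"
    and le: "linf_norm y \<le> 1 / 2 + 4 * real d powr (3 / 2) * 3.21 powr (real d + 1 / 2) * (l2_norm t / \<epsilon>)"
    using integer_certificate(2)[OF d a] by blast
  have "y \<in> coeff_space d" using y(1) by (simp add: interior_of_vec_top)
  then have "0 \<le> linf_norm y" by (intro linf_norm_nonneg) auto
  note ln_certificate_bound[OF d a(2) integer_certificate(1)[OF d a] this le]
  moreover have "linf_norm y \<le> 1 / 2 + 4 * real d powr (3 / 2) * 3.21 powr (real d + 1 / 2) * (real_of_int \<lceil>l2_norm t\<rceil> / \<epsilon>)"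
  proof (rule order.trans[OF le], intro add_left_mono mult_left_mono divide_right_mono)
    show "l2_norm t \<le> real_of_int \<lceil>l2_norm t\<rceil>" by (rule le_of_int_ceiling)
  qed (use a(2) in auto)
  ultimately show ?thesis using y by blast
qed

theorem theorem3p1:
  shows "\<exists>C::real. \<forall>d::nat. d \<ge> 1 \<longrightarrow>
    (e_vec d = coeff_vec d (\<Sum>i\<le>d. monom 1 (2 * i)) \<and>
     (\<exists>k \<in> k1_values d (e_vec d). (\<forall>r \<in> k1_values d (e_vec d). k \<le> r) \<and> k \<ge> 1)) \<and>
    (\<exists>(s::nat) (z :: nat \<Rightarrow> real) (\<alpha> :: nat \<Rightarrow> real).
       inj_on z {1..s} \<and> unisolvent (2 * d) (z ` {1..s}) \<and> (\<forall>i \<in> {1..s}. \<alpha> i > 0) \<and>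
       cond_number (moment_mat d s z \<alpha>) \<le> 3.21 ^ (2 * d + 1) / 2) \<and>
    (\<forall>(t :: real vec) (\<epsilon>::real).
       t \<in> vec_top (2 * d + 1) interior_of sos_cone d \<and> \<epsilon> > 0 \<and>
       t - \<epsilon> \<cdot>\<^sub>v e_vec d \<in> vec_top (2 * d + 1) frontier_of sos_cone d \<longrightarrow>
       (\<exists>y :: real vec. y \<in> vec_top (2 * d + 1) interior_of sos_dual d \<and> integer_vec y \<and>
          dual_certificate d y t \<and>
          linf_norm y \<le> 1 / 2 + 4 * real d powr (3 / 2) * 3.21 powr (real d + 1 / 2)
                            * (real_of_int \<lceil>l2_norm t\<rceil> / \<epsilon>) \<and>
          ln (linf_norm y) \<le> C * (1 + real d + ln (l2_norm t) + ln (1 / \<epsilon>))))"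
  by (rule exI[of _ 9], intro allI impI conjI e_vec_eq k1_min well_conditioned_moment_mat)
    (elim conjE, rule integer_certificate_bounds)

end
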